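(* Closure and opening are inverse bijections between the set of balanced blossom trees of total charge $1$ and the set of $1$-leg maps. Both maps preserve the degree distribution $(\lambda,\mu)$.
   Context: All maps are planar, connected, considered up to orientation-preserving homeomorphism, and bipartite: vertices are black or white and each edge joins a black and a white vertex. Maps may carry half-edges attached to single vertices and lying in the infinite face. A half-edge at a white vertex is a leaf; one at a black vertex is a bud. Maps are rooted at a half-edge. Degrees count edges and half-edges. The degree distribution $(\lambda,\mu)$ is the pair of multisets of degrees of white vertices and of black vertices. A $k$-leg map is such a map with exactly $k$ leaves and no buds, rooted at one of its leaves. A tree is such a map with a single face. The charge of a tree is the number of leaves minus the number of buds, not counting the root half-edge; the total charge counts it. For an edge $e$ of a tree $T$, cutting $e$ into a leaf at its white end and a bud at its black end yields $T_e^\bullet$ (containing the black end) and $T_e^\circ$ (containing the white end), each rooted at its new half-edge. The lower subtree at $e$ is the one not containing the root. A blossom tree is a tree such that, for every edge $e$: the lower subtree has charge $\ge0$ if it is $T_e^\circ$, and charge $\le1$ if it is $T_e^\bullet$. Closure. Let $T$ be a tree of total charge $k\ge1$. Its half-edges form a cyclic sequence when going around $T$ counterclockwise. Match buds and leaves like opening and closing brackets: repeatedly match a bud immediately followed (among the still unmatched half-edges) by a leaf, until no such pair remains. Exactly $k$ leaves remain unmatched; these are the single leaves. $T$ is balanced if it is rooted at a single leaf. The closure $\phi(T)$ of a balanced tree fuses each matched bud–leaf pair into an edge, drawn counterclockwise around the tree without crossings, and keeps the root. The result is a $k$-leg map. Opening. The opening $\psi(M)$ of a $k$-leg map $M$ is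 defined as follows. Walk around the infinite face counterclockwise starting from the root. Each time a non-separating edge has just been traversed from its black endpoint to its white endpoint, cut it into a bud at the black end and a leaf at the white end. Continue until all edges are separating; the result is a tree rooted at the original root leaf. *)

theory Defs
  imports
    "HOL-Library.Multiset"
    "HOL-Library.While_Combinator"
    "HOL-Combinatorics.Combinatorics"
begin

section \<open>Rooted bipartite planar maps with half-edges\<close>

text \<open>
  Maps are encoded as rotation systems. Each edge consists of two darts, one at each end, and
  each half-edge is a single dart. The permutation \<open>rot\<close> sends a dart to the next
  one counterclockwise around its vertex, so vertices are the cycles of \<open>rot\<close>. The
  involution \<open>opp\<close> exchanges the two darts of an edge and fixes the half-edges.
  The colour of a vertex is recorded on all of its darts. Values outside \<open>darts\<close> carry no
  information; they are the identity for the permutations and arbitrary for the colour.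
\<close>

record 'a pmap =
  darts :: "'a set"
  rot :: "'a \<Rightarrow> 'a"
  opp :: "'a \<Rightarrow> 'a"
  white :: "'a \<Rightarrow> bool"
  root_dart :: 'a

definition half_edges :: "'a pmap \<Rightarrow> 'a set" where
  "half_edges M = {d \<in> darts M. opp M d = d}"

definition leaves :: "'a pmap \<Rightarrow> 'a set" where
  "leaves M = {d \<in> half_edges M. white M d}"

definition buds :: "'a pmap \<Rightarrow> 'a set" where
  "buds M = {d \<in> half_edges M. \<not> white M d}"

text \<open>The darts that belong to an edge; the edge is denoted by either of its two darts.\<close>

definition edge_darts :: "'a pmap \<Rightarrow> 'a set" where
  "edge_darts M = {d \<in> darts M. opp M d \<noteq> d}"

definition vertices :: "'a pmap \<Rightarrow> 'a set set" where
  "vertices M = orbit (rot M) ` darts M"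

definition edges :: "'a pmap \<Rightarrow> 'a set set" where
  "edges M = (\<lambda>d. {d, opp M d}) ` edge_darts M"

text \<open>
  A walker keeping a face on the right leaves a vertex along \<open>d\<close>, arrives along \<open>opp d\<close> (or
  turns around the tip of the half-edge \<open>d\<close>) and then leaves along \<open>rot (opp d)\<close>.
  With the infinite face on the right, this walk goes counterclockwise around the map.
\<close>

definition next_dart :: "'a pmap \<Rightarrow> 'a \<Rightarrow> 'a" where
  "next_dart M d = rot M (opp M d)"

definition faces :: "'a pmap \<Rightarrow> 'a set set" where
  "faces M = orbit (next_dart M) ` darts M"

definition dart_graph :: "'a pmap \<Rightarrow> ('a \<times> 'a) set" where
  "dart_graph M = {(d, rot M d) | d. d \<in> darts M} \<union> {(d, opp M d) | d. d \<in> darts M}"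

definition component :: "'a pmap \<Rightarrow> 'a \<Rightarrow> 'a set" where
  "component M d = (dart_graph M)\<^sup>* `` {d}"

definition connected_map :: "'a pmap \<Rightarrow> bool" where
  "connected_map M \<longleftrightarrow> (\<forall>d \<in> darts M. component M d = darts M)"

text \<open>
  Planarity is Euler's formula for connected rotation systems. The infinite face is the one
  containing the root half-edge, and all half-edges have to lie in it.
\<close>

definition is_map :: "'a pmap \<Rightarrow> bool" where
  "is_map M \<longleftrightarrow>
     finite (darts M) \<and>
     rot M permutes darts M \<and>
     opp M permutes darts M \<and>
     (\<forall>d \<in> darts M. opp M (opp M d) = d) \<and>
     (\<forall>d \<in> darts M. white M (rot M d) = white M d) \<and>
     (\<forall>d \<in> edge_darts M. white M (opp M d) \<noteq> white M d) \<and>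
     connected_map M \<and>
     card (vertices M) + card (faces M) = card (edges M) + 2 \<and>
     root_dart M \<in> half_edges M \<and>
     half_edges M \<subseteq> orbit (next_dart M) (root_dart M)"

text \<open>The multiset of the degrees of the white vertices and that of the black vertices.\<close>

definition degree_distribution :: "'a pmap \<Rightarrow> nat multiset \<times> nat multiset" where
  "degree_distribution M =
     (image_mset card (mset_set (orbit (rot M) ` {d \<in> darts M. white M d})),
      image_mset card (mset_set (orbit (rot M) ` {d \<in> darts M. \<not> white M d})))"

definition is_leg_map :: "nat \<Rightarrow> 'a pmap \<Rightarrow> bool" where
  "is_leg_map k M \<longleftrightarrow>
     is_map M \<and> card (leaves M) = k \<and> buds M = {} \<and> root_dart M \<in> leaves M"

section \<open>Maps up to homeomorphism\<close>

text \<open>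
  Orientation-preserving homeomorphisms of rooted maps correspond to root-preserving bijections
  of the darts that commute with the structure maps.
\<close>

definition is_iso :: "('a \<Rightarrow> 'a) \<Rightarrow> 'a pmap \<Rightarrow> 'a pmap \<Rightarrow> bool" where
  "is_iso f M N \<longleftrightarrow>
     bij_betw f (darts M) (darts N) \<and>
     (\<forall>d \<in> darts M. f (rot M d) = rot N (f d)) \<and>
     (\<forall>d \<in> darts M. f (opp M d) = opp N (f d)) \<and>
     (\<forall>d \<in> darts M. white N (f d) = white M d) \<and>
     f (root_dart M) = root_dart N"

definition map_iso :: "('a pmap \<times> 'a pmap) set" where
  "map_iso = {(M, N). is_map M \<and> is_map N \<and> (\<exists>f. is_iso f M N)}"

lemma equiv_map_iso: "equiv (Collect is_map) (map_iso :: ('a pmap \<times> 'a pmap) set)"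
proof (rule equivI)
  show "refl_on (Collect is_map) (map_iso :: ('a pmap \<times> 'a pmap) set)"
    by (rule refl_onI) (auto simp: map_iso_def is_iso_def bij_betw_def intro: exI[where x = "\<lambda>d. d"])
  show "sym (map_iso :: ('a pmap \<times> 'a pmap) set)"
  proof (rule symI)
    fix M N :: "'a pmap"
    assume "(M, N) \<in> map_iso"
    then obtain f where maps: "is_map M" "is_map N" and f: "is_iso f M N"
      by (auto simp: map_iso_def)
    let ?g = "inv_into (darts M) f"
    have bij: "bij_betw f (darts M) (darts N)"
      using f by (simp add: is_iso_def)
    have inj: "inj_on f (darts M)"
      using bij by (rule bij_betw_imp_inj_on)
    have rM: "rot M d \<in> darts M" and oM: "opp M d \<in> darts M" if "d \<in> darts M" for d
      using maps(1) that by (auto simp: is_map_def permutes_in_image)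
    have root: "root_dart M \<in> darts M"
      using maps(1) by (auto simp: is_map_def half_edges_def)
    have "is_iso ?g N M"
      unfolding is_iso_def
    proof (intro conjI ballI)
      show "bij_betw ?g (darts N) (darts M)"
        using bij by (rule bij_betw_inv_into)
    next
      fix d assume "d \<in> darts N"
      then obtain e where e: "e \<in> darts M" "d = f e"
        using bij by (auto simp: bij_betw_def)
      have ge: "?g d = e"
        using inv_into_f_f[OF inj e(1)] e(2) by simp
      show "?g (rot N d) = rot M (?g d)"
        using f e ge inv_into_f_f[OF inj rM[OF e(1)]] by (simp add: is_iso_def)
      show "?g (opp N d) = opp M (?g d)"
        using f e ge inv_into_f_f[OF inj oM[OF e(1)]] by (simp add: is_iso_def)
      show "white M (?g d) = white N d"
        using f e ge by (simp add: is_iso_def)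
    next
      show "?g (root_dart N) = root_dart M"
        using f inv_into_f_f[OF inj root] by (simp add: is_iso_def)
    qed
    then show "(N, M) \<in> map_iso"
      using maps by (auto simp: map_iso_def)
  qed
  show "trans (map_iso :: ('a pmap \<times> 'a pmap) set)"
  proof (rule transI)
    fix L M N :: "'a pmap"
    assume "(L, M) \<in> map_iso" "(M, N) \<in> map_iso"
    then obtain f g where maps: "is_map L" "is_map N"
      and f: "is_iso f L M" and g: "is_iso g M N"
      by (auto simp: map_iso_def)
    have fd: "f d \<in> darts M" if "d \<in> darts L" for d
      using f that by (auto simp: is_iso_def bij_betw_def)
    have "is_iso (g \<circ> f) L N"
      using f g fd bij_betw_trans[of f "darts L" "darts M" g "darts N"]
      by (simp add: is_iso_def)
    then show "(L, N) \<in> map_iso"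
      using maps by (auto simp: map_iso_def)
  qed
qed (auto simp: map_iso_def)

text \<open>
  The induced operation on isomorphism classes. Representatives \<open>M\<close> for which \<open>F M\<close> is not a map
  contribute nothing. \<open>F\<close> is well defined on a class \<open>C\<close> if \<open>on_classes F C\<close> is again a class and
  contains \<open>F M\<close> for all \<open>M \<in> C\<close>.
\<close>

definition on_classes :: "('a pmap \<Rightarrow> 'a pmap) \<Rightarrow> 'a pmap set \<Rightarrow> 'a pmap set" where
  "on_classes F C = map_iso `` (F ` C)"

section \<open>Blossom trees\<close>

definition is_tree :: "'a pmap \<Rightarrow> bool" where
  "is_tree T \<longleftrightarrow> is_map T \<and> card (faces T) = 1"

definition charge :: "'a pmap \<Rightarrow> int" where
  "charge T = int (card (leaves T - {root_dart T})) - int (card (buds T - {root_dart T}))"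

definition total_charge :: "'a pmap \<Rightarrow> int" where
  "total_charge T = int (card (leaves T)) - int (card (buds T))"

text \<open>
  Cutting an edge turns both of its darts into half-edges: a leaf at the white end and a bud at
  the black end.
\<close>

definition cut :: "'a pmap \<Rightarrow> 'a \<Rightarrow> 'a pmap" where
  "cut M d = M\<lparr>opp := (opp M)(d := d, opp M d := opp M d)\<rparr>"

text \<open>
  The subtree on the side of \<open>d\<close> after cutting the edge of \<open>d\<close>, rooted at the new half-edge
  \<open>d\<close>. It is the tree at the white end of the edge if \<open>d\<close> is white, and the one at the black
  end otherwise.
\<close>

definition subtree :: "'a pmap \<Rightarrow> 'a \<Rightarrow> 'a pmap" where
  "subtree T d =
     (let C = component (cut T d) d
      in \<lparr>darts = C, rot = perm_restrict (rot T) C, opp = perm_restrict (opp (cut T d)) C,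
          white = white T, root_dart = d\<rparr>)"

definition is_blossom_tree :: "'a pmap \<Rightarrow> bool" where
  "is_blossom_tree T \<longleftrightarrow>
     is_tree T \<and>
     (\<forall>d \<in> edge_darts T. root_dart T \<notin> darts (subtree T d) \<longrightarrow>
        (if white T d then charge (subtree T d) \<ge> 0 else charge (subtree T d) \<le> 1))"

section \<open>Closure\<close>

text \<open>
  \<open>l\<close> is the first element of \<open>U\<close> met after \<open>b\<close> when going around the map counterclockwise.
\<close>

definition followed_by :: "'a pmap \<Rightarrow> 'a set \<Rightarrow> 'a \<Rightarrow> 'a \<Rightarrow> bool" where
  "followed_by T U b l \<longleftrightarrow>
     l \<in> U \<and> (\<exists>n > 0. (next_dart T ^^ n) b = l \<and>
                (\<forall>m. 0 < m \<and> m < n \<longrightarrow> (next_dart T ^^ m) b \<notin> U))"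

text \<open>
  The state of the matching procedure is the set \<open>P\<close> of pairs (bud, leaf) matched so far;
  the half-edges in \<open>Field P\<close> are those that have been matched.
\<close>

inductive match_step :: "'a pmap \<Rightarrow> ('a \<times> 'a) set \<Rightarrow> ('a \<times> 'a) set \<Rightarrow> bool" for T where
  "b \<in> buds T - Field P \<Longrightarrow> l \<in> leaves T - Field P \<Longrightarrow>
   followed_by T (half_edges T - Field P) b l \<Longrightarrow> match_step T P (insert (b, l) P)"

definition matching :: "'a pmap \<Rightarrow> ('a \<times> 'a) set" where
  "matching T = (THE P. (match_step T)\<^sup>*\<^sup>* {} P \<and> (\<nexists>Q. match_step T P Q))"

definition single_leaves :: "'a pmap \<Rightarrow> 'a set" where
  "single_leaves T = leaves T - Field (matching T)"

definition is_balanced :: "'a pmap \<Rightarrow> bool" where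
  "is_balanced T \<longleftrightarrow> root_dart T \<in> single_leaves T"

text \<open>
  Fusing leaves the cyclic order of darts around every vertex unchanged. The drawing of the new
  edges is determined by this order and by the fact that the root remains in the infinite face.
\<close>

definition map_closure :: "'a pmap \<Rightarrow> 'a pmap" where
  "map_closure T =
     T\<lparr>opp := \<lambda>d. if d \<in> Field (matching T)
                   then THE e. (d, e) \<in> matching T \<or> (e, d) \<in> matching T
                   else opp T d\<rparr>"

section \<open>Opening\<close>

definition separating :: "'a pmap \<Rightarrow> 'a \<Rightarrow> bool" where
  "separating M d \<longleftrightarrow> \<not> connected_map (cut M d)"

text \<open>
  The state of the walk is the current map and the dart about to be traversed. An edge cut
  right after its traversal leaves the walker just past the new leaf, at its white end.
\<close>

definition opening_step :: "'a pmap \<times> 'a \<Rightarrow> 'a pmap \<times> 'a" where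
  "opening_step = (\<lambda>(M, d).
     (if d \<in> edge_darts M \<and> \<not> white M d \<and> \<not> separating M d then cut M d else M,
      next_dart M d))"

definition map_opening :: "'a pmap \<Rightarrow> 'a pmap" where
  "map_opening M =
     fst (while (\<lambda>(N, d). \<exists>e \<in> edge_darts N. \<not> separating N e) opening_step (M, root_dart M))"

section \<open>The two sets of maps\<close>

text \<open>Every finite map has a copy with natural numbers as darts.\<close>

definition balanced_blossom_trees :: "nat \<Rightarrow> nat pmap set set" where
  "balanced_blossom_trees k =
     {T. is_blossom_tree T \<and> total_charge T = int k \<and> is_balanced T} // map_iso"

definition leg_maps :: "nat \<Rightarrow> nat pmap set set" where
  "leg_maps k = {M. is_leg_map k M} // map_iso"

end

theory Submission
  imports Defs "HOL-Library.Confluence"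
begin

text \<open>
  Number the darts of a tree along its contour from the root, and let the depth of a dart be the
  number of matched pairs (bud, leaf) that enclose it. The lower subtree at an edge is an interval
  of the contour, and its charge is the difference of the depths at the two ends of that interval.
  So the blossom conditions say: if \<open>x\<close> is a traversal of an edge from black to white, then the
  opposite traversal comes lexicographically, in (depth, position), strictly before \<open>x\<close> with its
  depth increased by one. The walk that opens the closure of the tree visits the contour exactly in
  this lexicographic order, one turn per depth, and the condition ensures that it cuts precisely
  the fused pairs. Conversely, cutting the edges of a leg map in this order yields a tree that
  satisfies the condition and whose matching consists of the edges cut. Planarity enters through
  Euler's inequality: an edge of a planar map is separating if and only if both its sides lie in
  the same face.
\<close>

section \<open>Orbits of a permutation\<close>

text \<open>A pair with both or none of its half-edges in a lower subtree contributes nothing to its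
  charge. What remains are the pairs that enclose exactly one end of the interval, whence the
  difference of the depths. The obstacle is that every cut changes the faces and hence the
  positions. In opening a closure, the contour of the final tree is used throughout: each
  intermediate map is that tree with part of its pairs still fused, and the walk only makes this
  part smaller. For an arbitrary leg map no such tree is given, and the loop is not followed there.
  Instead, the edge that comes first in the order among those with their other side outside the root
  face is cut, again and again. Each cut inserts a whole face into the contour without changing the
  depths or the relative order of the darts already there. The tree so obtained has the leg map as
  its closure, and what is known about closures then says that the loop stops with this
  tree.\<close>

lemma orbit_eq:
  assumes "permutation p" "y \<in> orbit p x"
  shows "orbit p y = orbit p x"
  using orbit_cyclic_eq3[OF cyclic_on_orbit'[OF assms(1)] assms(2)] .

lemma orbit_sym:
  assumes "permutation p" "y \<in> orbit p x"
  shows "x \<in> orbit p y"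
  using assms orbit_eq permutation_self_in_orbit by metis

lemma orbit_subset_closed:
  assumes "x \<in> A" "\<And>y. y \<in> A \<Longrightarrow> f y \<in> A"
  shows "orbit f x \<subseteq> A"
proof
  fix y assume "y \<in> orbit f x" then show "y \<in> A"
    by induct (use assms in auto)
qed

text \<open>After \<open>a\<close> the new permutation continues with \<open>p b\<close> and follows
  the old cycle of \<open>b\<close>, which avoids \<open>a\<close>, until it arrives at
  \<open>b\<close>.\<close>

lemma orbit_transpose_merge:
  assumes p: "permutation p" and b: "b \<notin> orbit p a"
  shows "b \<in> orbit (p \<circ> transpose a b) a"
proof -
  have "x \<in> orbit (p \<circ> transpose a b) a" if "x \<in> orbit p b" for x
    using that
  proof induct
    case base
    show ?case by (rule orbit_eqI(1)) simp
  next
    case (step x)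
    have "x \<noteq> a" using step(1) b orbit_sym[OF p] by auto
    show ?case
    proof (cases "x = b")
      case True
      then show ?thesis by (intro orbit_eqI(1)) simp
    next
      case False
      then show ?thesis using \<open>x \<noteq> a\<close> step(2) by (intro orbit_eqI(2)[OF _ step(2)]) simp
    qed
  qed
  then show ?thesis using permutation_self_in_orbit[OF p] by blast
qed

text \<open>The stretch of the cycle from \<open>p a\<close> to \<open>b\<close> becomes closed,
  because \<open>b\<close> is now followed by \<open>p a\<close>. As \<open>a\<close> lies outside
  this stretch, the new orbit of \<open>b\<close> misses it.\<close>

lemma orbit_transpose_split:
  assumes p: "permutation p" and b: "b \<in> orbit p a" and ab: "a \<noteq> b"
  shows "b \<notin> orbit (p \<circ> transpose a b) a"
proof -
  define k where "k = funpow_dist1 p a b"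
  define A where "A = {(p ^^ i) a | i. 0 < i \<and> i \<le> k}"
  have kb: "(p ^^ k) a = b" and k0: "0 < k"
    using funpow_dist1_prop[OF b] by (simp_all only: k_def zero_less_Suc)
  have k_least: "(p ^^ m) a \<noteq> b" if "0 < m" "m < k" for m
    using funpow_dist1_least[of m p a b] that by (simp add: k_def)
  have "a \<notin> A"
  proof
    assume "a \<in> A"
    then obtain i where i: "0 < i" "i \<le> k" "(p ^^ i) a = a" unfolding A_def by auto
    have "i \<noteq> k" using i(3) kb ab by auto
    \<comment> \<open>A return to \<open>a\<close> after \<open>i\<close> steps would bring the
      first visit of \<open>b\<close> forward to step \<open>k - i\<close>, against the minimality
      of \<open>k\<close>.\<close>
    have "(p ^^ (k - i)) a = (p ^^ (k - i)) ((p ^^ i) a)" using i by simp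
    also have "\<dots> = (p ^^ ((k - i) + i)) a" by (simp only: funpow_add o_apply)
    also have "\<dots> = b" using i(2) kb by simp
    finally show False using k_least[of "k - i"] i \<open>i \<noteq> k\<close> by simp
  qed
  moreover have "orbit (p \<circ> transpose a b) b \<subseteq> A"
  proof (rule orbit_subset_closed)
    show "b \<in> A" using kb k0 unfolding A_def by auto
  next
    fix y assume "y \<in> A"
    then obtain i where i: "0 < i" "i \<le> k" "y = (p ^^ i) a" unfolding A_def by auto
    show "(p \<circ> transpose a b) y \<in> A"
    proof (cases "y = b")
      case True
      have "p a \<in> A" unfolding A_def using k0 by (auto intro!: exI[of _ 1])
      then show ?thesis using True by simp
    next
      case False
      then have "i \<noteq> k" using i kb by auto
      have "y \<noteq> a" using \<open>y \<in> A\<close> \<open>a \<notin> A\<close> by auto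
      have "p y \<in> A" unfolding A_def using i \<open>i \<noteq> k\<close> by (auto intro!: exI[of _ "Suc i"])
      then show ?thesis using False \<open>y \<noteq> a\<close> by simp
    qed
  qed
  moreover have "permutation (p \<circ> transpose a b)"
    by (intro permutation_compose p) (simp add: permutation_swap_id)
  ultimately show ?thesis using orbit_sym[of "p \<circ> transpose a b" b a] by blast
qed

lemma orbit_transpose_other:
  assumes p: "permutation p" and "a \<notin> orbit p x" "b \<notin> orbit p x"
  shows "orbit (p \<circ> transpose a b) x = orbit p x"
proof (rule orbit_cong[OF permutation_self_in_orbit[OF p]])
  fix s assume "s \<in> orbit p x"
  then have "s \<noteq> a" "s \<noteq> b" using assms by auto
  then show "(p \<circ> transpose a b) s = p s" by simp
qed

text \<open>The orbits of \<open>a\<close> and \<open>b\<close> are the only ones lost, and the new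
  orbit of \<open>a\<close> is not among the old ones that survive. An inequality is enough: where
  an equality is wanted, Euler's inequality supplies the other half.\<close>

lemma card_orbits_transpose_merge:
  assumes S: "finite S" and p: "permutation p"
    and ab: "a \<in> S" "b \<in> S" and b: "b \<notin> orbit p a"
  shows "card (orbit p ` S) \<le> card (orbit (p \<circ> transpose a b) ` S) + 1"
proof -
  let ?q = "p \<circ> transpose a b"
  let ?R = "orbit p ` S - {orbit p a, orbit p b}"
  have q: "permutation ?q" by (intro permutation_compose p) (simp add: permutation_swap_id)
  have R: "?R \<subseteq> orbit ?q ` S"
  proof
    fix C assume "C \<in> ?R"
    then obtain x where x: "x \<in> S" "C = orbit p x" "orbit p x \<noteq> orbit p a" "orbit p x \<noteq> orbit p b" by auto
    then have "orbit ?q x = C" using orbit_transpose_other[OF p, of a x b] orbit_eq[OF p] by metis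
    then show "C \<in> orbit ?q ` S" using x by auto
  qed
  have "orbit ?q a \<notin> ?R"
  proof
    assume "orbit ?q a \<in> ?R"
    then obtain x where "orbit ?q a = orbit p x" "orbit p x \<noteq> orbit p a" by auto
    then show False using permutation_self_in_orbit[OF q, of a] orbit_eq[OF p] by metis
  qed
  then have "card ?R + 1 = card (insert (orbit ?q a) ?R)" using S by simp
  also have "\<dots> \<le> card (orbit ?q ` S)" using R ab S by (intro card_mono) auto
  finally have "card ?R + 1 \<le> card (orbit ?q ` S)" .
  moreover have "card (orbit p ` S) \<le> card ?R + 2"
    using diff_card_le_card_Diff[of "{orbit p a, orbit p b}" "orbit p ` S"] card_insert_le_m1[of 2 "{orbit p b}" "orbit p a"] by simp
  ultimately show ?thesis by simp
qed

lemma card_orbits_transpose_split: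
  assumes S: "finite S" and p: "permutation p"
    and ab: "a \<in> S" "b \<in> S" "a \<noteq> b" and b: "b \<in> orbit p a"
  shows "card (orbit p ` S) + 1 \<le> card (orbit (p \<circ> transpose a b) ` S)"
proof -
  let ?q = "p \<circ> transpose a b"
  let ?R = "orbit p ` S - {orbit p a}"
  have q: "permutation ?q" by (intro permutation_compose p) (simp add: permutation_swap_id)
  have pb: "orbit p b = orbit p a" using orbit_eq[OF p b] .
  have R: "?R \<subseteq> orbit ?q ` S"
  proof
    fix C assume "C \<in> ?R"
    then obtain x where x: "x \<in> S" "C = orbit p x" "orbit p x \<noteq> orbit p a" by auto
    then have "orbit ?q x = C" using orbit_transpose_other[OF p, of a x b] orbit_eq[OF p] pb by metis
    then show "C \<in> orbit ?q ` S" using x by auto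
  qed
  have nR: "orbit ?q c \<notin> ?R" if "c \<in> {a, b}" for c
  proof
    assume "orbit ?q c \<in> ?R"
    then obtain x where "orbit ?q c = orbit p x" "orbit p x \<noteq> orbit p a" by auto
    then show False using permutation_self_in_orbit[OF q, of c] orbit_eq[OF p] that pb by auto
  qed
  have "orbit ?q a \<noteq> orbit ?q b"
    using orbit_transpose_split[OF p b ab(3)] permutation_self_in_orbit[OF q, of b] by auto
  then have "card ?R + 2 = card (insert (orbit ?q a) (insert (orbit ?q b) ?R))"
    using nR[of a] nR[of b] S by simp
  also have "\<dots> \<le> card (orbit ?q ` S)" using R ab S by (intro card_mono) auto
  finally show ?thesis using S ab by (simp add: card_Diff_singleton)
qed

section \<open>Rotation systems and Euler's inequality\<close>

text \<open>This is the part of \<open>is_map\<close> that survives all constructions: cutting a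
  separating edge destroys connectedness, and the dual map in the proof of Euler's inequality does
  not respect the colours.\<close>

definition rotation_system :: "'a pmap \<Rightarrow> bool" where
  "rotation_system M \<longleftrightarrow> finite (darts M) \<and> rot M permutes darts M \<and> opp M permutes darts M \<and>
     (\<forall>d \<in> darts M. opp M (opp M d) = d)"

lemma is_map_rotation_system: "is_map M \<Longrightarrow> rotation_system M"
  by (simp add: is_map_def rotation_system_def)

lemma rotation_systemD:
  assumes "rotation_system M"
  shows "finite (darts M)" "rot M permutes darts M" "opp M permutes darts M"
    "opp M (opp M d) = d" "rot M d \<in> darts M \<longleftrightarrow> d \<in> darts M" "opp M d \<in> darts M \<longleftrightarrow> d \<in> darts M"
    "inj (opp M)" "inj (rot M)"
proof -
  show 1: "finite (darts M)" "rot M permutes darts M" "opp M permutes darts M"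
    using assms by (auto simp: rotation_system_def)
  show "opp M (opp M d) = d"
    using assms permutes_not_in[OF 1(3)] by (cases "d \<in> darts M") (auto simp: rotation_system_def)
  show "rot M d \<in> darts M \<longleftrightarrow> d \<in> darts M" "opp M d \<in> darts M \<longleftrightarrow> d \<in> darts M"
    using permutes_in_image 1 by metis+
  show "inj (opp M)" "inj (rot M)" using 1 permutes_inj by auto
qed

lemma next_dart_eq: "next_dart M = rot M \<circ> opp M"
  by (auto simp: next_dart_def)

lemma next_dart_permutes: "rotation_system M \<Longrightarrow> next_dart M permutes darts M"
  unfolding next_dart_eq by (intro permutes_compose) (auto simp: rotation_systemD)

lemma permutation_next_dart: "rotation_system M \<Longrightarrow> permutation (next_dart M)"
  using next_dart_permutes rotation_systemD(1) permutation_permutes by blast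

lemma next_dart_in_darts: "rotation_system M \<Longrightarrow> next_dart M d \<in> darts M \<longleftrightarrow> d \<in> darts M"
  using next_dart_permutes permutes_in_image by metis

lemma face_subset_darts: "rotation_system M \<Longrightarrow> d \<in> darts M \<Longrightarrow> orbit (next_dart M) d \<subseteq> darts M"
  using next_dart_permutes permutes_orbit_subset by metis

text \<open>A component is closed under \<open>rot\<close> and \<open>opp\<close> and lies in every
  closed set that contains its dart. In this form connectedness is proved and used without handling
  paths.\<close>

lemma connected_map_iff:
  assumes M: "rotation_system M"
  shows "connected_map M \<longleftrightarrow>
    (\<forall>A \<subseteq> darts M. A \<noteq> {} \<longrightarrow> (\<forall>x \<in> A. rot M x \<in> A \<and> opp M x \<in> A) \<longrightarrow> A = darts M)"
    (is "_ \<longleftrightarrow> ?R")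
proof
  assume c: "connected_map M"
  show ?R
  proof (intro allI impI)
    fix A assume A: "A \<subseteq> darts M" "A \<noteq> {}" "\<forall>x \<in> A. rot M x \<in> A \<and> opp M x \<in> A"
    then obtain d where d: "d \<in> A" by auto
    have "x \<in> A" if "(d, x) \<in> (dart_graph M)\<^sup>*" for x
      using that by induct (use d A(3) in \<open>auto simp: dart_graph_def\<close>)
    then have "component M d \<subseteq> A" by (auto simp: component_def)
    moreover have "component M d = darts M" using c d A(1) by (auto simp: connected_map_def)
    ultimately show "A = darts M" using A(1) by auto
  qed
next
  assume R: ?R
  show "connected_map M" unfolding connected_map_def
  proof
    fix d assume d: "d \<in> darts M"
    have sub: "component M d \<subseteq> darts M"
    proof
      fix x assume "x \<in> component M d"
      then have "(d, x) \<in> (dart_graph M)\<^sup>*" by (simp add: component_def)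
      then show "x \<in> darts M"
        by induct (use d M in \<open>auto simp: dart_graph_def rotation_systemD\<close>)
    qed
    have "rot M x \<in> component M d \<and> opp M x \<in> component M d" if x: "x \<in> component M d" for x
    proof -
      have "x \<in> darts M" using x sub by auto
      then have "(x, rot M x) \<in> dart_graph M" "(x, opp M x) \<in> dart_graph M"
        by (auto simp: dart_graph_def)
      then show ?thesis using x by (auto simp: component_def intro: rtrancl_into_rtrancl)
    qed
    then show "component M d = darts M"
      using R[rule_format, OF sub] by (auto simp: component_def)
  qed
qed

lemma connected_mapD:
  assumes "rotation_system M" "connected_map M" "A \<subseteq> darts M" "x \<in> A"
    "\<And>x. x \<in> A \<Longrightarrow> rot M x \<in> A" "\<And>x. x \<in> A \<Longrightarrow> opp M x \<in> A"
  shows "A = darts M"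
  using assms connected_map_iff by (metis equals0D)

lemma connected_mapI:
  assumes "rotation_system M"
    "\<And>A x. A \<subseteq> darts M \<Longrightarrow> x \<in> A \<Longrightarrow> (\<And>x. x \<in> A \<Longrightarrow> rot M x \<in> A) \<Longrightarrow> (\<And>x. x \<in> A \<Longrightarrow> opp M x \<in> A)
       \<Longrightarrow> A = darts M"
  shows "connected_map M"
  using assms connected_map_iff by (metis ex_in_conv)

subsection \<open>Cutting an edge\<close>

lemma cut_simps [simp]:
  "darts (cut M d) = darts M" "rot (cut M d) = rot M" "white (cut M d) = white M"
  "root_dart (cut M d) = root_dart M" "opp (cut M d) = (opp M)(d := d, opp M d := opp M d)"
  by (simp_all add: cut_def)

lemma opp_cut_eq:
  assumes M: "rotation_system M"
  shows "opp (cut M d) = opp M \<circ> transpose d (opp M d)"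
  using rotation_systemD[OF M]
  by (auto simp: fun_eq_iff transpose_def)

text \<open>This reduces the effect of a cut on the faces to the effect of a transposition on the
  cycles of a permutation: the faces on the two sides of the edge merge, or their common face
  splits.\<close>

lemma next_dart_cut:
  assumes M: "rotation_system M"
  shows "next_dart (cut M d) = next_dart M \<circ> transpose d (opp M d)"
  unfolding next_dart_eq opp_cut_eq[OF M] by (simp add: comp_assoc)

lemma rotation_system_cut:
  assumes M: "rotation_system M" and d: "d \<in> darts M"
  shows "rotation_system (cut M d)"
proof -
  note r = rotation_systemD[OF M]
  have "opp (cut M d) permutes darts M"
    unfolding opp_cut_eq[OF M]
    by (intro permutes_compose permutes_swap_id) (use r d in auto)
  moreover have "\<forall>x \<in> darts M. opp (cut M d) (opp (cut M d) x) = x"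
    by (metis cut_simps(5) fun_upd_apply r(4))
  ultimately show ?thesis unfolding rotation_system_def using r by simp
qed

lemma edge_darts_opp:
  "rotation_system M \<Longrightarrow> d \<in> edge_darts M \<Longrightarrow> opp M d \<in> edge_darts M"
  using rotation_systemD[of M] by (auto simp: edge_darts_def)

lemma edge_darts_cut:
  assumes M: "rotation_system M" and d: "d \<in> edge_darts M"
  shows "edge_darts (cut M d) = edge_darts M - {d, opp M d}"
  using d by (auto simp: edge_darts_def)

lemma half_edges_cut:
  assumes M: "rotation_system M" and d: "d \<in> edge_darts M"
  shows "half_edges (cut M d) = half_edges M \<union> {d, opp M d}"
  using d rotation_systemD[OF M] by (auto simp: edge_darts_def half_edges_def split: if_splits)

lemma finite_edge_darts: "rotation_system M \<Longrightarrow> finite (edge_darts M)"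
  by (simp add: edge_darts_def rotation_systemD)

lemma card_edges:
  assumes M: "rotation_system M"
  shows "2 * card (edges M) = card (edge_darts M)"
proof -
  note r = rotation_systemD[OF M]
  have U: "\<Union> (edges M) = edge_darts M"
    using edge_darts_opp[OF M] by (auto simp: edges_def)
  have "2 * card (edges M) = card (\<Union> (edges M))"
  proof (rule card_partition)
    show "finite (edges M)" using finite_edge_darts[OF M] by (simp add: edges_def)
    show "finite (\<Union> (edges M))" using U finite_edge_darts[OF M] by simp
    show "card c = 2" if "c \<in> edges M" for c
      using that by (auto simp: edges_def edge_darts_def card_insert_if)
    show "c1 \<inter> c2 = {}" if "c1 \<in> edges M" "c2 \<in> edges M" "c1 \<noteq> c2" for c1 c2
      using that r(4) by (auto simp: edges_def) metis+
  qed
  then show ?thesis using U by simp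
qed

lemma card_edges_cut:
  assumes M: "rotation_system M" and d: "d \<in> edge_darts M"
  shows "card (edges M) = card (edges (cut M d)) + 1"
proof -
  have dd: "d \<in> darts M" "opp M d \<noteq> d" using d by (auto simp: edge_darts_def)
  have "card (edge_darts M) = card (edge_darts (cut M d)) + 2"
    using edge_darts_cut[OF M d] finite_edge_darts[OF M] d edge_darts_opp[OF M d] dd(2)
      card_Diff_subset[of "{d, opp M d}" "edge_darts M"] card_mono[of "edge_darts M" "{d, opp M d}"]
    by simp
  then show ?thesis using card_edges[OF M] card_edges[OF rotation_system_cut[OF M dd(1)]] by simp
qed

lemma vertices_cut [simp]: "vertices (cut M d) = vertices M"
  by (simp add: vertices_def)

text \<open>The cut merges the two faces beside the edge, and the contour of the merged face leads
  from one end of the edge to the other without using it.\<close>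

lemma connected_cut:
  assumes M: "rotation_system M" and c: "connected_map M" and d: "d \<in> darts M"
    and e: "opp M d \<notin> orbit (next_dart M) d"
  shows "connected_map (cut M d)"
proof (rule connected_mapI[OF rotation_system_cut[OF M d]])
  let ?N = "cut M d" and ?e = "opp M d"
  note p = permutation_next_dart[OF M]
  fix A x assume A: "A \<subseteq> darts ?N" "x \<in> A" and rA: "\<And>x. x \<in> A \<Longrightarrow> rot ?N x \<in> A"
    and oA: "\<And>x. x \<in> A \<Longrightarrow> opp ?N x \<in> A"
  have nA: "next_dart ?N x \<in> A" if "x \<in> A" for x
    unfolding next_dart_def by (intro rA oA that)
  have 1: "?e \<in> A" if "d \<in> A"
    using orbit_subset_closed[of d A "next_dart ?N", OF that nA] orbit_transpose_merge[OF p e]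
    unfolding next_dart_cut[OF M] by blast
  have 2: "d \<in> A" if "?e \<in> A"
  proof -
    have "d \<notin> orbit (next_dart M) ?e" using orbit_sym[OF p] e by blast
    from orbit_transpose_merge[OF p this] have "d \<in> orbit (next_dart ?N) ?e"
      using next_dart_cut[OF M] transpose_commute by metis
    then show ?thesis using orbit_subset_closed[of ?e A "next_dart ?N", OF that nA] by blast
  qed
  have "opp M x \<in> A" if "x \<in> A" for x
    using oA[OF that] 1 2 that rotation_systemD(4)[OF M] by (auto split: if_splits)
  then show "A = darts ?N" using connected_mapD[OF M c _ A(2)] A(1) rA by simp
qed

lemma card_faces_cut_merge:
  assumes M: "rotation_system M" and d: "d \<in> darts M" and e: "opp M d \<notin> orbit (next_dart M) d"
  shows "card (faces M) \<le> card (faces (cut M d)) + 1"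
  unfolding faces_def next_dart_cut[OF M] cut_simps
  by (rule card_orbits_transpose_merge) (use rotation_systemD[OF M] permutation_next_dart[OF M] d e in auto)

lemma card_faces_cut_split:
  assumes M: "rotation_system M" and d: "d \<in> edge_darts M" and e: "opp M d \<in> orbit (next_dart M) d"
  shows "card (faces M) + 1 \<le> card (faces (cut M d))"
  unfolding faces_def next_dart_cut[OF M] cut_simps
  by (rule card_orbits_transpose_split)
    (use rotation_systemD[OF M] permutation_next_dart[OF M] d e in \<open>auto simp: edge_darts_def\<close>)

section \<open>Faces of connected systems and Euler's inequality\<close>

lemma face_eq_darts_if_opp_closed:
  assumes M: "rotation_system M" and c: "connected_map M" and d: "d \<in> darts M"
    and op: "\<And>x. x \<in> orbit (next_dart M) d \<Longrightarrow> opp M x \<in> orbit (next_dart M) d"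
  shows "orbit (next_dart M) d = darts M"
proof (rule connected_mapD[OF M c _ permutation_self_in_orbit[OF permutation_next_dart[OF M]]])
  show "orbit (next_dart M) d \<subseteq> darts M" using face_subset_darts[OF M d] .
  \<comment> \<open>\<open>rot\<close> is \<open>next_dart\<close> after \<open>opp\<close>, so a
    face closed under \<open>opp\<close> is closed under \<open>rot\<close> as well.\<close>
  show "rot M x \<in> orbit (next_dart M) d" if "x \<in> orbit (next_dart M) d" for x
    using orbit.step[OF op[OF that]] rotation_systemD(4)[OF M] by (simp add: next_dart_def)
qed (rule op)

lemma faces_single:
  assumes M: "rotation_system M" and d: "d \<in> darts M"
  shows "card (faces M) = 1 \<longleftrightarrow> orbit (next_dart M) d = darts M"
proof
  assume "card (faces M) = 1"
  then obtain C where C: "faces M = {C}" by (auto simp: card_1_singleton_iff)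
  have "x \<in> orbit (next_dart M) d" if "x \<in> darts M" for x
  proof -
    have "orbit (next_dart M) x \<in> faces M" "orbit (next_dart M) d \<in> faces M"
      using that d by (auto simp: faces_def)
    then have "orbit (next_dart M) x = orbit (next_dart M) d" using C by simp
    then show ?thesis using permutation_self_in_orbit[OF permutation_next_dart[OF M]] by auto
  qed
  then show "orbit (next_dart M) d = darts M" using face_subset_darts[OF M d] by auto
next
  assume o: "orbit (next_dart M) d = darts M"
  have "orbit (next_dart M) x = darts M" if "x \<in> darts M" for x
    using orbit_eq[OF permutation_next_dart[OF M]] o that by metis
  then have "faces M = {darts M}" using d by (auto simp: faces_def)
  then show "card (faces M) = 1" by simp
qed

text \<open>An edge with different faces on its two sides can be deleted without disconnecting the map.
  If there is none, then there is only one face, and one passes to the dual map instead of choosing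
  a spanning tree.\<close>

lemma euler_inequality:
  assumes "rotation_system M" "connected_map M" "darts M \<noteq> {}"
  shows "card (vertices M) + card (faces M) \<le> card (edges M) + 2"
  using assms
proof (induction "card (edges M)" arbitrary: M rule: less_induct)
  case less
  note M = \<open>rotation_system M\<close> and c = \<open>connected_map M\<close>
  \<comment> \<open>Stated for any system with as many edges as \<open>M\<close>, since it is
    applied to \<open>M\<close> and to its dual.\<close>
  have step: "card (vertices N) + card (faces N) \<le> card (edges N) + 2"
    if N: "rotation_system N" "connected_map N" "darts N \<noteq> {}" "card (edges N) = card (edges M)"
      "card (faces N) \<noteq> 1" for N :: "'a pmap"
  proof -
    obtain x where x: "x \<in> darts N" using N by auto
    obtain d where d: "d \<in> orbit (next_dart N) x" "opp N d \<notin> orbit (next_dart N) x"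
      using face_eq_darts_if_opp_closed[OF N(1,2) x] faces_single[OF N(1) x] N(5) by blast
    have dd: "d \<in> darts N" "orbit (next_dart N) d = orbit (next_dart N) x"
      using d(1) face_subset_darts[OF N(1) x] orbit_eq[OF permutation_next_dart[OF N(1)]] by auto
    then have e: "opp N d \<notin> orbit (next_dart N) d" using d(2) by simp
    have "opp N d \<noteq> d" using d by metis
    then have de: "d \<in> edge_darts N" using dd(1) by (simp add: edge_darts_def)
    have E: "card (edges N) = card (edges (cut N d)) + 1" by (rule card_edges_cut[OF N(1) de])
    have "card (vertices (cut N d)) + card (faces (cut N d)) \<le> card (edges (cut N d)) + 2"
      by (rule less.hyps) (use E N(3,4) connected_cut[OF N(1,2) dd(1) e] rotation_system_cut[OF N(1) dd(1)] in auto)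
    then show ?thesis using E card_faces_cut_merge[OF N(1) dd(1) e] by simp
  qed
  show ?case
  proof (cases "card (faces M) = 1")
    case False
    then show ?thesis using step[OF M c less.prems(3)] by simp
  next
    case F1: True
    let ?N = "M\<lparr>rot := next_dart M\<rparr>"
    have next_N: "next_dart ?N = rot M"
      by (auto simp: next_dart_def fun_eq_iff rotation_systemD[OF M])
    have vf: "vertices ?N = faces M" "faces ?N = vertices M" "edges ?N = edges M"
      by (auto simp: vertices_def faces_def next_N edges_def edge_darts_def)
    have N: "rotation_system ?N"
      using M next_dart_permutes[OF M] by (auto simp: rotation_system_def)
    have cN: "connected_map ?N"
    proof (rule connected_mapI[OF N])
      fix A x assume A: "A \<subseteq> darts ?N" "x \<in> A" "\<And>x. x \<in> A \<Longrightarrow> rot ?N x \<in> A" "\<And>x. x \<in> A \<Longrightarrow> opp ?N x \<in> A"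
      have "rot M x \<in> A" if "x \<in> A" for x
        using A(3)[OF A(4)[OF that]] by (simp add: next_dart_def rotation_systemD[OF M])
      then show "A = darts ?N" using connected_mapD[OF M c _ A(2)] A by auto
    qed
    show ?thesis
    proof (cases "card (vertices M) = 1")
      case True then show ?thesis using F1 by simp
    next
      case False
      then show ?thesis using step[OF N cN] less.prems(3) by (simp add: vf)
    qed
  qed
qed

section \<open>The matching\<close>

lemma half_edges_split:
  "half_edges M = buds M \<union> leaves M" "buds M \<inter> leaves M = {}"
  "buds M \<subseteq> darts M" "leaves M \<subseteq> darts M" "half_edges M \<subseteq> darts M"
  by (auto simp: half_edges_def buds_def leaves_def)

lemma finite_half_edges:
  assumes "rotation_system M"
  shows "finite (half_edges M)" "finite (buds M)" "finite (leaves M)"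
  using half_edges_split[of M] rotation_systemD(1)[OF assms] finite_subset by metis+

lemma followed_by_functional:
  assumes "followed_by T U b l" "followed_by T U b l'"
  shows "l = l'"
proof -
  obtain n where n: "n > 0" "(next_dart T ^^ n) b = l" "\<And>m. 0 < m \<and> m < n \<Longrightarrow> (next_dart T ^^ m) b \<notin> U" "l \<in> U"
    using assms(1) by (auto simp: followed_by_def)
  obtain n' where n': "n' > 0" "(next_dart T ^^ n') b = l'" "\<And>m. 0 < m \<and> m < n' \<Longrightarrow> (next_dart T ^^ m) b \<notin> U" "l' \<in> U"
    using assms(2) by (auto simp: followed_by_def)
  have "\<not> n < n'" "\<not> n' < n" using n n' by auto
  then show ?thesis using n n' by auto
qed

text \<open>\<open>next_dart\<close> is injective, so of two walks ending in \<open>l\<close> the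
  shorter is a tail of the longer. If they differed in length, the start of the shorter one would be
  an inner dart of the longer one, and inner darts avoid \<open>U\<close>.\<close>

lemma followed_by_injective:
  assumes T: "rotation_system T" and f: "followed_by T U b l" "followed_by T U b' l" and b: "b \<in> U" "b' \<in> U"
  shows "b = b'"
proof -
  have aux: "c = c'"
    if "0 < m" "m \<le> m'" "(next_dart T ^^ m) c = (next_dart T ^^ m') c'" "c \<in> U"
      "\<And>k. 0 < k \<and> k < m' \<Longrightarrow> (next_dart T ^^ k) c' \<notin> U" for m m' c c'
  proof -
    have inj: "inj (next_dart T ^^ m)"
      using permutes_inj[OF next_dart_permutes[OF T]] by (simp add: inj_fn)
    have "(next_dart T ^^ m) c = (next_dart T ^^ (m + (m' - m))) c'" using that by simp
    also have "\<dots> = (next_dart T ^^ m) ((next_dart T ^^ (m' - m)) c')" by (simp only: funpow_add o_apply)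
    finally have "c = (next_dart T ^^ (m' - m)) c'" using injD[OF inj] by blast
    then show ?thesis using that(5)[of "m' - m"] that by (cases "m' = m") auto
  qed
  obtain n where n: "n > 0" "(next_dart T ^^ n) b = l" "\<And>m. 0 < m \<and> m < n \<Longrightarrow> (next_dart T ^^ m) b \<notin> U"
    using f(1) by (auto simp: followed_by_def)
  obtain n' where n': "n' > 0" "(next_dart T ^^ n') b' = l" "\<And>m. 0 < m \<and> m < n' \<Longrightarrow> (next_dart T ^^ m) b' \<notin> U"
    using f(2) by (auto simp: followed_by_def)
  show ?thesis using aux[of n n' b b'] aux[of n' n b' b] n n' b by (cases "n \<le> n'") auto
qed

lemma followed_by_subset:
  "followed_by T U b l \<Longrightarrow> U' \<subseteq> U \<Longrightarrow> l \<in> U' \<Longrightarrow> followed_by T U' b l"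
  unfolding followed_by_def by blast

text \<open>Two different steps involve four different half-edges, and matching one pair leaves the
  other bud followed by its leaf, as half-edges are only removed from between. So the steps commute,
  and the final state does not depend on the choices made.\<close>

lemma confluent_match_step:
  assumes T: "rotation_system T"
  shows "confluentp (match_step T)"
proof (rule strong_confluentp_imp_confluentp, rule strong_confluentpI)
  fix P Q1 Q2 assume s1: "match_step T P Q1" and s2: "match_step T P Q2"
  obtain b l where bl: "Q1 = insert (b, l) P" "b \<in> buds T - Field P" "l \<in> leaves T - Field P"
    "followed_by T (half_edges T - Field P) b l" using s1 by cases auto
  obtain b' l' where bl': "Q2 = insert (b', l') P" "b' \<in> buds T - Field P" "l' \<in> leaves T - Field P"
    "followed_by T (half_edges T - Field P) b' l'" using s2 by cases auto
  show "\<exists>u. (match_step T)\<^sup>*\<^sup>* Q1 u \<and> (match_step T)\<^sup>=\<^sup>= Q2 u"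
  proof (cases "b = b' \<or> l = l'")
    case True
    have "b = b' \<and> l = l'"
    proof (cases "b = b'")
      case True
      then show ?thesis using followed_by_functional bl(4) bl'(4) by metis
    next
      case False
      then have "l = l'" using True by simp
      have "b = b'"
        by (rule followed_by_injective[OF T bl(4)]) (use bl bl' half_edges_split[of T] \<open>l = l'\<close> in auto)
      then show ?thesis using \<open>l = l'\<close> by simp
    qed
    then have "Q1 = Q2" using bl bl' by simp
    then show ?thesis by auto
  next
    case False
    have ne: "b \<noteq> l'" "b' \<noteq> l" using bl(2,3) bl'(2,3) half_edges_split(2)[of T] by auto
    have "match_step T Q1 (insert (b', l') Q1)"
      by (rule match_step.intros)
        (use bl bl' ne False half_edges_split[of T] in \<open>auto intro: followed_by_subset[OF bl'(4)]\<close>)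
    moreover have "match_step T Q2 (insert (b, l) Q2)"
      by (rule match_step.intros)
        (use bl bl' ne False half_edges_split[of T] in \<open>auto intro: followed_by_subset[OF bl(4)]\<close>)
    moreover have "insert (b', l') Q1 = insert (b, l) Q2" using bl(1) bl'(1) by auto
    ultimately show ?thesis by (intro exI[of _ "insert (b', l') Q1"]) auto
  qed
qed

lemma match_steps_subset:
  "(match_step T)\<^sup>*\<^sup>* {} P \<Longrightarrow> P \<subseteq> buds T \<times> leaves T"
  by (induct rule: rtranclp_induct) (auto elim: match_step.cases)

lemma matching_eqI:
  assumes T: "rotation_system T" and P: "(match_step T)\<^sup>*\<^sup>* {} P" "\<nexists>Q. match_step T P Q"
  shows "matching T = P"
  unfolding matching_def
proof (rule the_equality)
  fix Q assume Q: "(match_step T)\<^sup>*\<^sup>* {} Q \<and> (\<nexists>R. match_step T Q R)"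
  obtain u where "(match_step T)\<^sup>*\<^sup>* P u" "(match_step T)\<^sup>*\<^sup>* Q u"
    using confluentpD[OF confluent_match_step[OF T] P(1)] Q by blast
  then show "Q = P" using P(2) Q by (metis converse_rtranclpE)
qed (use P in auto)

text \<open>There are finitely many reachable states and every step enlarges the state, so a
  reachable state that is maximal under inclusion is final.\<close>

lemma matching_steps:
  assumes T: "rotation_system T"
  shows "(match_step T)\<^sup>*\<^sup>* {} (matching T)" "\<nexists>Q. match_step T (matching T) Q"
proof -
  define X where "X = {P. (match_step T)\<^sup>*\<^sup>* {} P}"
  have "X \<subseteq> Pow (buds T \<times> leaves T)" using match_steps_subset by (auto simp: X_def)
  then have "finite X" using finite_half_edges[OF T] finite_subset by blast
  moreover have "{} \<in> X" by (simp add: X_def)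
  ultimately obtain P where P: "P \<in> X" "\<And>Q. Q \<in> X \<Longrightarrow> P \<subseteq> Q \<Longrightarrow> P = Q"
    using finite_has_maximal[of X] by auto
  have "\<nexists>Q. match_step T P Q"
  proof
    assume "\<exists>Q. match_step T P Q"
    then obtain Q where Q: "match_step T P Q" by blast
    have "Q \<in> X" using P(1) Q by (auto simp: X_def intro: rtranclp.rtrancl_into_rtrancl)
    moreover have "P \<subset> Q" using Q by cases (auto simp: Field_def)
    ultimately show False using P(2) by auto
  qed
  moreover from this have "matching T = P" using matching_eqI[OF T] P(1) by (simp add: X_def)
  ultimately show "(match_step T)\<^sup>*\<^sup>* {} (matching T)" "\<nexists>Q. match_step T (matching T) Q"
    using P(1) by (auto simp: X_def)
qed

section \<open>Positions in the contour of the root face\<close>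

definition root_face :: "'a pmap \<Rightarrow> 'a set" where
  "root_face M = orbit (next_dart M) (root_dart M)"

text \<open>Meaningful on the root face only, since no number of steps leads from the root to a dart
  of another face.\<close>

definition pos :: "'a pmap \<Rightarrow> 'a \<Rightarrow> nat" where
  "pos M x = funpow_dist (next_dart M) (root_dart M) x"

lemma root_in_root_face: "rotation_system M \<Longrightarrow> root_dart M \<in> root_face M"
  unfolding root_face_def by (rule permutation_self_in_orbit[OF permutation_next_dart])

lemma next_in_root_face: "x \<in> root_face M \<Longrightarrow> next_dart M x \<in> root_face M"
  unfolding root_face_def by (rule orbit.step)

lemma root_face_subset_darts: "rotation_system M \<Longrightarrow> root_dart M \<in> darts M \<Longrightarrow> root_face M \<subseteq> darts M"
  unfolding root_face_def by (rule face_subset_darts)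

lemma is_mapD:
  assumes "is_map M"
  shows "root_dart M \<in> half_edges M" "root_dart M \<in> darts M" "half_edges M \<subseteq> root_face M" "connected_map M"
    "card (vertices M) + card (faces M) = card (edges M) + 2"
  using assms by (auto simp: is_map_def root_face_def half_edges_def)

lemma pos_root [simp]: "pos M (root_dart M) = 0"
  by (simp add: pos_def funpow_dist_0)

lemma funpow_pos: "x \<in> root_face M \<Longrightarrow> (next_dart M ^^ pos M x) (root_dart M) = x"
  unfolding pos_def root_face_def by (rule funpow_dist_prop)

lemma pos_inj: "x \<in> root_face M \<Longrightarrow> y \<in> root_face M \<Longrightarrow> pos M x = pos M y \<longleftrightarrow> x = y"
  using funpow_pos by metis

text \<open>\<open>funpow_dist1\<close> counts at least one step; plain \<open>funpow_dist\<close>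
  from the root to itself would be 0 instead of the length of the cycle.\<close>

definition face_length :: "'a pmap \<Rightarrow> nat" where
  "face_length M = funpow_dist1 (next_dart M) (root_dart M) (root_dart M)"

context
  fixes M :: "'a pmap"
  assumes M: "rotation_system M"
begin

lemma funpow_face_length: "(next_dart M ^^ face_length M) (root_dart M) = root_dart M"
  using funpow_dist1_prop[OF root_in_root_face[OF M, unfolded root_face_def]]
  by (simp only: face_length_def)

lemma root_face_eq: "root_face M = (\<lambda>n. (next_dart M ^^ n) (root_dart M)) ` {0..<face_length M}"
  using orbit_conv_funpow_dist1[OF root_in_root_face[OF M, unfolded root_face_def]]
  by (simp only: face_length_def root_face_def)

lemma pos_funpow: "i < face_length M \<Longrightarrow> pos M ((next_dart M ^^ i) (root_dart M)) = i"
proof -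
  assume i: "i < face_length M"
  have inj: "inj_on (\<lambda>n. (next_dart M ^^ n) (root_dart M)) {0..<face_length M}"
    using inj_on_funpow_dist1[OF root_in_root_face[OF M, unfolded root_face_def]]
    by (simp only: face_length_def)
  show ?thesis
    unfolding pos_def funpow_dist_def
  proof (rule Least_equality)
    fix j assume "(next_dart M ^^ j) (root_dart M) = (next_dart M ^^ i) (root_dart M)"
    then show "i \<le> j" using inj_onD[OF inj, of j i] i by (cases "j < i") auto
  qed simp
qed

lemma pos_less: "x \<in> root_face M \<Longrightarrow> pos M x < face_length M"
  using pos_funpow by (auto simp: root_face_eq)

lemma pos_next_cases:
  assumes x: "x \<in> root_face M"
  shows "if next_dart M x = root_dart M then Suc (pos M x) = face_length M
    else pos M (next_dart M x) = Suc (pos M x)"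
proof -
  obtain i where i: "i < face_length M" "x = (next_dart M ^^ i) (root_dart M)"
    using x by (auto simp: root_face_eq)
  have nx: "next_dart M x = (next_dart M ^^ Suc i) (root_dart M)" using i by simp
  have px: "pos M x = i" using pos_funpow i by simp
  show ?thesis
  proof (cases "Suc i < face_length M")
    case True
    then have "pos M (next_dart M x) = Suc i" using pos_funpow[of "Suc i"] nx by simp
    then show ?thesis using px by auto
  next
    case False
    then have "Suc i = face_length M" using i by simp
    then show ?thesis using px nx funpow_face_length by auto
  qed
qed

lemma pos_next: "x \<in> root_face M \<Longrightarrow> next_dart M x \<noteq> root_dart M \<Longrightarrow> pos M (next_dart M x) = Suc (pos M x)"
  using pos_next_cases by auto

lemma pos_le_last:
  "x \<in> root_face M \<Longrightarrow> next_dart M x = root_dart M \<Longrightarrow> y \<in> root_face M \<Longrightarrow> pos M y \<le> pos M x"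
  using pos_next_cases[of x] pos_less[of y] by auto

lemma pos_0_iff: "x \<in> root_face M \<Longrightarrow> pos M x = 0 \<longleftrightarrow> x = root_dart M"
  using pos_inj[of x M "root_dart M"] root_in_root_face[OF M] by auto

lemma root_face_pred:
  assumes "x \<in> root_face M" "x \<noteq> root_dart M"
  obtains y where "y \<in> root_face M" "next_dart M y = x" "pos M x = Suc (pos M y)"
proof -
  obtain i where i: "i < face_length M" "x = (next_dart M ^^ i) (root_dart M)"
    using assms by (auto simp: root_face_eq)
  then obtain j where j: "i = Suc j" using assms(2) by (cases i) auto
  let ?y = "(next_dart M ^^ j) (root_dart M)"
  have "?y \<in> root_face M" "next_dart M ?y = x" "pos M x = Suc (pos M ?y)"
    using i j pos_funpow[of j] pos_funpow[of "Suc j"] by (auto simp: root_face_eq)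
  then show thesis by (rule that)
qed

lemma root_face_induct [consumes 1, case_names root step]:
  assumes "x \<in> root_face M" "Q (root_dart M)"
    "\<And>y. y \<in> root_face M \<Longrightarrow> next_dart M y \<noteq> root_dart M \<Longrightarrow> pos M (next_dart M y) = Suc (pos M y) \<Longrightarrow> Q y \<Longrightarrow> Q (next_dart M y)"
  shows "Q x"
  using assms(1)
proof (induction "pos M x" arbitrary: x rule: less_induct)
  case less
  show ?case
  proof (cases "x = root_dart M")
    case False
    from root_face_pred[OF less.prems this] obtain y where
      "y \<in> root_face M" "next_dart M y = x" "pos M x = Suc (pos M y)" .
    then show ?thesis using assms(3)[of y] less.hyps[of y] False by auto
  qed (use assms(2) in simp)
qed

text \<open>Serves to verify a formula for the positions after a cut, where the contour is spliced
  together from two old ones.\<close>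

lemma pos_eqI:
  assumes "q (root_dart M) = 0" "x \<in> root_face M"
    and "\<And>y. y \<in> root_face M \<Longrightarrow> next_dart M y \<noteq> root_dart M \<Longrightarrow> q (next_dart M y) = Suc (q y)"
  shows "pos M x = q x"
  using assms(2) by (induct rule: root_face_induct) (use assms in auto)

text \<open>As the root belongs to \<open>U\<close>, a walk from \<open>b\<close> stops at the root
  at the latest. So the cyclic order matters in one case only: \<open>l\<close> is the root and
  nothing in \<open>U\<close> comes after \<open>b\<close>. In all other cases it is the linear
  order of the positions.\<close>

lemma followed_by_iff:
  assumes b: "b \<in> root_face M" and U: "U \<subseteq> root_face M" "root_dart M \<in> U"
  shows "followed_by M U b l \<longleftrightarrow> l \<in> U \<and>
    (l = root_dart M \<and> (\<forall>u \<in> U. pos M u \<le> pos M b) \<or>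
     pos M b < pos M l \<and> (\<forall>u \<in> U. \<not> (pos M b < pos M u \<and> pos M u < pos M l)))"
    (is "_ \<longleftrightarrow> ?R")
proof -
  let ?nx = "next_dart M" and ?r = "root_dart M" and ?N = "face_length M"
  have fb: "(?nx ^^ m) b = (?nx ^^ (m + pos M b)) ?r" for m
    using funpow_pos[OF b] by (simp add: funpow_add)
  have ub: "(?nx ^^ (pos M u - pos M b)) b = u" if "u \<in> root_face M" "pos M b < pos M u" for u
    using funpow_pos[OF that(1)] that(2) fb by simp
  have pb: "pos M ((?nx ^^ m) b) = m + pos M b" if "m + pos M b < ?N" for m
    using pos_funpow[OF that] fb by simp
  have wrap: "(?nx ^^ (?N - pos M b)) b = ?r"
    using funpow_face_length pos_less[OF b] fb by simp
  show ?thesis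
  proof
    assume "followed_by M U b l"
    then obtain n where n: "n > 0" "(?nx ^^ n) b = l" "\<And>m. 0 < m \<Longrightarrow> m < n \<Longrightarrow> (?nx ^^ m) b \<notin> U" and l: "l \<in> U"
      by (auto simp: followed_by_def)
    show ?R
    proof (cases "n + pos M b < ?N")
      case True
      then have "pos M l = n + pos M b" using pb n(2) by auto
      moreover have "u \<notin> U" if u: "pos M b < pos M u" "pos M u < n + pos M b" for u
      proof
        assume uU: "u \<in> U"
        then have "(?nx ^^ (pos M u - pos M b)) b = u" using ub U u by auto
        moreover have "0 < pos M u - pos M b" "pos M u - pos M b < n" using u by linarith+
        ultimately show False using n(3) uU by metis
      qed
      ultimately show ?thesis using l n(1) by auto
    next
      case False
      then have "n = ?N - pos M b" using n(3)[of "?N - pos M b"] wrap U(2) pos_less[OF b]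
        by (cases "?N - pos M b < n") auto
      then have "l = ?r" using wrap n(2) by simp
      moreover have "pos M u \<le> pos M b" if "u \<in> U" for u
      proof (rule ccontr)
        assume gt: "\<not> pos M u \<le> pos M b"
        then have "(?nx ^^ (pos M u - pos M b)) b = u" using ub U that by auto
        then show False using n(3)[of "pos M u - pos M b"] pos_less[of u] U that \<open>n = _\<close> gt by force
      qed
      ultimately show ?thesis using l by auto
    qed
  next
    assume R: ?R
    show "followed_by M U b l"
    proof (cases "pos M b < pos M l")
      case True
      then have no: "\<And>u. u \<in> U \<Longrightarrow> \<not> (pos M b < pos M u \<and> pos M u < pos M l)" using R by auto
      have lF: "l \<in> root_face M" using R U by auto
      have "(?nx ^^ m) b \<notin> U" if "0 < m" "m < pos M l - pos M b" for m
        using no[of "(?nx ^^ m) b"] pb[of m] pos_less[OF lF] that by auto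
      then show ?thesis using R True ub[OF lF True] unfolding followed_by_def
        by (auto intro!: exI[of _ "pos M l - pos M b"])
    next
      case False
      then have l: "l = ?r" and no: "\<And>u. u \<in> U \<Longrightarrow> pos M u \<le> pos M b" using R by auto
      have "(?nx ^^ m) b \<notin> U" if "0 < m" "m < ?N - pos M b" for m
        using no[of "(?nx ^^ m) b"] pb[of m] that by auto
      then show ?thesis using R l wrap pos_less[OF b] unfolding followed_by_def
        by (auto intro!: exI[of _ "?N - pos M b"])
    qed
  qed
qed

end

section \<open>Bracketings\<close>

text \<open>No pair uses the root and each bud comes before its leaf, so no pair wraps around the
  root and linear positions can replace the cyclic order. The last clause excludes crossings.
  Half-edges may stay unmatched, because subsets of a matching occur while a map is being
  opened.\<close>

definition bracketing :: "'a pmap \<Rightarrow> ('a \<times> 'a) set \<Rightarrow> bool" where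
  "bracketing M P \<longleftrightarrow>
     P \<subseteq> buds M \<times> (leaves M - {root_dart M}) \<and>
     (\<forall>p \<in> P. pos M (fst p) < pos M (snd p)) \<and>
     (\<forall>p \<in> P. \<forall>q \<in> P. fst p = fst q \<or> snd p = snd q \<longrightarrow> p = q) \<and>
     (\<forall>p \<in> P. \<forall>q \<in> P. pos M (fst p) < pos M (fst q) \<and> pos M (fst q) < pos M (snd p) \<longrightarrow>
        pos M (snd q) < pos M (snd p))"

text \<open>A map admits such a set exactly if it is balanced with total charge 1, and the set is
  then its matching.\<close>

definition perfect_bracketing :: "'a pmap \<Rightarrow> ('a \<times> 'a) set \<Rightarrow> bool" where
  "perfect_bracketing M P \<longleftrightarrow>
     bracketing M P \<and> buds M = fst ` P \<and> leaves M = insert (root_dart M) (snd ` P)"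

lemma bracketingD:
  assumes "bracketing M P"
  shows "\<And>b l. (b, l) \<in> P \<Longrightarrow> b \<in> buds M \<and> l \<in> leaves M \<and> l \<noteq> root_dart M"
    "\<And>b l. (b, l) \<in> P \<Longrightarrow> pos M b < pos M l"
    "\<And>b l l'. (b, l) \<in> P \<Longrightarrow> (b, l') \<in> P \<Longrightarrow> l = l'"
    "\<And>b b' l. (b, l) \<in> P \<Longrightarrow> (b', l) \<in> P \<Longrightarrow> b = b'"
    "\<And>b l b' l'. (b, l) \<in> P \<Longrightarrow> (b', l') \<in> P \<Longrightarrow> pos M b < pos M b' \<Longrightarrow> pos M b' < pos M l \<Longrightarrow> pos M l' < pos M l"
  using assms unfolding bracketing_def by fastforce+

lemma bracketing_subset: "bracketing M P \<Longrightarrow> Q \<subseteq> P \<Longrightarrow> bracketing M Q"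
  unfolding bracketing_def by blast

lemma Field_eq: "Field P = fst ` P \<union> snd ` P"
  by (auto simp: Field_def Domain_fst Range_snd)

lemma bracketing_inj:
  assumes "bracketing M P" shows "inj_on fst P" "inj_on snd P"
  using assms unfolding bracketing_def inj_on_def by blast+

lemma finite_bracketing:
  assumes "rotation_system M" "bracketing M P" shows "finite P"
proof -
  have "P \<subseteq> buds M \<times> leaves M" using assms(2) by (auto simp: bracketing_def)
  then show ?thesis using finite_half_edges[OF assms(1)] finite_subset by blast
qed

lemma finite_has_max:
  fixes f :: "'a \<Rightarrow> nat"
  assumes "finite A" "A \<noteq> {}"
  obtains x where "x \<in> A" "\<And>y. y \<in> A \<Longrightarrow> f y \<le> f x"
proof -
  obtain x where "x \<in> A" "Max (f ` A) = f x" using obtains_MAX[OF assms] .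
  then show thesis using that[of x] Max_ge[of "f ` A"] assms(1) by auto
qed

lemma finite_has_min:
  fixes f :: "'a \<Rightarrow> nat"
  assumes "finite A" "A \<noteq> {}"
  obtains x where "x \<in> A" "\<And>y. y \<in> A \<Longrightarrow> f x \<le> f y"
proof -
  obtain x where "x \<in> A" "Min (f ` A) = f x" using obtains_MIN[OF assms] .
  then show thesis using that[of x] Min_le[of "f ` A"] assms(1) by auto
qed

text \<open>Behind the last unmatched bud of the contour there are only unmatched leaves, or nothing
  at all; in the latter case the next unmatched half-edge is the root, itself a leaf.\<close>

lemma match_step_if_unmatched_bud:
  assumes M: "is_map M" and r: "root_dart M \<in> leaves M - Field P" and b: "b \<in> buds M - Field P"
  shows "\<exists>Q. match_step M P Q"
proof -
  note rs = is_map_rotation_system[OF M]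
  define U where "U = half_edges M - Field P"
  have UF: "U \<subseteq> root_face M" "root_dart M \<in> U" using is_mapD[OF M] r half_edges_split[of M] by (auto simp: U_def)
  have finU: "finite U" using finite_half_edges[OF rs] by (simp add: U_def)
  have "finite (buds M - Field P)" using finite_half_edges[OF rs] by simp
  then obtain c where c: "c \<in> buds M - Field P" "\<And>y. y \<in> buds M - Field P \<Longrightarrow> pos M y \<le> pos M c"
    using b finite_has_max[of "buds M - Field P" "pos M"] by blast
  have cF: "c \<in> root_face M" using c(1) is_mapD(3)[OF M] half_edges_split(1)[of M] by auto
  show ?thesis
  proof (cases "\<exists>u\<in>U. pos M c < pos M u")
    case True
    let ?V = "{u \<in> U. pos M c < pos M u}"
    have "finite ?V" "?V \<noteq> {}" using finU True by auto
    then obtain l where l: "l \<in> ?V" "\<And>y. y \<in> ?V \<Longrightarrow> pos M l \<le> pos M y"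
      using finite_has_min[of ?V "pos M"] by blast
    have "l \<notin> buds M" using c(2)[of l] l(1) by (auto simp: U_def)
    then have "l \<in> leaves M - Field P" using l(1) half_edges_split(1)[of M] by (auto simp: U_def)
    moreover have "followed_by M U c l" unfolding followed_by_iff[OF rs cF UF] using l by force
    ultimately show ?thesis using c(1) match_step.intros[of c M P l] unfolding U_def by blast
  next
    case False
    then have "followed_by M U c (root_dart M)" unfolding followed_by_iff[OF rs cF UF] using UF by force
    then show ?thesis using c(1) r match_step.intros[of c M P] unfolding U_def by blast
  qed
qed

text \<open>The second conjunct strengthens the induction: with nothing unmatched between a bud and
  its leaf, a pair added later cannot cross an earlier one. Since the root stays unmatched, no step
  matches around it.\<close>

lemma match_steps_bracketing:
  assumes M: "is_map M" and r: "root_dart M \<in> leaves M" and "(match_step M)\<^sup>*\<^sup>* {} P" "root_dart M \<notin> Field P"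
  shows "bracketing M P \<and>
    (\<forall>(b, l) \<in> P. \<forall>u \<in> half_edges M - Field P. \<not> (pos M b < pos M u \<and> pos M u < pos M l))"
  using assms(3,4)
proof (induct rule: rtranclp_induct)
  case base
  show ?case by (simp add: bracketing_def)
next
  case (step P Q)
  note rs = is_map_rotation_system[OF M]
  define U where "U = half_edges M - Field P"
  from step(2) obtain b l where bl: "Q = insert (b, l) P" "b \<in> buds M - Field P" "l \<in> leaves M - Field P"
    "followed_by M U b l" unfolding U_def by cases auto
  have rP: "root_dart M \<notin> Field P" "l \<noteq> root_dart M" using step(4) bl(1) by auto
  have UF: "U \<subseteq> root_face M" "root_dart M \<in> U"
    using is_mapD[OF M] rP by (auto simp: U_def)
  have bF: "b \<in> root_face M" "b \<in> U" "l \<in> U" using bl(2,3) is_mapD(3)[OF M] half_edges_split(1)[of M] by (auto simp: U_def)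
  have f: "pos M b < pos M l" "\<And>u. u \<in> U \<Longrightarrow> \<not> (pos M b < pos M u \<and> pos M u < pos M l)"
    using bl(4) rP(2) unfolding followed_by_iff[OF rs bF(1) UF] by auto
  have IH: "bracketing M P" "\<And>c k u. (c, k) \<in> P \<Longrightarrow> u \<in> U \<Longrightarrow> \<not> (pos M c < pos M u \<and> pos M u < pos M k)"
    using step(3)[OF rP(1)] by (auto simp: U_def)
  note B = bracketingD[OF IH(1)]
  have PF: "c \<in> Field P \<and> k \<in> Field P \<and> c \<in> root_face M \<and> k \<in> root_face M" if "(c, k) \<in> P" for c k
    using B(1)[OF that] that is_mapD(3)[OF M] half_edges_split(1)[of M] by (auto simp: Field_def)
  have UQ: "half_edges M - Field Q \<subseteq> U" using bl(1) by (auto simp: U_def)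
  have "bracketing M Q"
    unfolding bracketing_def
  proof (intro conjI ballI impI)
    show "Q \<subseteq> buds M \<times> (leaves M - {root_dart M})"
      using bl rP B(1) by (auto)
    show "pos M (fst p) < pos M (snd p)" if "p \<in> Q" for p
      using that bl(1) f(1) B(2)[of "fst p" "snd p"] by auto
    show "p = q" if "p \<in> Q" "q \<in> Q" "fst p = fst q \<or> snd p = snd q" for p q
      using that bl B(3,4) PF by (cases p; cases q) auto
    show "pos M (snd q) < pos M (snd p)" if pq: "p \<in> Q" "q \<in> Q"
      and c: "pos M (fst p) < pos M (fst q) \<and> pos M (fst q) < pos M (snd p)" for p q
    proof (cases "p = (b, l)"; cases "q = (b, l)")
      assume "p = (b, l)" "q = (b, l)" then show ?thesis using c by simp
    next
      assume p: "p = (b, l)" and q: "q \<noteq> (b, l)"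
      then obtain b' l' where q: "q = (b', l')" "(b', l') \<in> P" using pq(2) bl(1) by (cases q) auto
      have "l \<noteq> l'" using PF[OF q(2)] bl(3) by auto
      then have "pos M l \<noteq> pos M l'" using pos_inj[of l M l'] PF[OF q(2)] UF(1) bF(3) by auto
      then show ?thesis using IH(2)[OF q(2) bF(3)] c p q by auto
    next
      assume p: "p \<noteq> (b, l)" and q: "q = (b, l)"
      then obtain b' l' where p: "p = (b', l')" "(b', l') \<in> P" using pq(1) bl(1) by (cases p) auto
      then show ?thesis using IH(2)[OF p(2) bF(2)] c q by auto
    next
      assume p: "p \<noteq> (b, l)" and q: "q \<noteq> (b, l)"
      then show ?thesis using B(5)[of "fst p" "snd p" "fst q" "snd q"] pq c bl(1) by auto
    qed
  qed
  then show ?case using f(2) IH(2) UQ bl(1) by fastforce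
qed

text \<open>With the root unmatched, a final state leaves no bud unmatched. Total charge 1 then
  leaves a single unmatched leaf, which has to be the root.\<close>

lemma perfect_bracketing_matching:
  assumes M: "is_map M" and t: "total_charge M = 1" and bal: "is_balanced M"
  shows "perfect_bracketing M (matching M)"
proof -
  note rs = is_map_rotation_system[OF M]
  let ?P = "matching M"
  have r: "root_dart M \<in> leaves M - Field ?P" using bal by (simp add: is_balanced_def single_leaves_def)
  note ms = matching_steps[OF rs]
  have br: "bracketing M ?P" using match_steps_bracketing[OF M _ ms(1)] r by auto
  have "buds M \<subseteq> Field ?P" using match_step_if_unmatched_bud[OF M r] ms(2) by blast
  moreover have "fst ` ?P \<subseteq> buds M" "snd ` ?P \<subseteq> leaves M" using br by (auto simp: bracketing_def)
  ultimately have b: "buds M = fst ` ?P" using half_edges_split(2)[of M] unfolding Field_eq by blast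
  have fin: "finite ?P" using finite_bracketing[OF rs br] .
  have "card (leaves M) = card ?P + 1"
    using t b card_image[OF bracketing_inj(1)[OF br]] by (simp add: total_charge_def)
  moreover have sub: "insert (root_dart M) (snd ` ?P) \<subseteq> leaves M" using br r unfolding bracketing_def by auto
  moreover have "card (insert (root_dart M) (snd ` ?P)) = card ?P + 1"
    using card_image[OF bracketing_inj(2)[OF br]] r fin by (simp add: Field_eq)
  ultimately have "insert (root_dart M) (snd ` ?P) = leaves M"
    using card_subset_eq finite_half_edges(3)[OF rs] by metis
  then show ?thesis using br b by (simp add: perfect_bracketing_def)
qed

text \<open>The procedure creates pairs of \<open>P\<close> only. Suppose it matched a bud
  \<open>c\<close> to a leaf \<open>k\<close> that comes before the partner of \<open>c\<close>. The
  partner of \<open>k\<close> would be an unmatched bud before \<open>c\<close>, and two pairs of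
  \<open>P\<close> would cross. Conversely, the unmatched root allows a step as long as a bud is
  left, so all of \<open>P\<close> is created.\<close>

lemma matching_perfect_bracketing:
  assumes M: "is_map M" and P: "perfect_bracketing M P"
  shows "matching M = P" "is_balanced M" "total_charge M = 1"
proof -
  note rs = is_map_rotation_system[OF M]
  have br: "bracketing M P" and b: "buds M = fst ` P" and l: "leaves M = insert (root_dart M) (snd ` P)"
    using P by (auto simp: perfect_bracketing_def)
  note B = bracketingD[OF br]
  have HF: "x \<in> root_face M" if "x \<in> buds M \<or> x \<in> leaves M" for x
    using that is_mapD(3)[OF M] half_edges_split(1)[of M] by auto
  have rl: "root_dart M \<in> leaves M" using l by simp
  have rF: "root_dart M \<notin> Field P" using B(1) rl half_edges_split(2)[of M] by (auto simp: Field_def)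
  have sub: "Q \<subseteq> P" if "(match_step M)\<^sup>*\<^sup>* {} Q" for Q
    using that
  proof (induct rule: rtranclp_induct)
    case (step Q R)
    define U where "U = half_edges M - Field Q"
    from step(2) obtain c k where ck: "R = insert (c, k) Q" "c \<in> buds M - Field Q" "k \<in> leaves M - Field Q"
      "followed_by M U c k" unfolding U_def by cases auto
    obtain k0 where k0: "(c, k0) \<in> P" using ck(2) b by auto
    have k0U: "k0 \<in> U"
    proof -
      have "k0 \<notin> Field Q"
      proof
        assume "k0 \<in> Field Q"
        then obtain c' where "(c', k0) \<in> Q \<or> (k0, c') \<in> Q" by (auto simp: Field_def)
        then have "(c', k0) \<in> Q" using step(3) B(1) k0 half_edges_split(2)[of M] by blast
        then have "c' = c" using B(4) k0 step(3) by blast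
        then show False using \<open>(c', k0) \<in> Q\<close> ck(2) by (auto simp: Field_def)
      qed
      then show ?thesis using B(1)[OF k0] half_edges_split(1)[of M] by (simp add: U_def)
    qed
    have UF: "U \<subseteq> root_face M" "root_dart M \<in> U"
      using is_mapD[OF M] rF mono_Field[OF step(3)] by (auto simp: U_def)
    have cF: "c \<in> root_face M" using HF ck(2) by auto
    have kU: "k \<in> U" using ck(3) half_edges_split(1)[of M] by (simp add: U_def)
    have pk: "pos M c < pos M k" "\<not> pos M k0 < pos M k"
      "\<And>u. u \<in> U \<Longrightarrow> \<not> (pos M c < pos M u \<and> pos M u < pos M k)"
      using ck(4) k0U B(2)[OF k0] unfolding followed_by_iff[OF rs cF UF] by force+
    have "k = k0"
    proof (rule ccontr)
      assume "k \<noteq> k0"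
      then have lt: "pos M k < pos M k0" using pk(2) pos_inj[of k M k0] kU k0U UF(1) by fastforce
      have "k \<noteq> root_dart M" using pk(1) by auto
      then obtain c1 where c1: "(c1, k) \<in> P" using ck(3) l by auto
      have "c1 \<notin> Field Q"
      proof
        assume "c1 \<in> Field Q"
        then obtain k' where "(c1, k') \<in> Q \<or> (k', c1) \<in> Q" by (auto simp: Field_def)
        then have "(c1, k') \<in> Q" using step(3) B(1) c1 half_edges_split(2)[of M] by blast
        then have "k' = k" using B(3) c1 step(3) by blast
        then show False using \<open>(c1, k') \<in> Q\<close> ck(3) by (auto simp: Field_def)
      qed
      then have c1U: "c1 \<in> U" using B(1)[OF c1] half_edges_split(1)[of M] by (simp add: U_def)
      have "c1 \<noteq> c" using B(3)[OF k0, of k] c1 \<open>k \<noteq> k0\<close> by blast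
      then have "pos M c1 \<noteq> pos M c" using pos_inj[of c1 M c] c1U cF UF(1) by blast
      then have "pos M c1 < pos M c" using pk(3)[OF c1U] B(2)[OF c1] by linarith
      then show False using B(5)[OF c1 k0] pk(1) lt by linarith
    qed
    then show ?case using ck(1) k0 step(3) by simp
  qed simp
  note ms = matching_steps[OF rs]
  have mP: "matching M \<subseteq> P" using sub ms(1) by simp
  have rm: "root_dart M \<in> leaves M - Field (matching M)" using rF mono_Field[OF mP] rl by auto
  have "p \<in> matching M" if p: "p \<in> P" for p
  proof -
    have "fst p \<in> Field (matching M)"
      using match_step_if_unmatched_bud[OF M rm] ms(2) b p by blast
    then obtain k' where "(fst p, k') \<in> matching M \<or> (k', fst p) \<in> matching M" by (auto simp: Field_def)
    then have "(fst p, k') \<in> matching M" using mP B(1) p half_edges_split(2)[of M] prod.collapse[of p] by (metis disjoint_iff subsetD)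
    then show ?thesis using B(3)[of "fst p" k' "snd p"] p mP by (cases p) auto
  qed
  then show eq: "matching M = P" using mP by auto
  show "is_balanced M" using rm by (simp add: is_balanced_def single_leaves_def)
  have "card (leaves M) = card P + 1"
    unfolding l using card_image[OF bracketing_inj(2)[OF br]] rF finite_bracketing[OF rs br] by (simp add: Field_eq)
  then show "total_charge M = 1" using b card_image[OF bracketing_inj(1)[OF br]] by (simp add: total_charge_def)
qed

text \<open>If both sides of the edge lie in one face, the cut adds a face and removes an edge, so a
  connected result would violate Euler's inequality. If they lie in two faces, the cut map is
  connected along the merged contour.\<close>

lemma separating_iff:
  assumes M: "rotation_system M" "connected_map M"
    and E: "card (vertices M) + card (faces M) = card (edges M) + 2" and d: "d \<in> edge_darts M"
  shows "separating M d \<longleftrightarrow> opp M d \<in> orbit (next_dart M) d"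
proof
  have dd: "d \<in> darts M" using d by (auto simp: edge_darts_def)
  show "opp M d \<in> orbit (next_dart M) d" if "separating M d"
    using connected_cut[OF M dd] that by (auto simp: separating_def)
  show "separating M d" if "opp M d \<in> orbit (next_dart M) d"
  proof -
    have "\<not> card (vertices (cut M d)) + card (faces (cut M d)) \<le> card (edges (cut M d)) + 2"
      using card_faces_cut_split[OF M(1) d that] card_edges_cut[OF M(1) d] E by simp
    then show ?thesis
      using euler_inequality[OF rotation_system_cut[OF M(1) dd]] dd by (auto simp: separating_def)
  qed
qed

section \<open>Fusing the pairs of a bracketing\<close>

text \<open>The closure along an arbitrary set of pairs: the opening passes through maps in which
  only part of the matching is still fused.\<close>

definition fuse :: "'a pmap \<Rightarrow> ('a \<times> 'a) set \<Rightarrow> 'a pmap" where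
  "fuse T P = T\<lparr>opp := \<lambda>d. if d \<in> Field P then THE e. (d, e) \<in> P \<or> (e, d) \<in> P else opp T d\<rparr>"

lemma map_closure_eq_fuse: "map_closure T = fuse T (matching T)"
  by (simp add: map_closure_def fuse_def)

lemma fuse_simps [simp]:
  "darts (fuse T P) = darts T" "rot (fuse T P) = rot T" "white (fuse T P) = white T"
  "root_dart (fuse T P) = root_dart T"
  by (simp_all add: fuse_def)

lemma fuse_empty [simp]: "fuse T {} = T"
  by (simp add: fuse_def)

text \<open>The interval is open at the bud and closed at the leaf: after fusion, the dart of the
  bud belongs to the face outside the new edge and the dart of the leaf to the one inside. This
  makes \<open>cover\<close> constant on the faces of a fused tree.\<close>

definition cover :: "'a pmap \<Rightarrow> ('a \<times> 'a) set \<Rightarrow> 'a \<Rightarrow> ('a \<times> 'a) set" where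
  "cover M P x = {p \<in> P. pos M (fst p) < pos M x \<and> pos M x \<le> pos M (snd p)}"

definition depth :: "'a pmap \<Rightarrow> ('a \<times> 'a) set \<Rightarrow> 'a \<Rightarrow> nat" where
  "depth M P x = card (cover M P x)"

lemma cover_root [simp]: "cover M P (root_dart M) = {}" "depth M P (root_dart M) = 0"
  by (simp_all add: cover_def depth_def)

text \<open>The traversals of the edges from black to white, ordered lexicographically by depth and
  position, are those at which a walk cuts: the depth counts the turns around the map completed
  before. In a tree obtained by opening, the other side of an edge that is not cut has been
  reached before one more turn is completed.\<close>

definition breadth_first :: "'a pmap \<Rightarrow> ('a \<times> 'a) set \<Rightarrow> bool" where
  "breadth_first T P \<longleftrightarrow> (\<forall>x \<in> edge_darts T. \<not> white T x \<longrightarrow>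
     depth T P (opp T x) \<le> depth T P x \<or>
     depth T P (opp T x) = Suc (depth T P x) \<and> pos T (opp T x) < pos T x)"

lemma buds_leavesD:
  "b \<in> buds M \<Longrightarrow> b \<in> darts M \<and> opp M b = b \<and> \<not> white M b"
  "l \<in> leaves M \<Longrightarrow> l \<in> darts M \<and> opp M l = l \<and> white M l"
  by (auto simp: buds_def leaves_def half_edges_def)

lemma bracketing_pairD:
  assumes "bracketing T P" "(b, l) \<in> P"
  shows "b \<in> darts T" "l \<in> darts T" "opp T b = b" "opp T l = l" "\<not> white T b" "white T l"
  using bracketingD(1)[OF assms] buds_leavesD(1)[of b T] buds_leavesD(2)[of l T] by auto

lemma opp_fuse:
  assumes B: "bracketing T P"
  shows "(b, l) \<in> P \<Longrightarrow> opp (fuse T P) b = l" "(b, l) \<in> P \<Longrightarrow> opp (fuse T P) l = b"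
    "x \<notin> Field P \<Longrightarrow> opp (fuse T P) x = opp T x"
proof -
  note D = bracketingD[OF B]
  have disj: "x \<noteq> y" if "(x, z) \<in> P" "(w, y) \<in> P" for x y z w
    using bracketing_pairD(5)[OF B that(1)] bracketing_pairD(6)[OF B that(2)] by metis
  show "opp (fuse T P) b = l" if p: "(b, l) \<in> P"
  proof -
    have "(THE e. (b, e) \<in> P \<or> (e, b) \<in> P) = l"
    proof (rule the_equality)
      show "e = l" if "(b, e) \<in> P \<or> (e, b) \<in> P" for e
        using that D(3)[OF _ p] disj[OF p] by blast
    qed (use p in simp)
    then show ?thesis using p by (auto simp: fuse_def Field_def)
  qed
  show "opp (fuse T P) l = b" if p: "(b, l) \<in> P"
  proof -
    have "(THE e. (l, e) \<in> P \<or> (e, l) \<in> P) = b"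
    proof (rule the_equality)
      show "e = b" if "(l, e) \<in> P \<or> (e, l) \<in> P" for e
        using that D(4)[OF _ p] disj[OF _ p] by blast
    qed (use p in simp)
    then show ?thesis using p by (auto simp: fuse_def Field_def)
  qed
qed (simp add: fuse_def)

lemma FieldE:
  assumes "x \<in> Field P"
  obtains l where "(x, l) \<in> P" | b where "(b, x) \<in> P"
  using assms by (auto simp: Field_def)

lemma rotation_system_fuse:
  assumes T: "rotation_system T" and B: "bracketing T P"
  shows "rotation_system (fuse T P)"
proof -
  note D = bracketingD[OF B] note o = opp_fuse[OF B] note r = rotation_systemD[OF T]
  have F: "x \<in> Field P \<Longrightarrow> opp T x = x" for x
    by (erule FieldE) (simp_all add: bracketing_pairD[OF B])
  have inv: "opp (fuse T P) (opp (fuse T P) x) = x" for x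
  proof (cases "x \<in> Field P")
    case True
    then show ?thesis by (rule FieldE) (simp_all add: o(1,2))
  next
    case False
    then have "opp T x \<notin> Field P" using F r(4) by metis
    then show ?thesis using False o(3) r(4) by simp
  qed
  have out: "opp (fuse T P) x = x" if x: "x \<notin> darts T" for x
  proof -
    have "x \<notin> Field P" using x by (auto elim!: FieldE dest: bracketing_pairD[OF B])
    then show ?thesis using x r(3) by (simp add: o(3) permutes_not_in)
  qed
  have "opp (fuse T P) permutes darts T"
    unfolding permutes_def using inv out by metis
  then show ?thesis using r(1,2) inv by (simp add: rotation_system_def)
qed

lemma edge_darts_fuse:
  assumes T: "rotation_system T" and B: "bracketing T P"
  shows "edge_darts (fuse T P) = edge_darts T \<union> Field P" "edge_darts T \<inter> Field P = {}"
    "half_edges (fuse T P) = half_edges T - Field P"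
proof -
  note D = bracketingD[OF B] note o = opp_fuse[OF B]
  have F: "x \<in> darts T \<and> opp T x = x \<and> opp (fuse T P) x \<noteq> x" if "x \<in> Field P" for x
    using that by (rule FieldE) (use bracketing_pairD[OF B] o(1,2) in metis)+
  show "edge_darts (fuse T P) = edge_darts T \<union> Field P" "edge_darts T \<inter> Field P = {}"
    "half_edges (fuse T P) = half_edges T - Field P"
    using F o(3) unfolding edge_darts_def half_edges_def by force+
qed

lemma card_edges_fuse:
  assumes T: "rotation_system T" and B: "bracketing T P"
  shows "card (edges (fuse T P)) = card (edges T) + card P"
proof -
  note D = bracketingD[OF B]
  have "fst ` P \<inter> snd ` P = {}" using bracketing_pairD(5,6)[OF B] by fastforce
  then have "card (Field P) = 2 * card P"
    unfolding Field_eq using bracketing_inj[OF B] finite_bracketing[OF T B]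
    by (simp add: card_Un_disjoint card_image)
  moreover have "finite (Field P)"
    using finite_bracketing[OF T B] by (simp add: finite_Field)
  ultimately have "card (edge_darts (fuse T P)) = card (edge_darts T) + 2 * card P"
    using edge_darts_fuse[OF T B] finite_edge_darts[OF T] by (simp add: card_Un_disjoint)
  then show ?thesis using card_edges[OF T] card_edges[OF rotation_system_fuse[OF T B]] by simp
qed

lemma next_dart_fuse:
  assumes B: "bracketing T P"
  shows "(b, l) \<in> P \<Longrightarrow> next_dart (fuse T P) b = next_dart T l"
    "(b, l) \<in> P \<Longrightarrow> next_dart (fuse T P) l = next_dart T b"
    "x \<notin> Field P \<Longrightarrow> next_dart (fuse T P) x = next_dart T x"
  using opp_fuse[OF B] bracketing_pairD(3,4)[OF B] by (simp_all add: next_dart_def)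

lemma connected_fuse_subset:
  assumes T: "rotation_system T" "connected_map T" and N: "rotation_system N" "darts N = darts T" "rot N = rot T"
    and o: "\<And>x. x \<in> edge_darts T \<Longrightarrow> opp N x = opp T x"
  shows "connected_map N"
proof (rule connected_mapI[OF N(1)])
  fix A x assume A: "A \<subseteq> darts N" "x \<in> A" "\<And>x. x \<in> A \<Longrightarrow> rot N x \<in> A" "\<And>x. x \<in> A \<Longrightarrow> opp N x \<in> A"
  have "opp T x \<in> A" if "x \<in> A" for x
    using o[of x] A(1) A(4)[OF that] that N(2) by (cases "x \<in> edge_darts T") (auto simp: edge_darts_def)
  then show "A = darts N" using connected_mapD[OF T _ A(2)] A(1,3) N by simp
qed

section \<open>Faces of the fusion of a bracketed tree\<close>

locale bracketed_tree =
  fixes T :: "'a pmap" and P :: "('a \<times> 'a) set"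
  assumes tree: "is_tree T" and bracketing: "bracketing T P"
begin

lemma is_map: "is_map T" and rs: "rotation_system T"
  using tree is_map_rotation_system by (auto simp: is_tree_def)

lemmas D = bracketingD[OF bracketing]
lemmas pairD = bracketing_pairD[OF bracketing]

lemma root_face: "root_face T = darts T"
  using tree faces_single[OF rs is_mapD(2)[OF is_map]] by (simp add: is_tree_def root_face_def)

lemma face: "d \<in> darts T \<Longrightarrow> orbit (next_dart T) d = darts T"
  using tree faces_single[OF rs] by (simp add: is_tree_def)

lemma P_darts: "(b, l) \<in> P \<Longrightarrow> b \<in> darts T \<and> l \<in> darts T"
  using pairD by blast

lemma pos_eq_iff: "x \<in> darts T \<Longrightarrow> y \<in> darts T \<Longrightarrow> pos T x = pos T y \<longleftrightarrow> x = y"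
  using pos_inj[of x T y] root_face by simp

lemma pos_next': "x \<in> darts T \<Longrightarrow> next_dart T x \<noteq> root_dart T \<Longrightarrow> pos T (next_dart T x) = Suc (pos T x)"
  using pos_next[OF rs] root_face by simp

lemma pos_le_last': "x \<in> darts T \<Longrightarrow> next_dart T x = root_dart T \<Longrightarrow> y \<in> darts T \<Longrightarrow> pos T y \<le> pos T x"
  using pos_le_last[OF rs] root_face by simp

lemma finite_P: "finite P"
  using finite_bracketing[OF rs bracketing] .

lemma finite_cover: "finite (cover T P x)"
  using finite_P by (simp add: cover_def)

lemma depth_le: "depth T P x \<le> card P"
  unfolding depth_def by (rule card_mono[OF finite_P]) (auto simp: cover_def)

text \<open>Moving past \<open>x\<close> closes the pair with leaf \<open>x\<close> and opens the
  pair with bud \<open>x\<close>. This includes the step back to the root, as all pairs are closed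
  at the end of the contour.\<close>

lemma cover_next:
  assumes x: "x \<in> darts T"
  shows "cover T P (next_dart T x) = cover T P x - {p. snd p = x} \<union> {p \<in> P. fst p = x}"
proof (cases "next_dart T x = root_dart T")
  case True
  have "pos T (snd p) \<le> pos T x \<and> pos T (fst p) < pos T x" if "p \<in> P" for p
    using pos_le_last'[OF x True, of "snd p"] P_darts[of "fst p" "snd p"] D(2)[of "fst p" "snd p"] that by auto
  then show ?thesis using True x pos_eq_iff[of _ x] P_darts by (fastforce simp: cover_def)
next
  case False
  have iff: "pos T (fst p) < Suc (pos T x) \<longleftrightarrow> fst p = x \<or> pos T (fst p) < pos T x"
    "Suc (pos T x) \<le> pos T (snd p) \<longleftrightarrow> snd p \<noteq> x \<and> pos T x \<le> pos T (snd p)"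
    "pos T (fst p) < pos T (snd p)" if "p \<in> P" for p
    using pos_eq_iff[of "fst p" x] pos_eq_iff[of "snd p" x] x P_darts[of "fst p" "snd p"] D(2)[of "fst p" "snd p"] that
    by (auto simp: less_Suc_eq Suc_le_eq order_less_le)
  show ?thesis
  proof (rule set_eqI)
    fix p
    show "p \<in> cover T P (next_dart T x) \<longleftrightarrow> p \<in> cover T P x - {p. snd p = x} \<union> {p \<in> P. fst p = x}"
    proof (cases "p \<in> P")
      case True
      show ?thesis using iff[OF True] True unfolding cover_def pos_next'[OF x False] by auto
    qed (simp add: cover_def)
  qed
qed

text \<open>As pairs do not cross, a pair other than \<open>(b, l)\<close> encloses both of its
  half-edges or neither.\<close>

lemma cover_leaf:
  assumes p: "(b, l) \<in> P"
  shows "cover T P l = insert (b, l) (cover T P b)" "(b, l) \<notin> cover T P b"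
proof -
  show "(b, l) \<notin> cover T P b" by (simp add: cover_def)
  have "(b', l') \<in> cover T P l \<longleftrightarrow> (b', l') \<in> cover T P b" if q: "(b', l') \<in> P" "(b', l') \<noteq> (b, l)" for b' l'
  proof -
    have "b' \<noteq> b" "l \<noteq> l'" using D(3,4) p q by blast+
    moreover have "b \<noteq> l'" "b' \<noteq> l" using pairD(5,6)[OF p] pairD(5,6)[OF q(1)] by auto
    ultimately have "pos T b' \<noteq> pos T b" "pos T l \<noteq> pos T l'" "pos T b \<noteq> pos T l'" "pos T b' \<noteq> pos T l"
      using pos_eq_iff P_darts p q by metis+
    then have "pos T b' < pos T l \<and> pos T l \<le> pos T l' \<longleftrightarrow> pos T b' < pos T b \<and> pos T b \<le> pos T l'"
      using D(2)[OF p] D(2)[OF q(1)] D(5)[OF p q(1)] D(5)[OF q(1) p] by linarith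
    then show ?thesis using q(1) unfolding cover_def by simp
  qed
  note other = this
  show "cover T P l = insert (b, l) (cover T P b)"
  proof (rule set_eqI)
    fix q :: "'a \<times> 'a"
    obtain b' l' where q: "q = (b', l')" by (cases q)
    have "(b, l) \<in> cover T P l" using p D(2)[OF p] by (simp add: cover_def)
    then show "q \<in> cover T P l \<longleftrightarrow> q \<in> insert (b, l) (cover T P b)"
      using other[of b' l'] q by (cases "q \<in> P"; cases "q = (b, l)") (auto simp: cover_def)
  qed
qed

text \<open>Fusion exchanges what comes after the bud and after the leaf. From the bud the walk
  jumps past the leaf and skips the inside of the pair; from the leaf it returns to the start of the
  inside.\<close>

lemma cover_next_fuse:
  assumes x: "x \<in> darts T"
  shows "cover T P (next_dart (fuse T P) x) = cover T P x"
proof (cases "x \<in> Field P")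
  case True
  then show ?thesis
  proof (rule FieldE)
    fix l assume p: "(x, l) \<in> P"
    have n1: "{p \<in> P. fst p = l} = {}" using pairD(6)[OF p] pairD(5) by fastforce
    have "snd q = l \<longleftrightarrow> q = (x, l)" if "q \<in> P" for q
      using D(4)[OF _ p, of "fst q"] that by (cases q) auto
    then have "q \<in> cover T P l - {p. snd p = l} \<longleftrightarrow> q \<in> cover T P l - {(x, l)}" for q
      by (cases "q \<in> P") (simp_all add: cover_def)
    then have n2: "cover T P l - {p. snd p = l} = cover T P l - {(x, l)}" by blast
    have "cover T P (next_dart T l) = cover T P x"
      unfolding cover_next[OF pairD(2)[OF p]] n1 n2 using cover_leaf[OF p] by simp
    then show ?thesis using next_dart_fuse(1)[OF bracketing p] by simp
  next
    fix b assume p: "(b, x) \<in> P"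
    have "snd q \<noteq> b" if "q \<in> P" for q
      using pairD(5)[OF p] pairD(6)[of "fst q" "snd q"] that by auto
    then have n1: "cover T P b - {p. snd p = b} = cover T P b" by (auto simp: cover_def)
    have q: "q = (b, x)" if "q \<in> P" "fst q = b" for q
      using D(3)[OF _ p, of "snd q"] that by (cases q) auto
    have n2: "{q \<in> P. fst q = b} = {(b, x)}"
    proof (intro equalityI subsetI)
      fix r assume "r \<in> {q \<in> P. fst q = b}"
      then have "r = (b, x)" by (intro q) simp_all
      then show "r \<in> {(b, x)}" by simp
    qed (use p in simp)
    have "cover T P (next_dart T b) = cover T P x"
      unfolding cover_next[OF pairD(1)[OF p]] n1 n2 using cover_leaf[OF p] by simp
    then show ?thesis using next_dart_fuse(2)[OF bracketing p] by simp
  qed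
next
  case False
  then have "{p. snd p = x} \<inter> cover T P x = {}" "{p \<in> P. fst p = x} = {}"
    unfolding cover_def Field_eq by blast+
  then have "cover T P x - {p. snd p = x} \<union> {p \<in> P. fst p = x} = cover T P x" by blast
  then show ?thesis using cover_next[OF x] next_dart_fuse(3)[OF bracketing False] by simp
qed

lemma rs_fuse: "rotation_system (fuse T P)"
  by (rule rotation_system_fuse[OF rs bracketing])

lemma connected_fuse: "connected_map (fuse T P)"
proof (rule connected_fuse_subset[OF rs is_mapD(4)[OF is_map] rs_fuse])
  show "opp (fuse T P) x = opp T x" if "x \<in> edge_darts T" for x
    using opp_fuse(3)[OF bracketing] edge_darts_fuse(2)[OF rs bracketing] that by blast
qed simp_all

lemma cover_face:
  assumes "x \<in> darts T" "y \<in> orbit (next_dart (fuse T P)) x"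
  shows "cover T P y = cover T P x"
  using assms(2)
proof (induct)
  case base show ?case using cover_next_fuse[OF assms(1)] .
next
  case (step y)
  have "y \<in> darts T" using face_subset_darts[OF rs_fuse, of x] step(1) assms(1) by auto
  then show ?case using cover_next_fuse step(2) by simp
qed

text \<open>Since \<open>cover\<close> is constant on faces, there are at least as many faces as
  covers: the empty one, and one for each leaf. So \<open>card P\<close> fused edges come with at
  least \<open>card P\<close> additional faces, and Euler's inequality forbids more.\<close>

lemma euler_fuse: "card (vertices (fuse T P)) + card (faces (fuse T P)) = card (edges (fuse T P)) + 2"
proof -
  let ?M = "fuse T P"
  have inj: "inj_on (cover T P) (snd ` P)"
  proof (rule inj_onI)
    fix l l' assume l: "l \<in> snd ` P" "l' \<in> snd ` P" and eq: "cover T P l = cover T P l'"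
    then obtain b b' where p: "(b, l) \<in> P" "(b', l') \<in> P" by auto
    have "(b, l) \<in> cover T P l'" "(b', l') \<in> cover T P l" using cover_leaf(1) p eq by auto
    then have "pos T l = pos T l'" by (auto simp: cover_def)
    then show "l = l'" using pos_eq_iff P_darts p by metis
  qed
  have ne: "{} \<notin> cover T P ` snd ` P" using cover_leaf(1) by force
  have "card P + 1 = card (insert {} (cover T P ` snd ` P))"
    using ne finite_P card_image[OF inj] card_image[OF bracketing_inj(2)[OF bracketing]] by simp
  \<comment> \<open>All darts of a face share one cover, which \<open>the_elem\<close>
    extracts.\<close>
  also have "\<dots> \<le> card ((\<lambda>C. the_elem (cover T P ` C)) ` faces ?M)"
  proof (rule card_mono)
    show "finite ((\<lambda>C. the_elem (cover T P ` C)) ` faces ?M)"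
      using rotation_systemD(1)[OF rs] by (simp add: faces_def)
    have "cover T P x \<in> (\<lambda>C. the_elem (cover T P ` C)) ` faces ?M" if x: "x \<in> darts T" for x
    proof -
      have "cover T P ` orbit (next_dart ?M) x = {cover T P x}"
        using cover_face[OF x] orbit_nonempty[of "next_dart ?M" x] by auto
      then have "cover T P x = the_elem (cover T P ` orbit (next_dart ?M) x)" by simp
      then show ?thesis using x by (auto simp: faces_def)
    qed
    from this[of "root_dart T"] this show "insert {} (cover T P ` snd ` P) \<subseteq> (\<lambda>C. the_elem (cover T P ` C)) ` faces ?M"
      using is_mapD(2)[OF is_map] P_darts by fastforce
  qed
  also have "\<dots> \<le> card (faces ?M)"
    by (rule card_image_le) (use rotation_systemD(1)[OF rs] in \<open>simp add: faces_def\<close>)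
  finally have "card P + 1 \<le> card (faces ?M)" .
  moreover have "card (vertices ?M) = card (vertices T)" by (simp add: vertices_def)
  moreover have "card (vertices T) + 1 = card (edges T) + 2"
    using is_mapD(5)[OF is_map] tree by (simp add: is_tree_def)
  ultimately show ?thesis
    using euler_inequality[OF rs_fuse connected_fuse] card_edges_fuse[OF rs bracketing] is_mapD(2)[OF is_map] by fastforce
qed

text \<open>Induction on the position. An uncovered dart is reached from the dart before it or, if
  that one is the leaf of a pair, from the bud of the pair, which comes earlier and is uncovered as
  well.\<close>

lemma root_face_fuse: "root_face (fuse T P) = {x \<in> darts T. cover T P x = {}}"
proof
  show "root_face (fuse T P) \<subseteq> {x \<in> darts T. cover T P x = {}}"
    using cover_face[OF is_mapD(2)[OF is_map]] face_subset_darts[OF rs_fuse, of "root_dart T"] is_mapD(2)[OF is_map]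
    by (auto simp: root_face_def)
  have "x \<in> root_face (fuse T P)" if "x \<in> darts T" "cover T P x = {}" for x
    using that
  proof (induction "pos T x" arbitrary: x rule: less_induct)
    case less
    show ?case
    proof (cases "x = root_dart T")
      case True
      then show ?thesis using root_in_root_face[OF rs_fuse] by simp
    next
      case False
      obtain y where y: "y \<in> darts T" "next_dart T y = x" "pos T x = Suc (pos T y)"
        using root_face_pred[OF rs _ False] less.prems(1) root_face by metis
      have cov: "cover T P x = cover T P y - {p. snd p = y} \<union> {p \<in> P. fst p = y}"
        using cover_next[OF y(1)] y(2) by simp
      show ?thesis
      proof (cases "y \<in> Field P")
        case True
        then show ?thesis
        proof (rule FieldE)
          fix l assume "(y, l) \<in> P"
          then show ?thesis using cov less.prems(2) by auto
        next
          fix b assume p: "(b, y) \<in> P"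
          have nx: "next_dart (fuse T P) b = x" using next_dart_fuse(1)[OF bracketing p] y(2) by simp
          have "cover T P b = {}" using cover_next_fuse[of b] P_darts[OF p] nx less.prems(2) by simp
          moreover have "pos T b < pos T x" using D(2)[OF p] y(3) by simp
          ultimately have "b \<in> root_face (fuse T P)" using less.hyps P_darts[OF p] by simp
          then show ?thesis using next_in_root_face nx by metis
        qed
      next
        case F: False
        have nx: "next_dart (fuse T P) y = x" using next_dart_fuse(3)[OF bracketing F] y(2) by simp
        have "cover T P y = {}" using cover_next_fuse[OF y(1)] nx less.prems(2) by simp
        then have "y \<in> root_face (fuse T P)" using less.hyps y by simp
        then show ?thesis using next_in_root_face nx by metis
      qed
    qed
  qed
  then show "{x \<in> darts T. cover T P x = {}} \<subseteq> root_face (fuse T P)" by auto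
qed

lemma bracketed_subset: "Q \<subseteq> P \<Longrightarrow> bracketed_tree T Q"
  using tree bracketing_subset[OF bracketing] by unfold_locales

lemma is_leg_map_fuse:
  assumes P: "perfect_bracketing T P"
  shows "is_leg_map 1 (fuse T P)"
proof -
  let ?M = "fuse T P"
  have w: "white T (root_dart T)"
    using P buds_leavesD(2)[of "root_dart T" T] by (simp add: perfect_bracketing_def)
  have he: "half_edges ?M = {root_dart T}"
  proof -
    have "root_dart T \<notin> Field P"
      using D(1) pairD(5) w by (auto elim!: FieldE)
    moreover have "half_edges T = insert (root_dart T) (Field P)"
      using P by (auto simp: half_edges_split(1) perfect_bracketing_def Field_eq)
    ultimately show ?thesis using edge_darts_fuse(3)[OF rs bracketing] by auto
  qed
  from w have l: "leaves ?M = {root_dart T}" "buds ?M = {}"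
    using he by (auto simp: leaves_def buds_def)
  have wopp: "white T (opp ?M d) \<noteq> white T d" if "d \<in> edge_darts ?M" for d
  proof (cases "d \<in> Field P")
    case True
    then show ?thesis
      by (rule FieldE) (use pairD(5,6) opp_fuse(1,2)[OF bracketing] in auto)
  next
    case False
    then have "d \<in> edge_darts T" using that edge_darts_fuse(1)[OF rs bracketing] by auto
    then show ?thesis using is_map opp_fuse(3)[OF bracketing False] by (simp add: is_map_def)
  qed
  have "is_map ?M"
    unfolding is_map_def
    using rs_fuse is_map connected_fuse euler_fuse wopp he root_in_root_face[OF rs_fuse]
    by (simp add: rotation_system_def is_map_def root_face_def)
  then show ?thesis using l by (simp add: is_leg_map_def)
qed

section \<open>Charges of subtrees\<close>

lemma next_dart_cut_simps:
  "next_dart (cut T d) d = next_dart T (opp T d)"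
  "next_dart (cut T d) (opp T d) = next_dart T d"
  "x \<noteq> d \<Longrightarrow> x \<noteq> opp T d \<Longrightarrow> next_dart (cut T d) x = next_dart T x"
  by (simp_all add: next_dart_cut[OF rs] transpose_def)

text \<open>The cut splits the only face of the tree into two contours, the interval
  \<open>I\<close> and its complement. Since the edge is separating, no other edge connects the two,
  and they are the components.\<close>

lemma component_cut:
  assumes d: "d \<in> edge_darts T" and lt: "pos T (opp T d) < pos T d"
  defines "I \<equiv> {x \<in> darts T. pos T (opp T d) < pos T x \<and> pos T x \<le> pos T d}"
  shows "component (cut T d) d = I" "component (cut T d) (opp T d) = darts T - I"
proof -
  let ?e = "opp T d" and ?N = "cut T d"
  let ?nx = "next_dart ?N"
  have dd: "d \<in> darts T" "?e \<in> darts T" "?e \<noteq> d"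
    using d rotation_systemD(6)[OF rs] by (auto simp: edge_darts_def)
  have N: "rotation_system ?N" by (rule rotation_system_cut[OF rs dd(1)])
  have IJ: "d \<in> I" "?e \<in> darts T - I" using dd lt by (auto simp: I_def)
  have nI: "?nx x \<in> I" if x: "x \<in> I" for x
  proof (cases "x = d")
    case True
    have "next_dart T ?e \<noteq> root_dart T" using pos_le_last'[OF dd(2) _ dd(1)] lt by fastforce
    then show ?thesis using True next_dart_cut_simps(1) pos_next'[OF dd(2)] lt dd next_dart_in_darts[OF rs]
      by (simp add: I_def)
  next
    case False
    have xd: "x \<in> darts T" and xe: "x \<noteq> ?e" using x by (auto simp: I_def)
    have "pos T x < pos T d" using x False pos_eq_iff[OF xd dd(1)] by (auto simp: I_def)
    moreover from this have "next_dart T x \<noteq> root_dart T" using pos_le_last'[OF xd _ dd(1)] by fastforce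
    ultimately show ?thesis using next_dart_cut_simps(3)[OF False xe] pos_next'[OF xd] x xd next_dart_in_darts[OF rs]
      by (simp add: I_def)
  qed
  have nJ: "?nx x \<in> darts T - I" if x: "x \<in> darts T - I" for x
  proof (cases "x = ?e")
    case True
    have "next_dart T d \<notin> I" using pos_next'[OF dd(1)] by (cases "next_dart T d = root_dart T") (auto simp: I_def)
    then show ?thesis using True next_dart_cut_simps(2) dd next_dart_in_darts[OF rs] by simp
  next
    case False
    have xd: "x \<in> darts T" "x \<noteq> d" using x IJ(1) by auto
    have "next_dart T x \<notin> I"
    proof (cases "next_dart T x = root_dart T")
      case F: False
      have "pos T x \<noteq> pos T ?e" using pos_eq_iff xd dd False by simp
      then show ?thesis using x pos_next'[OF xd(1) F] by (auto simp: I_def)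
    qed (simp add: I_def)
    then show ?thesis using next_dart_cut_simps(3)[OF xd(2) False] xd next_dart_in_darts[OF rs] by simp
  qed
  have sub: "orbit ?nx d \<subseteq> I" "orbit ?nx ?e \<subseteq> darts T - I"
    using orbit_subset_closed[of d I ?nx] orbit_subset_closed[of ?e "darts T - I" ?nx] IJ nI nJ by blast+
  have "darts T \<subseteq> orbit ?nx d \<union> orbit ?nx ?e"
  proof -
    have self: "d \<in> orbit ?nx d" "?e \<in> orbit ?nx ?e"
      using permutation_self_in_orbit[OF permutation_next_dart[OF N]] by auto
    have "next_dart T x \<in> orbit ?nx d \<union> orbit ?nx ?e" if "x \<in> orbit ?nx d \<union> orbit ?nx ?e" for x
    proof -
      consider "x = d" | "x = ?e" | "x \<noteq> d" "x \<noteq> ?e" by blast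
      then show ?thesis
      proof cases
        case 1
        have "?nx ?e \<in> orbit ?nx ?e" by (rule orbit.base)
        then show ?thesis using 1 next_dart_cut_simps(2)[of d] by simp
      next
        case 2
        have "?nx d \<in> orbit ?nx d" by (rule orbit.base)
        then show ?thesis using 2 next_dart_cut_simps(1)[of d] by simp
      next
        case 3
        have "?nx x \<in> orbit ?nx d \<union> orbit ?nx ?e" using that orbit.step by fast
        then show ?thesis using next_dart_cut_simps(3)[OF 3] by simp
      qed
    qed
    then show ?thesis using orbit_subset_closed[of d "orbit ?nx d \<union> orbit ?nx ?e" "next_dart T"] self face[OF dd(1)] by auto
  qed
  then have O: "orbit ?nx d = I" "orbit ?nx ?e = darts T - I" using sub by (auto simp: I_def)
  have notc: "\<not> connected_map ?N"
    using separating_iff[OF rs is_mapD(4)[OF is_map] is_mapD(5)[OF is_map] d] face[OF dd(1)] dd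
    by (simp add: separating_def)
  \<comment> \<open>If an edge of the cut map joined the two contours, every closed set would
    contain both of them and the cut map would be connected.\<close>
  have oI: "opp ?N x \<in> I" if x: "x \<in> I" for x
  proof (rule ccontr)
    assume nx: "opp ?N x \<notin> I"
    have xd: "x \<in> darts ?N" using x by (auto simp: I_def)
    then have ox: "opp ?N x \<in> darts T - I" using nx rotation_systemD(6)[OF N] by simp
    have "connected_map ?N"
    proof (rule connected_mapI[OF N])
      fix A y assume A: "A \<subseteq> darts ?N" "y \<in> A" "\<And>x. x \<in> A \<Longrightarrow> rot ?N x \<in> A" "\<And>x. x \<in> A \<Longrightarrow> opp ?N x \<in> A"
      have nA: "?nx x \<in> A" if "x \<in> A" for x unfolding next_dart_def by (intro A(3,4) that)
      have sA: "orbit ?nx z \<subseteq> A" if "z \<in> A" for z by (rule orbit_subset_closed) (use that nA in auto)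
      have oz: "orbit ?nx z = orbit ?nx z'" if "z \<in> orbit ?nx z'" for z z'
        using orbit_eq[OF permutation_next_dart[OF N] that] .
      have iA: "I \<subseteq> A \<or> darts T - I \<subseteq> A"
        using sA[OF A(2)] oz[of y d] oz[of y ?e] O A(1,2) by auto
      have 1: "darts T - I \<subseteq> A" if "I \<subseteq> A"
        using sA[of "opp ?N x"] A(4)[of x] that x ox O(2) oz[of "opp ?N x" ?e] by auto
      have 2: "I \<subseteq> A" if "darts T - I \<subseteq> A"
        using sA[of x] A(4)[of "opp ?N x"] that x ox O(1) oz[of x d] rotation_systemD(4)[OF N] by auto
      show "A = darts ?N" using iA 1 2 A(1) by auto
    qed
    then show False using notc by simp
  qed
  have oJ: "opp ?N x \<in> darts T - I" if "x \<in> darts T - I" for x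
    using oI[of "opp ?N x"] that rotation_systemD(4,6)[OF N, of x] by (metis Diff_iff cut_simps(1))
  have rI: "rot ?N x \<in> I" if "x \<in> I" for x
    using nI[OF oI[OF that]] rotation_systemD(4)[OF N] by (simp add: next_dart_def del: cut_simps)
  have rJ: "rot ?N x \<in> darts T - I" if "x \<in> darts T - I" for x
    using nJ[OF oJ[OF that]] rotation_systemD(4)[OF N] by (simp add: next_dart_def del: cut_simps)
  have csub: "component ?N z \<subseteq> A" if "z \<in> A" "\<And>x. x \<in> A \<Longrightarrow> rot ?N x \<in> A" "\<And>x. x \<in> A \<Longrightarrow> opp ?N x \<in> A" for z A
  proof
    fix x assume "x \<in> component ?N z"
    then have "(z, x) \<in> (dart_graph ?N)\<^sup>*" by (simp add: component_def)
    then show "x \<in> A" by induct (use that in \<open>auto simp: dart_graph_def simp del: cut_simps\<close>)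
  qed
  have cd: "component ?N d \<subseteq> I" by (rule csub[OF IJ(1) rI oI])
  have ce: "component ?N ?e \<subseteq> darts T - I" by (rule csub[OF IJ(2) rJ oJ])
  have self: "z \<in> component ?N z" for z by (simp add: component_def)
  have cl: "rot ?N x \<in> component ?N z \<and> opp ?N x \<in> component ?N z" if "x \<in> component ?N z" "x \<in> darts T" for x z
  proof -
    have "(x, rot ?N x) \<in> dart_graph ?N" "(x, opp ?N x) \<in> dart_graph ?N"
      using that(2) by (auto simp: dart_graph_def)
    then show ?thesis using that(1) by (auto simp: component_def simp del: cut_simps intro: rtrancl_into_rtrancl)
  qed
  have "component ?N d \<union> component ?N ?e = darts T"
  proof (rule connected_mapD[OF rs is_mapD(4)[OF is_map]])
    show "component ?N d \<union> component ?N ?e \<subseteq> darts T" using cd ce by (auto simp: I_def)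
    then have inD: "x \<in> darts T" if "x \<in> component ?N d \<union> component ?N ?e" for x using that by auto
    show "d \<in> component ?N d \<union> component ?N ?e" using self by blast
    show "rot T x \<in> component ?N d \<union> component ?N ?e" if "x \<in> component ?N d \<union> component ?N ?e" for x
      using cl[of x d] cl[of x ?e] that inD[OF that] by auto
    show "opp T x \<in> component ?N d \<union> component ?N ?e" if x: "x \<in> component ?N d \<union> component ?N ?e" for x
    proof (cases "x = d \<or> x = ?e")
      case True
      then show ?thesis using self[of d] self[of ?e] rotation_systemD(4)[OF rs] by auto
    next
      case False
      then have "opp ?N x = opp T x" by simp
      then show ?thesis using cl[of x d] cl[of x ?e] x inD[OF x] by (metis UnE UnI1 UnI2)
    qed
  qed
  then show "component ?N d = I" "component ?N ?e = darts T - I" using cd ce by (auto simp: I_def)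
qed

lemma charge_subtree:
  assumes P: "perfect_bracketing T P" and d: "d \<in> edge_darts T" and lt: "pos T (opp T d) < pos T d"
  shows "charge (subtree T d) = int (depth T P (opp T d)) - int (depth T P d)"
proof -
  define I where "I = {x \<in> darts T. pos T (opp T d) < pos T x \<and> pos T x \<le> pos T d}"
  let ?e = "opp T d" and ?S = "subtree T d"
  have dd: "d \<in> darts T" "?e \<in> darts T" "?e \<noteq> d"
    using d rotation_systemD(6)[OF rs] by (auto simp: edge_darts_def)
  have C: "component (cut T d) d = I" using component_cut(1)[OF d lt] by (simp add: I_def)
  have S: "darts ?S = I" "white ?S = white T" "root_dart ?S = d"
    "\<And>x. x \<in> I \<Longrightarrow> opp ?S x = opp (cut T d) x"
    by (simp_all add: subtree_def C Let_def perm_restrict_def)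
  have dI: "d \<in> I" "?e \<notin> I" "root_dart T \<notin> I" using dd lt by (auto simp: I_def)
  have h: "half_edges ?S - {d} = half_edges T \<inter> I"
  proof -
    have "opp ?S x = opp T x" if "x \<in> I" "x \<noteq> d" for x
      using S(4)[OF that(1)] that dI(2) by auto
    note o = this
    have "I \<subseteq> darts T" by (auto simp: I_def)
    then have "x \<in> half_edges ?S - {d} \<longleftrightarrow> x \<in> half_edges T \<inter> I" for x
      using S(1) dd(3) o[of x] by (cases "x = d") (auto simp: half_edges_def)
    then show ?thesis by blast
  qed
  have lb: "leaves ?S - {d} = leaves T \<inter> I" "buds ?S - {d} = buds T \<inter> I"
    using h S(2) by (auto simp: leaves_def buds_def)
  let ?B = "{p \<in> P. fst p \<in> I}" and ?L = "{p \<in> P. snd p \<in> I}"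
  have "buds T \<inter> I = fst ` ?B" using P by (auto simp: perfect_bracketing_def)
  then have cB: "card (buds T \<inter> I) = card ?B"
    using card_image inj_on_subset[OF bracketing_inj(1)[OF bracketing], of ?B] by fastforce
  have "leaves T \<inter> I = snd ` ?L" using P dI(3) by (auto simp: perfect_bracketing_def)
  then have cL: "card (leaves T \<inter> I) = card ?L"
    using card_image inj_on_subset[OF bracketing_inj(2)[OF bracketing], of ?L] by fastforce
  have ne: "pos T (fst p) \<noteq> pos T d" "pos T (fst p) \<noteq> pos T ?e" "pos T (snd p) \<noteq> pos T d" "pos T (snd p) \<noteq> pos T ?e"
    "pos T (fst p) < pos T (snd p)" "fst p \<in> darts T" "snd p \<in> darts T"
    if "p \<in> P" for p
  proof -
    have p: "(fst p, snd p) \<in> P" using that by simp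
    have "opp T (fst p) = fst p" "opp T (snd p) = snd p" using pairD(3,4)[OF p] .
    then have "fst p \<noteq> d" "fst p \<noteq> ?e" "snd p \<noteq> d" "snd p \<noteq> ?e"
      using dd(3) rotation_systemD(4)[OF rs] by metis+
    then show "pos T (fst p) \<noteq> pos T d" "pos T (fst p) \<noteq> pos T ?e" "pos T (snd p) \<noteq> pos T d" "pos T (snd p) \<noteq> pos T ?e"
      "pos T (fst p) < pos T (snd p)" "fst p \<in> darts T" "snd p \<in> darts T"
      using pos_eq_iff P_darts[OF p] dd D(2)[OF p] by auto
  qed
  \<comment> \<open>Both sides are the pairs whose span from bud to leaf meets \<open>I\<close>.
    Such a pair is open when \<open>I\<close> begins or has its bud in \<open>I\<close>; likewise it
    is open when \<open>I\<close> ends or has its leaf in \<open>I\<close>.\<close>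
  have un: "?B \<union> cover T P ?e = ?L \<union> cover T P d"
  proof (rule set_eqI)
    fix p
    show "p \<in> ?B \<union> cover T P ?e \<longleftrightarrow> p \<in> ?L \<union> cover T P d"
    proof (cases "p \<in> P")
      case True
      have "pos T ?e < pos T (fst p) \<and> pos T (fst p) \<le> pos T d \<or> pos T (fst p) < pos T ?e \<and> pos T ?e \<le> pos T (snd p) \<longleftrightarrow>
        pos T ?e < pos T (snd p) \<and> pos T (snd p) \<le> pos T d \<or> pos T (fst p) < pos T d \<and> pos T d \<le> pos T (snd p)"
        using ne(1-5)[OF True] lt by linarith
      then show ?thesis using True ne(6,7)[OF True] by (simp add: cover_def I_def)
    qed (simp add: cover_def)
  qed
  have disj1: "?B \<inter> cover T P ?e = {}" by (auto simp: cover_def I_def)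
  have disj2: "?L \<inter> cover T P d = {}"
  proof -
    have "p \<notin> cover T P d" if "p \<in> ?L" for p
      using that ne(3)[of p] by (simp add: cover_def I_def)
    then show ?thesis by blast
  qed
  have "finite ?B" "finite ?L" using finite_P by auto
  then have "card ?B + depth T P ?e = card ?L + depth T P d"
    using card_Un_disjoint[OF _ finite_cover disj1] card_Un_disjoint[OF _ finite_cover disj2] un
    unfolding depth_def by simp
  then show ?thesis using cB cL lb S(3) by (simp add: charge_def)
qed

lemma root_in_subtree_iff:
  assumes d: "d \<in> edge_darts T"
  shows "root_dart T \<in> darts (subtree T d) \<longleftrightarrow> pos T d < pos T (opp T d)"
proof -
  have dd: "d \<in> darts T" "opp T d \<in> darts T" "opp T d \<noteq> d" "opp T (opp T d) = d" "opp T d \<in> edge_darts T"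
    using d rotation_systemD[OF rs] edge_darts_opp[OF rs] by (auto simp: edge_darts_def)
  have S: "darts (subtree T d) = component (cut T d) d" by (simp add: subtree_def Let_def)
  consider "pos T (opp T d) < pos T d" | "pos T d < pos T (opp T d)"
    using pos_eq_iff dd by (metis linorder_neqE_nat)
  then show ?thesis
  proof cases
    case 1
    then show ?thesis using component_cut(1)[OF d] S by simp
  next
    case 2
    \<comment> \<open>The cut is the same from either dart, so here the side of \<open>d\<close> is
      the complement of the interval that belongs to \<open>opp T d\<close>.\<close>
    have "cut T (opp T d) = cut T d" by (simp add: cut_def dd fun_upd_twist[OF dd(3)])
    then show ?thesis using component_cut(2)[OF dd(5)] 2 S dd is_mapD(2)[OF is_map] by simp
  qed
qed

text \<open>Let \<open>x\<close> be a traversal from black to white. If its reverse comes first, the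
  black end is below, and charge at most 1 allows the reverse to be one level deeper. If
  \<open>x\<close> comes first, the white end is below, and charge at least 0 says that the reverse
  is not deeper.\<close>

lemma blossom_iff_breadth_first:
  assumes P: "perfect_bracketing T P"
  shows "is_blossom_tree T \<longleftrightarrow> breadth_first T P"
proof
  assume bl: "is_blossom_tree T"
  show "breadth_first T P"
    unfolding breadth_first_def
  proof (intro ballI impI)
    fix x assume x: "x \<in> edge_darts T" "\<not> white T x"
    let ?e = "opp T x"
    have e: "?e \<in> edge_darts T" "opp T ?e = x" "?e \<noteq> x" "x \<in> darts T" "?e \<in> darts T"
      using x edge_darts_opp[OF rs] rotation_systemD[OF rs] by (auto simp: edge_darts_def)
    have w: "white T ?e" using is_map x by (auto simp: is_map_def)
    consider "pos T ?e < pos T x" | "pos T x < pos T ?e"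
      using pos_eq_iff e by (metis linorder_neqE_nat)
    then show "depth T P ?e \<le> depth T P x \<or> depth T P ?e = Suc (depth T P x) \<and> pos T ?e < pos T x"
    proof cases
      case 1
      then have "charge (subtree T x) \<le> 1"
        using bl x root_in_subtree_iff[OF x(1)] by (auto simp: is_blossom_tree_def)
      then show ?thesis using charge_subtree[OF P x(1) 1] 1 by auto
    next
      case 2
      then have "charge (subtree T ?e) \<ge> 0"
        using bl e w root_in_subtree_iff[OF e(1)] by (auto simp: is_blossom_tree_def)
      then show ?thesis using charge_subtree[OF P e(1)] e 2 by auto
    qed
  qed
next
  assume bf: "breadth_first T P"
  show "is_blossom_tree T"
    unfolding is_blossom_tree_def
  proof (intro conjI ballI impI tree)
    fix d assume d: "d \<in> edge_darts T" and r: "root_dart T \<notin> darts (subtree T d)"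
    let ?e = "opp T d"
    have e: "?e \<in> edge_darts T" "opp T ?e = d" "?e \<noteq> d" "d \<in> darts T" "?e \<in> darts T"
      using d edge_darts_opp[OF rs] rotation_systemD[OF rs] by (auto simp: edge_darts_def)
    have lt: "pos T ?e < pos T d" using r root_in_subtree_iff[OF d] pos_eq_iff e by (metis linorder_neqE_nat)
    have w: "white T ?e \<longleftrightarrow> \<not> white T d" using is_map d by (auto simp: is_map_def)
    show "if white T d then charge (subtree T d) \<ge> 0 else charge (subtree T d) \<le> 1"
      using charge_subtree[OF P d lt] bf[unfolded breadth_first_def] d e w lt by fastforce
  qed
qed

end

section \<open>Opening a closure\<close>

lemma cut_fuse:
  assumes B: "bracketing T P" and p: "(b, l) \<in> P"
  shows "cut (fuse T P) b = fuse T (P - {(b, l)})"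
proof -
  let ?Q = "P - {(b, l)}"
  have BQ: "bracketing T ?Q" using bracketing_subset[OF B] by blast
  have nF: "b \<notin> Field ?Q" "l \<notin> Field ?Q"
  proof -
    have "(c, b) \<notin> P" "(l, c) \<notin> P" for c
      using bracketing_pairD(5,6)[OF B] p by blast+
    moreover have "(b, c) \<notin> ?Q" "(c, l) \<notin> ?Q" for c
      using bracketingD(3,4)[OF B _ p] by blast+
    ultimately show "b \<notin> Field ?Q" "l \<notin> Field ?Q" by (auto simp: Field_def)
  qed
  have "opp (cut (fuse T P) b) x = opp (fuse T ?Q) x" for x
  proof -
    consider "x = b" | "x = l" | "x \<noteq> b" "x \<noteq> l" by blast
    then show ?thesis
    proof cases
      case 3
      have "opp (fuse T P) x = opp (fuse T ?Q) x"
      proof (cases "x \<in> Field P")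
        case True
        then show ?thesis
          by (rule FieldE) (use 3 opp_fuse(1,2)[OF B] opp_fuse(1,2)[OF BQ] in auto)
      next
        case False
        then have "x \<notin> Field ?Q" using mono_Field[of ?Q P] by auto
        then show ?thesis using False opp_fuse(3)[OF B] opp_fuse(3)[OF BQ] by simp
      qed
      then show ?thesis using 3 opp_fuse(1)[OF B p] by simp
    qed (use nF opp_fuse(1)[OF B p] opp_fuse(3)[OF BQ] bracketing_pairD(3,4)[OF B p] in simp_all)
  qed
  then have "opp (cut (fuse T P) b) = opp (fuse T ?Q)" by blast
  then show ?thesis by (simp add: cut_def fuse_def)
qed

abbreviation opening_guard :: "'a pmap \<times> 'a \<Rightarrow> bool" where
  "opening_guard \<equiv> (\<lambda>(N, d). \<exists>e \<in> edge_darts N. \<not> separating N e)"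

section \<open>The walk on a partially fused tree\<close>

context bracketed_tree
begin

text \<open>A pair open at \<open>b\<close> closes after \<open>l\<close>, since pairs do not cross,
  and so encloses \<open>x\<close> too; the pair \<open>(b, l)\<close> is one more.\<close>

lemma depth_inside:
  assumes p: "(b, l) \<in> P" and x: "pos T b < pos T x" "pos T x \<le> pos T l"
  shows "Suc (depth T P b) \<le> depth T P x"
proof -
  have "insert (b, l) (cover T P b) \<subseteq> cover T P x"
  proof
    fix q assume q: "q \<in> insert (b, l) (cover T P b)"
    show "q \<in> cover T P x"
    proof (cases "q = (b, l)")
      case True
      then show ?thesis using p x by (simp add: cover_def)
    next
      case False
      obtain b' l' where q': "q = (b', l')" by (cases q)
      have c: "(b', l') \<in> P" "pos T b' < pos T b" "pos T b \<le> pos T l'"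
        using q q' False by (auto simp: cover_def)
      have "b \<noteq> l'" using pairD(5)[OF p] pairD(6)[OF c(1)] by auto
      then have "pos T b \<noteq> pos T l'" using pos_eq_iff P_darts[OF p] P_darts[OF c(1)] by blast
      then have "pos T l < pos T l'" using D(5)[OF c(1) p c(2)] c(3) by simp
      then show ?thesis using q' c x by (simp add: cover_def)
    qed
  qed
  then have "card (insert (b, l) (cover T P b)) \<le> depth T P x"
    unfolding depth_def by (rule card_mono[OF finite_cover])
  then show ?thesis using cover_leaf(2)[OF p] finite_cover by (simp add: depth_def)
qed

text \<open>The pairs whose bud has not been reached when the walk is at position \<open>i\<close> of turn \<open>p\<close>.\<close>

definition pending :: "nat \<Rightarrow> nat \<Rightarrow> ('a \<times> 'a) set" where
  "pending p i = {q \<in> P. p < depth T P (fst q) \<or> p = depth T P (fst q) \<and> i \<le> pos T (fst q)}"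

text \<open>Cutting a fused pair gives the fusion of the remaining pairs, which is connected because
  the tree is.\<close>

lemma not_separating_fused:
  assumes p: "(b, l) \<in> P"
  shows "b \<in> edge_darts (fuse T P)" "\<not> separating (fuse T P) b"
proof -
  let ?Q = "P - {(b, l)}"
  interpret Q: bracketed_tree T ?Q by (rule bracketed_subset) auto
  show "b \<in> edge_darts (fuse T P)" using edge_darts_fuse(1)[OF rs bracketing] p by (auto simp: Field_def)
  show "\<not> separating (fuse T P) b"
    using Q.connected_fuse cut_fuse[OF bracketing p] by (simp add: separating_def)
qed

lemma separating_tree: "e \<in> edge_darts T \<Longrightarrow> separating T e"
  using separating_iff[OF rs is_mapD(4)[OF is_map] is_mapD(5)[OF is_map]] face
  by (simp add: edge_darts_def rotation_systemD(6)[OF rs])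

text \<open>Uncovered darts are those of the root face, so both sides of the edge lie in that
  face.\<close>

lemma separating_fused:
  assumes d: "d \<in> edge_darts T" and c: "cover T P d = {}" "cover T P (opp T d) = {}"
  shows "separating (fuse T P) d"
proof -
  have dd: "d \<in> darts T" "opp T d \<in> darts T" using d rotation_systemD(6)[OF rs] by (auto simp: edge_darts_def)
  have F: "d \<in> root_face (fuse T P)" "opp T d \<in> root_face (fuse T P)"
    using root_face_fuse c dd by auto
  have "orbit (next_dart (fuse T P)) d = root_face (fuse T P)"
    using F(1) orbit_eq[OF permutation_next_dart[OF rs_fuse]] unfolding root_face_def by blast
  then have "opp T d \<in> orbit (next_dart (fuse T P)) d" using F(2) by simp
  moreover have "opp (fuse T P) d = opp T d" "d \<in> edge_darts (fuse T P)"
    using edge_darts_fuse[OF rs bracketing] opp_fuse(3)[OF bracketing] d by blast+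
  ultimately show ?thesis using separating_iff[OF rs_fuse connected_fuse euler_fuse] by simp
qed

text \<open>A pair that encloses \<open>x\<close> has its bud before \<open>x\<close> and at a
  smaller depth. The walk has therefore already passed this bud, and the pair is no longer
  pending.\<close>

lemma cover_pending:
  assumes "depth T P x \<le> p \<or> depth T P x = Suc p \<and> pos T x \<le> i"
  shows "cover T (pending p i) x = {}"
proof -
  have False if q: "q \<in> pending p i" "pos T (fst q) < pos T x" "pos T x \<le> pos T (snd q)" for q
  proof -
    have "(fst q, snd q) \<in> P" using q by (simp add: pending_def)
    from depth_inside[OF this q(2,3)] show False using q assms by (auto simp: pending_def)
  qed
  then show ?thesis by (auto simp: cover_def)
qed

text \<open>At a pending bud of depth \<open>p\<close> the walk cuts the pair and goes on behind its
  leaf. Anywhere else it moves one dart along the contour of the tree without a cut. Passing the end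
  of the contour begins the next turn.\<close>

lemma opening_step_fuse_pending:
  assumes bf: "breadth_first T P" and d: "d \<in> darts T" "depth T P d \<le> p"
  shows "\<exists>p' d'. opening_step (fuse T (pending p (pos T d)), d) = (fuse T (pending p' (pos T d')), d') \<and>
    d' \<in> darts T \<and> depth T P d' \<le> p' \<and> (p' = p \<and> pos T d < pos T d' \<or> p' = Suc p)"
proof -
  let ?Q = "pending p (pos T d)"
  let ?N = "fuse T ?Q"
  have QP: "?Q \<subseteq> P" by (auto simp: pending_def)
  interpret Q: bracketed_tree T ?Q by (rule bracketed_subset[OF QP])
  show ?thesis
  proof (cases "\<exists>l. (d, l) \<in> ?Q")
    case True
    then obtain l where l: "(d, l) \<in> ?Q" by blast
    then have lP: "(d, l) \<in> P" using QP by auto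
    have dp: "depth T P d = p" using l d(2) by (auto simp: pending_def)
    have nx: "next_dart ?N d = next_dart T l" by (rule next_dart_fuse(1)[OF Q.bracketing l])
    have st: "opening_step (?N, d) = (fuse T (?Q - {(d, l)}), next_dart T l)"
      using Q.not_separating_fused[OF l] pairD(5)[OF lP] nx cut_fuse[OF Q.bracketing l]
      by (simp add: opening_step_def)
    have dl: "depth T P (next_dart T l) = p"
      using cover_next_fuse[OF d(1)] next_dart_fuse(1)[OF bracketing lP] dp by (simp add: depth_def)
    have ld: "l \<in> darts T" "next_dart T l \<in> darts T" using pairD(2)[OF lP] next_dart_in_darts[OF rs] by auto
    \<comment> \<open>The jump from \<open>d\<close> past \<open>l\<close> skips no other bud of
      depth \<open>p\<close>, as everything inside the pair is deeper.\<close>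
    have mid: "q = (d, l)" if q: "q \<in> P" "depth T P (fst q) = p" "pos T d \<le> pos T (fst q)" "pos T (fst q) \<le> pos T l" for q
    proof -
      have "pos T (fst q) = pos T d"
        using depth_inside[OF lP, of "fst q"] q dp by (cases "pos T d < pos T (fst q)") auto
      then have "fst q = d" using pos_eq_iff d(1) P_darts[of "fst q" "snd q"] q(1) by simp
      then show ?thesis using D(3)[OF lP, of "snd q"] q(1) by (cases q) auto
    qed
    show ?thesis
    proof (cases "next_dart T l = root_dart T")
      case True
      have "pos T (fst q) \<le> pos T l" if "q \<in> P" for q
        using pos_le_last'[OF ld(1) True] P_darts[of "fst q" "snd q"] that by simp
      \<comment> \<open>The leaf ends the contour, so no bud of depth \<open>p\<close> is left and
        the next turn begins at the root, at position 0.\<close>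
      then have "?Q - {(d, l)} = pending (Suc p) 0"
      proof -
        have "q \<in> ?Q - {(d, l)} \<longleftrightarrow> q \<in> pending (Suc p) 0" for q
        proof (cases "q \<in> P \<and> depth T P (fst q) = p")
          case T: True
          then show ?thesis using mid[of q] \<open>\<And>q. q \<in> P \<Longrightarrow> pos T (fst q) \<le> pos T l\<close>[of q]
            by (auto simp: pending_def)
        next
          case F: False
          then have "q \<noteq> (d, l)" using dp lP by auto
          then show ?thesis using F by (auto simp: pending_def)
        qed
        then show ?thesis by blast
      qed
      then show ?thesis using st True ld(2) by (intro exI[of _ "Suc p"] exI[of _ "root_dart T"]) simp
    next
      case False
      have pl: "pos T (next_dart T l) = Suc (pos T l)" by (rule pos_next'[OF ld(1) False])
      have dlt: "pos T d < pos T l" by (rule D(2)[OF lP])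
      have "q \<in> ?Q - {(d, l)} \<longleftrightarrow> q \<in> pending p (Suc (pos T l))" for q
      proof (cases "q \<in> P \<and> depth T P (fst q) = p")
        case True
        then show ?thesis using mid[of q] dlt lP
          by (cases "pos T (fst q) \<le> pos T l") (auto simp: pending_def Suc_le_eq)
      next
        case F: False
        then have "q \<noteq> (d, l)" using dp lP by auto
        then show ?thesis using F by (auto simp: pending_def)
      qed
      then have "?Q - {(d, l)} = pending p (pos T (next_dart T l))" unfolding pl by blast
      then show ?thesis using st ld(2) dl dlt pl
        by (intro exI[of _ p] exI[of _ "next_dart T l"]) simp
    qed
  next
    case no: False
    have nF: "d \<notin> Field ?Q"
    proof
      assume "d \<in> Field ?Q"
      then obtain b where b: "(b, d) \<in> ?Q" using no by (auto elim: FieldE)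
      then have "(b, d) \<in> P" using QP by auto
      from depth_inside[OF this D(2)[OF this]] show False using b d(2) by (auto simp: pending_def)
    qed
    have nx: "next_dart ?N d = next_dart T d" by (rule next_dart_fuse(3)[OF Q.bracketing nF])
    \<comment> \<open>By \<open>breadth_first\<close> the other side of a tree edge is at depth at
      most \<open>p\<close>, or at depth \<open>Suc p\<close> and before \<open>d\<close>. In both
      cases no pending pair covers it, and both sides lie in the root face.\<close>
    have "separating ?N d" if e: "d \<in> edge_darts ?N" "\<not> white T d"
    proof (rule Q.separating_fused)
      show dT: "d \<in> edge_darts T" using e(1) nF edge_darts_fuse(1)[OF rs Q.bracketing] by auto
      show "cover T ?Q d = {}" by (rule cover_pending) (use d(2) in simp)
      show "cover T ?Q (opp T d) = {}"
        by (rule cover_pending) (use bf dT e(2) d(2) in \<open>fastforce simp: breadth_first_def\<close>)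
    qed
    then have st: "opening_step (?N, d) = (?N, next_dart T d)"
      using nx by (auto simp: opening_step_def)
    have ld: "next_dart T d \<in> darts T" using d(1) next_dart_in_darts[OF rs] by auto
    have nb: "fst q \<noteq> d" if "q \<in> ?Q" for q using nF that by (auto simp: Field_eq)
    show ?thesis
    proof (cases "next_dart T d = root_dart T")
      case True
      have eq: "pos T (fst q) = pos T d \<longleftrightarrow> fst q = d" "pos T (fst q) \<le> pos T d" if "q \<in> P" for q
        using pos_le_last'[OF d(1) True] P_darts[of "fst q" "snd q"] that pos_eq_iff d(1) by simp_all
      have "q \<in> ?Q \<longleftrightarrow> q \<in> pending (Suc p) 0" for q
        using eq[of q] nb[of q] by (auto simp: pending_def Suc_le_eq le_less)
      then have "?Q = pending (Suc p) 0" by blast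
      then show ?thesis using st True ld by (intro exI[of _ "Suc p"] exI[of _ "root_dart T"]) simp
    next
      case False
      have pl: "pos T (next_dart T d) = Suc (pos T d)" by (rule pos_next'[OF d(1) False])
      have eq: "pos T (fst q) = pos T d \<longleftrightarrow> fst q = d" if "q \<in> P" for q
        using P_darts[of "fst q" "snd q"] that pos_eq_iff d(1) by simp
      have "q \<in> ?Q \<longleftrightarrow> q \<in> pending p (Suc (pos T d))" for q
        using eq[of q] nb[of q] by (auto simp: pending_def Suc_le_eq le_less)
      then have Q': "?Q = pending p (pos T (next_dart T d))" unfolding pl by blast
      \<comment> \<open>The depth can grow here only if \<open>d\<close> is the bud of a pair cut
        before, which the walk now enters. A bud of depth \<open>p\<close> at this position would be
        pending, so the depth of \<open>d\<close> is below \<open>p\<close> and may grow by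
        one.\<close>
      have "depth T P (next_dart T d) \<le> p"
      proof (cases "\<exists>l. (d, l) \<in> P")
        case True
        then obtain l where l: "(d, l) \<in> P" by blast
        then have "depth T P d < p" using no d(2) by (auto simp: pending_def)
        moreover have "q = (d, l)" if "q \<in> P" "fst q = d" for q
          using D(3)[OF _ l, of "snd q"] that by (cases q) auto
        then have "cover T P (next_dart T d) \<subseteq> insert (d, l) (cover T P d)"
          unfolding cover_next[OF d(1)] by blast
        then have "depth T P (next_dart T d) \<le> card (insert (d, l) (cover T P d))"
          unfolding depth_def by (intro card_mono) (use finite_cover in auto)
        then have "depth T P (next_dart T d) \<le> Suc (depth T P d)"
          using card_insert_le_m1[of "Suc (depth T P d)" "cover T P d" "(d, l)"] by (simp add: depth_def)
        ultimately show ?thesis by simp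
      next
        case False
        then have "cover T P (next_dart T d) \<subseteq> cover T P d"
          unfolding cover_next[OF d(1)] by auto
        then have "depth T P (next_dart T d) \<le> depth T P d"
          unfolding depth_def by (rule card_mono[OF finite_cover])
        then show ?thesis using d(2) by simp
      qed
      then show ?thesis using st ld Q' pl
        by (intro exI[of _ p] exI[of _ "next_dart T d"]) simp
    qed
  qed
qed

text \<open>Formulated with \<open>while_option\<close>, so that termination is part of the result
  and the run can later be compared with that on an isomorphic map.\<close>

lemma opening_loop:
  assumes bf: "breadth_first T P"
  shows "d \<in> darts T \<Longrightarrow> depth T P d \<le> p \<Longrightarrow>
    \<exists>e. while_option opening_guard opening_step (fuse T (pending p (pos T d)), d) = Some (T, e)"
\<comment> \<open>Depths are at most \<open>card P\<close>, so a pair is pending only in the turns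
  \<open>0\<close> to \<open>card P\<close>. The factor \<open>Suc (face_length T)\<close> makes a
  new turn outweigh the jump back to small positions.\<close>
proof (induction "(card P + 1 - p) * Suc (face_length T) + (face_length T - pos T d)" arbitrary: p d rule: less_induct)
  case less
  let ?Q = "pending p (pos T d)" and ?n = "face_length T"
  show ?case
  proof (cases "?Q = {}")
    case True
    have "\<not> opening_guard (T, d)" using separating_tree by auto
    then show ?thesis using True by (subst while_option_unfold) simp
  next
    case False
    then obtain b l where bl: "(b, l) \<in> ?Q" by auto
    interpret Q: bracketed_tree T ?Q by (rule bracketed_subset) (auto simp: pending_def)
    have g: "opening_guard (fuse T ?Q, d)" using Q.not_separating_fused[OF bl] by auto
    have pP: "p \<le> card P" using bl depth_le[of b] by (auto simp: pending_def)
    obtain p' d' where st: "opening_step (fuse T ?Q, d) = (fuse T (pending p' (pos T d')), d')"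
      and d': "d' \<in> darts T" "depth T P d' \<le> p'" and lt: "p' = p \<and> pos T d < pos T d' \<or> p' = Suc p"
      using opening_step_fuse_pending[OF bf less.prems] by blast
    have posd: "pos T d < ?n" using pos_less[OF rs] root_face less.prems(1) by simp
    have m: "(card P + 1 - p') * Suc ?n + (?n - pos T d') < (card P + 1 - p) * Suc ?n + (?n - pos T d)"
      using lt
    proof
      assume "p' = p \<and> pos T d < pos T d'"
      moreover from this have "?n - pos T d' < ?n - pos T d" using posd by linarith
      ultimately show ?thesis by (simp only: add_less_cancel_left)
    next
      assume p': "p' = Suc p"
      then have "card P + 1 - p = Suc (card P + 1 - p')" using pP by simp
      then show ?thesis by simp
    qed
    show ?thesis using less.hyps[OF m d'] g st by (subst while_option_unfold) simp
  qed
qed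

lemma while_option_opening_fuse:
  assumes "breadth_first T P"
  shows "\<exists>e. while_option opening_guard opening_step (fuse T P, root_dart (fuse T P)) = Some (T, e)"
proof -
  have "pending 0 0 = P" by (auto simp: pending_def)
  then show ?thesis using opening_loop[OF assms is_mapD(2)[OF is_map], of 0] by simp
qed

lemma map_opening_fuse:
  assumes "breadth_first T P"
  shows "map_opening (fuse T P) = T"
  using while_option_opening_fuse[OF assms] by (auto simp: map_opening_def while_def)

end

section \<open>Every leg map is a closure\<close>

text \<open>Along a face, colours change at each edge and are kept at each half-edge. Hence a face
  traverses as many edges from black to white as from white to black.\<close>

lemma opp_in_root_face:
  assumes M: "is_map M"
    and b: "\<And>x. x \<in> root_face M \<Longrightarrow> x \<in> edge_darts M \<Longrightarrow> \<not> white M x \<Longrightarrow> opp M x \<in> root_face M"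
    and x: "x \<in> root_face M"
  shows "opp M x \<in> root_face M"
proof -
  note rs = is_map_rotation_system[OF M]
  let ?F = "root_face M"
  have FD: "?F \<subseteq> darts M" using root_face_subset_darts[OF rs is_mapD(2)[OF M]] .
  have finF: "finite ?F" using FD rotation_systemD(1)[OF rs] finite_subset by auto
  have wn: "white M (next_dart M y) = white M (opp M y)" if "y \<in> ?F" for y
    using M FD that rotation_systemD(6)[OF rs] by (auto simp: next_dart_def is_map_def)
  have wo: "white M (opp M y) \<longleftrightarrow> \<not> white M y" if "y \<in> edge_darts M" for y
    using M that by (auto simp: is_map_def)
  have inj: "inj_on (next_dart M) ?F"
    using permutes_inj[OF next_dart_permutes[OF rs]] by (rule inj_on_subset) simp
  have nF: "next_dart M ` ?F = ?F"
    by (rule card_subset_eq[OF finF]) (use next_in_root_face card_image[OF inj] in auto)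
  let ?BE = "{y \<in> ?F. y \<in> edge_darts M \<and> \<not> white M y}" and ?WE = "{y \<in> ?F. y \<in> edge_darts M \<and> white M y}"
  let ?HB = "{y \<in> ?F. y \<notin> edge_darts M \<and> \<not> white M y}"
  \<comment> \<open>A dart starts at a black vertex exactly if its predecessor in the face arrives
    at one, and \<open>next_dart\<close> permutes the face.\<close>
  have "next_dart M ` {y \<in> ?F. \<not> white M (opp M y)} = {y \<in> ?F. \<not> white M y}"
    using nF wn by (auto simp: image_iff) (metis image_iff)
  then have "card {y \<in> ?F. \<not> white M (opp M y)} = card {y \<in> ?F. \<not> white M y}"
    using card_image[OF inj_on_subset[OF inj], of "{y \<in> ?F. \<not> white M (opp M y)}"] by fastforce
  moreover have "{y \<in> ?F. \<not> white M y} = ?BE \<union> ?HB" by auto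
  moreover have "{y \<in> ?F. \<not> white M (opp M y)} = ?WE \<union> ?HB"
    using wo FD by (fastforce simp: edge_darts_def)
  ultimately have "card (?WE \<union> ?HB) = card (?BE \<union> ?HB)" by simp
  moreover have "card (?WE \<union> ?HB) = card ?WE + card ?HB" "card (?BE \<union> ?HB) = card ?BE + card ?HB"
    by (rule card_Un_disjoint; use finF in auto)+
  ultimately have eq: "card ?WE = card ?BE" by simp
  \<comment> \<open>Hypothesis \<open>b\<close> embeds the black-to-white traversals of the face
    into the white-to-black ones. As they are equally many, every white-to-black traversal is
    reached.\<close>
  have "opp M ` ?BE \<subseteq> ?WE" using b wo edge_darts_opp[OF rs] by auto
  moreover have "card (opp M ` ?BE) = card ?BE"
    using inj_on_subset[OF rotation_systemD(7)[OF rs]] by (intro card_image) auto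
  ultimately have W: "opp M ` ?BE = ?WE" using eq finF by (intro card_subset_eq) auto
  show ?thesis
  proof (cases "x \<in> edge_darts M \<and> white M x")
    case True
    then have "x \<in> opp M ` ?BE" using x W by blast
    then show ?thesis using rotation_systemD(4)[OF rs] by auto
  next
    case False
    then show ?thesis using b[OF x] x FD by (cases "x \<in> edge_darts M") (auto simp: edge_darts_def)
  qed
qed

section \<open>Merging another face into the root face by a cut\<close>

locale root_face_cut =
  fixes N :: "'a pmap" and P :: "('a \<times> 'a) set" and d :: 'a
  assumes is_map: "is_map N" and perfect: "perfect_bracketing N P"
    and d_face: "d \<in> root_face N" and d_edge: "d \<in> edge_darts N" and d_black: "\<not> white N d"
    and opp_d: "opp N d \<notin> root_face N"
begin

abbreviation "w \<equiv> opp N d"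
abbreviation "N' \<equiv> cut N d"
abbreviation "P' \<equiv> insert (d, w) P"

definition new_face :: "'a set" where
  "new_face = orbit (next_dart N) w"

text \<open>Rooting the map in the other face makes \<open>pos\<close> available there.\<close>

definition rerooted :: "'a pmap" where
  "rerooted = N\<lparr>root_dart := next_dart N w\<rparr>"

lemma rs: "rotation_system N"
  by (rule is_map_rotation_system[OF is_map])

lemma dd: "d \<in> darts N" "w \<in> darts N" "w \<noteq> d" "opp N w = d" "w \<in> edge_darts N" "white N w"
  using d_edge d_black edge_darts_opp[OF rs] is_map rotation_systemD[OF rs]
  by (auto simp: edge_darts_def is_map_def)

lemma rs': "rotation_system N'"
  by (rule rotation_system_cut[OF rs dd(1)])

lemma rs_rerooted: "rotation_system rerooted"
  using rs by (simp add: rotation_system_def rerooted_def)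

lemma next_rerooted: "next_dart rerooted = next_dart N" "root_dart rerooted = next_dart N w"
  by (auto simp: rerooted_def next_dart_def)

lemma root_face_rerooted: "root_face rerooted = new_face"
  using permutation_orbit_step[OF permutation_next_dart[OF rs]]
  by (simp add: root_face_def next_rerooted new_face_def)

lemma w_new: "w \<in> new_face"
  unfolding new_face_def by (rule permutation_self_in_orbit[OF permutation_next_dart[OF rs]])

lemma disjoint: "new_face \<inter> root_face N = {}"
proof -
  have "orbit (next_dart N) x = new_face \<and> orbit (next_dart N) x = root_face N" if "x \<in> new_face \<inter> root_face N" for x
    using that orbit_eq[OF permutation_next_dart[OF rs]] unfolding new_face_def root_face_def by auto
  then show ?thesis using w_new opp_d by auto
qed

lemma next_cut:
  "next_dart N' d = next_dart N w" "next_dart N' w = next_dart N d"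
  "x \<noteq> d \<Longrightarrow> x \<noteq> w \<Longrightarrow> next_dart N' x = next_dart N x"
  by (simp_all add: next_dart_cut[OF rs] transpose_def)

lemma next_new: "x \<in> new_face \<Longrightarrow> next_dart N x \<in> new_face"
  unfolding new_face_def by (rule orbit.step)

lemma d_notin_new: "d \<notin> new_face"
  using disjoint d_face by auto

text \<open>The walk follows the old contour up to \<open>d\<close>, goes once around the other face
  from \<open>next_dart N w\<close> to \<open>w\<close>, and resumes behind
  \<open>d\<close>.\<close>

lemma root_face': "root_face N' = root_face N \<union> new_face"
proof
  show "root_face N' \<subseteq> root_face N \<union> new_face"
    unfolding root_face_def[of N'] cut_simps
  proof (rule orbit_subset_closed)
    show "root_dart N \<in> root_face N \<union> new_face" using root_in_root_face[OF rs] by simp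
    fix x assume x: "x \<in> root_face N \<union> new_face"
    consider "x = d" | "x = w" | "x \<noteq> d" "x \<noteq> w" by blast
    then show "next_dart N' x \<in> root_face N \<union> new_face"
    proof cases
      case 1
      then show ?thesis using next_cut(1) next_new w_new by simp
    next
      case 2
      then show ?thesis using next_cut(2) next_in_root_face[OF d_face] by simp
    next
      case 3
      then show ?thesis using next_cut(3) next_in_root_face[of x N] next_new x by auto
    qed
  qed
  have new: "x \<in> root_face N'" if d: "d \<in> root_face N'" and x: "x \<in> new_face" for x
  proof -
    have "x \<in> root_face rerooted" using x root_face_rerooted by simp
    then show ?thesis
    proof (induction rule: root_face_induct[OF rs_rerooted, consumes 1, case_names root step])
      case root
      then show ?case using next_in_root_face[OF d] next_cut(1) next_rerooted(2) by simp
    next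
      case (step y)
      have "y \<noteq> w" "y \<noteq> d" using step(1,2) next_rerooted d_notin_new root_face_rerooted by auto
      then show ?case using next_in_root_face[OF step(4)] next_cut(3) next_rerooted(1) by simp
    qed
  qed
  have old: "x \<in> root_face N'" if "x \<in> root_face N" for x
    using that
  proof (induction rule: root_face_induct[OF rs, consumes 1, case_names root step])
    case root
    then show ?case using root_in_root_face[OF rs'] by simp
  next
    case (step y)
    show ?case
    proof (cases "y = d")
      case True
      then show ?thesis using next_in_root_face[OF new[OF _ w_new]] step(4) next_cut(2) by simp
    next
      case False
      have "y \<noteq> w" using step(1) opp_d by auto
      then show ?thesis using next_in_root_face[OF step(4)] next_cut(3) False by simp
    qed
  qed
  show "root_face N \<union> new_face \<subseteq> root_face N'" using old new[OF old[OF d_face]] by auto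
qed

text \<open>The new face is inserted right after \<open>d\<close> and has \<open>w\<close> as its
  last dart. Its length, by which the later darts are shifted, is thus
  \<open>Suc (pos rerooted w)\<close>.\<close>

definition new_pos :: "'a \<Rightarrow> nat" where
  "new_pos x = (if x \<in> new_face then Suc (pos N d) + pos rerooted x
     else if pos N x \<le> pos N d then pos N x else pos N x + Suc (pos rerooted w))"

lemma pos_cut: "x \<in> root_face N' \<Longrightarrow> pos N' x = new_pos x"
proof (rule pos_eqI[OF rs'])
  show "new_pos (root_dart N') = 0"
    using disjoint root_in_root_face[OF rs] by (auto simp: new_pos_def)
next
  fix y assume y: "y \<in> root_face N'" and ny: "next_dart N' y \<noteq> root_dart N'"
  consider (d) "y = d" | (w) "y = w" | (new) "y \<in> new_face" "y \<noteq> w" | (old) "y \<in> root_face N" "y \<notin> new_face" "y \<noteq> d"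
    using y disjoint unfolding root_face' by auto
  then show "new_pos (next_dart N' y) = Suc (new_pos y)"
  proof cases
    case d
    have "pos rerooted (next_dart N w) = 0" using pos_root[of rerooted] next_rerooted by simp
    then show ?thesis unfolding d next_cut new_pos_def using next_new[OF w_new] d_notin_new by simp
  next
    case w
    have nd: "next_dart N d \<in> root_face N" "next_dart N d \<notin> new_face"
      using next_in_root_face[OF d_face] disjoint by auto
    have "next_dart N d \<noteq> root_dart N" using ny w next_cut(2) by simp
    from pos_next[OF rs d_face this] show ?thesis
      unfolding w next_cut new_pos_def using nd w_new by simp
  next
    case new
    have yd: "y \<noteq> d" using new(1) d_notin_new by auto
    have inj: "inj (next_dart N)" using permutes_inj[OF next_dart_permutes[OF rs]] .
    have "next_dart rerooted y \<noteq> root_dart rerooted" using injD[OF inj, of y w] new(2) next_rerooted by auto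
    then have "pos rerooted (next_dart N y) = Suc (pos rerooted y)"
      using pos_next[OF rs_rerooted, of y] new(1) root_face_rerooted next_rerooted(1) by simp
    then show ?thesis unfolding next_cut(3)[OF yd new(2)] new_pos_def using new(1) next_new by simp
  next
    case old
    have yw: "y \<noteq> w" using old(2) w_new by auto
    have nd: "next_dart N y \<in> root_face N" "next_dart N y \<notin> new_face"
      using next_in_root_face[OF old(1)] disjoint by auto
    have "next_dart N y \<noteq> root_dart N" using ny next_cut(3)[OF old(3) yw] by simp
    from pos_next[OF rs old(1) this] have p: "pos N (next_dart N y) = Suc (pos N y)" .
    have "pos N y \<noteq> pos N d" using pos_inj[OF old(1) d_face] old(3) by simp
    then show ?thesis unfolding next_cut(3)[OF old(3) yw] new_pos_def using nd old(2) p by auto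
  qed
qed

lemma pos_old:
  assumes "x \<in> root_face N" "y \<in> root_face N"
  shows "pos N' x < pos N' y \<longleftrightarrow> pos N x < pos N y"
  using assms disjoint pos_cut[of x] pos_cut[of y] root_face' by (auto simp: new_pos_def)

lemma pos_old_new:
  assumes "x \<in> root_face N" "y \<in> new_face"
  shows "pos N' x < pos N' y \<longleftrightarrow> pos N x \<le> pos N d" "pos N' y < pos N' x \<longleftrightarrow> pos N d < pos N x"
proof -
  have "pos rerooted y \<le> pos rerooted w"
    using pos_le_last[OF rs_rerooted, of w y] root_face_rerooted next_rerooted assms(2) w_new by simp
  moreover have "x \<notin> new_face" using assms(1) disjoint by auto
  ultimately show "pos N' x < pos N' y \<longleftrightarrow> pos N x \<le> pos N d" "pos N' y < pos N' x \<longleftrightarrow> pos N d < pos N x"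
    using assms pos_cut[of x] pos_cut[of y] root_face' by (auto simp: new_pos_def)
qed

lemma pos_new_le:
  assumes "y \<in> new_face"
  shows "pos N' y \<le> pos N' w"
proof -
  have "pos rerooted y \<le> pos rerooted w"
    using pos_le_last[OF rs_rerooted, of w y] root_face_rerooted next_rerooted assms w_new by simp
  then show ?thesis using assms w_new pos_cut[of w] pos_cut[of y] root_face' by (simp add: new_pos_def)
qed

lemma bracketing: "bracketing N P"
  using perfect by (simp add: perfect_bracketing_def)

lemmas D = bracketingD[OF bracketing]

lemma P_face:
  assumes "(b, l) \<in> P"
  shows "b \<in> root_face N" "l \<in> root_face N" "b \<noteq> d" "l \<noteq> d" "b \<noteq> w" "l \<noteq> w"
proof -
  have "b \<in> half_edges N" "l \<in> half_edges N" using D(1)[OF assms] half_edges_split(1)[of N] by auto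
  then show "b \<in> root_face N" "l \<in> root_face N" "b \<noteq> d" "l \<noteq> d" "b \<noteq> w" "l \<noteq> w"
    using is_mapD(3)[OF is_map] d_edge dd(5) by (auto simp: half_edges_def edge_darts_def)
qed

lemma half_edges': "buds N' = insert d (buds N)" "leaves N' = insert w (leaves N)"
  using half_edges_cut[OF rs d_edge] d_black dd(6) by (auto simp: buds_def leaves_def)

lemma root_ne: "root_dart N \<noteq> d" "root_dart N \<noteq> w"
  using is_mapD(1)[OF is_map] d_edge dd(5) by (auto simp: half_edges_def edge_darts_def)

text \<open>All half-edges of \<open>N\<close> lie in its root face, hence outside the stretch
  inserted between \<open>d\<close> and \<open>w\<close>. So the new pair crosses no old
  one.\<close>

lemma bracketing': "bracketing N' P'"
  unfolding bracketing_def
proof (intro conjI ballI impI)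
  show "P' \<subseteq> buds N' \<times> (leaves N' - {root_dart N'})"
    using D(1) half_edges' root_ne by auto
  show "pos N' (fst p) < pos N' (snd p)" if "p \<in> P'" for p
    using that
  proof
    assume "p = (d, w)"
    then show ?thesis using pos_old_new(1)[OF d_face w_new] by simp
  next
    assume p: "p \<in> P"
    then show ?thesis using P_face[of "fst p" "snd p"] D(2)[of "fst p" "snd p"] pos_old by simp
  qed
  show "p = q" if "p \<in> P'" "q \<in> P'" and e: "fst p = fst q \<or> snd p = snd q" for p q
  proof (cases "p = (d, w)"; cases "q = (d, w)")
    assume "p \<noteq> (d, w)" "q \<noteq> (d, w)"
    then have "p \<in> P" "q \<in> P" using that by auto
    then show "p = q" using e bracketing unfolding bracketing_def by blast
  next
    assume a: "p = (d, w)" "q \<noteq> (d, w)"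
    then have "(fst q, snd q) \<in> P" using that by auto
    from P_face[OF this] show "p = q" using a e by auto
  next
    assume a: "p \<noteq> (d, w)" "q = (d, w)"
    then have "(fst p, snd p) \<in> P" using that by auto
    from P_face[OF this] show "p = q" using a e by auto
  qed simp
  show "pos N' (snd q) < pos N' (snd p)" if "p \<in> P'" "q \<in> P'"
    and c: "pos N' (fst p) < pos N' (fst q) \<and> pos N' (fst q) < pos N' (snd p)" for p q
  proof (cases "p = (d, w)"; cases "q = (d, w)")
    assume "p = (d, w)" "q = (d, w)" then show ?thesis using c by simp
  next
    assume "p \<noteq> (d, w)" "q \<noteq> (d, w)"
    then have p: "(fst p, snd p) \<in> P" and q: "(fst q, snd q) \<in> P" using that by auto
    show ?thesis using D(5)[OF p q] c P_face[OF p] P_face[OF q] pos_old by simp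
  next
    assume a: "p = (d, w)" "q \<noteq> (d, w)"
    then have q: "(fst q, snd q) \<in> P" using that by auto
    have "pos N d < pos N (fst q)" using c a pos_old[OF d_face P_face(1)[OF q]] by simp
    then show ?thesis using c a pos_old_new(2)[OF P_face(1)[OF q] w_new] by simp
  next
    assume a: "p \<noteq> (d, w)" "q = (d, w)"
    then have p: "(fst p, snd p) \<in> P" using that by auto
    have "pos N d < pos N (snd p)" using c a pos_old[OF d_face P_face(2)[OF p]] by simp
    then show ?thesis using a pos_old_new(2)[OF P_face(2)[OF p] w_new] by simp
  qed
qed

lemma perfect': "perfect_bracketing N' P'"
  using bracketing' perfect half_edges' by (auto simp: perfect_bracketing_def)

text \<open>The new pair encloses darts of the new face only. Hence a depth is final as soon as its
  dart has entered the root face, and so is the order in which edges are cut.\<close>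

lemma cover_old:
  assumes x: "x \<in> root_face N"
  shows "cover N' P' x = cover N P x"
proof -
  have "(d, w) \<notin> cover N' P' x"
    using pos_old[OF d_face x] pos_old_new(2)[OF x w_new] by (auto simp: cover_def)
  moreover have "(b, l) \<in> cover N' P' x \<longleftrightarrow> (b, l) \<in> cover N P x" if "(b, l) \<in> P" for b l
    using that pos_old[OF P_face(1)[OF that] x] pos_old[OF P_face(2)[OF that] x]
    by (auto simp: cover_def not_less[symmetric])
  moreover have "(d, w) \<notin> P" using P_face(3)[of d w] by blast
  ultimately have "q \<in> cover N' P' x \<longleftrightarrow> q \<in> cover N P x" for q
    by (cases q; cases "q \<in> P"; cases "q = (d, w)") (auto simp: cover_def)
  then show ?thesis by blast
qed

lemma cover_new:
  assumes x: "x \<in> new_face"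
  shows "cover N' P' x = insert (d, w) (cover N P d)"
proof -
  have "(d, w) \<in> cover N' P' x"
    using pos_old_new(1)[OF d_face x] pos_new_le[OF x] by (auto simp: cover_def)
  moreover have "(b, l) \<in> cover N' P' x \<longleftrightarrow> (b, l) \<in> cover N P d" if p: "(b, l) \<in> P" for b l
  proof -
    have ne: "pos N b \<noteq> pos N d" "pos N l \<noteq> pos N d"
      using pos_inj[of _ N d] P_face[OF p] d_face by auto
    have "pos N' b < pos N' x \<longleftrightarrow> pos N b < pos N d" "pos N' x \<le> pos N' l \<longleftrightarrow> pos N d \<le> pos N l"
      using pos_old_new(1)[OF P_face(1)[OF p] x] pos_old_new(1)[OF P_face(2)[OF p] x] ne by auto
    then show ?thesis using p by (simp add: cover_def)
  qed
  moreover have "(d, w) \<notin> P" using P_face(3)[of d w] by blast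
  ultimately have "q \<in> cover N' P' x \<longleftrightarrow> q \<in> insert (d, w) (cover N P d)" for q
    by (cases q; cases "q \<in> P"; cases "q = (d, w)") (auto simp: cover_def)
  then show ?thesis by blast
qed

lemma depth_old: "x \<in> root_face N \<Longrightarrow> depth N' P' x = depth N P x"
  by (simp add: depth_def cover_old)

lemma depth_new: "x \<in> new_face \<Longrightarrow> depth N' P' x = Suc (depth N P d)"
proof -
  have "(d, w) \<notin> cover N P d" "finite (cover N P d)"
    using finite_bracketing[OF rs bracketing] by (simp_all add: cover_def)
  then show "x \<in> new_face \<Longrightarrow> depth N' P' x = Suc (depth N P d)"
    unfolding depth_def by (simp add: cover_new)
qed

text \<open>One edge is removed and at most one face is lost; Euler's inequality excludes that no
  face is lost, so Euler's formula persists. Both new half-edges lie in the root face, since this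
  has absorbed the face of \<open>w\<close>.\<close>

lemma is_map': "is_map N'"
proof -
  have "root_face N = orbit (next_dart N) d"
    using d_face orbit_eq[OF permutation_next_dart[OF rs]] unfolding root_face_def by blast
  then have wd: "w \<notin> orbit (next_dart N) d" using opp_d by simp
  have ne: "darts N' \<noteq> {}" using dd(1) by auto
  have c: "connected_map N'" by (rule connected_cut[OF rs is_mapD(4)[OF is_map] dd(1) wd])
  have "card (vertices N') + card (faces N') = card (edges N') + 2"
    using euler_inequality[OF rs' c] ne card_faces_cut_merge[OF rs dd(1) wd] card_edges_cut[OF rs d_edge]
      is_mapD(5)[OF is_map] by (simp del: cut_simps(5))
  moreover have "half_edges N' \<subseteq> root_face N'"
    using half_edges_cut[OF rs d_edge] is_mapD(3)[OF is_map] root_face' d_face w_new by auto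
  moreover have "\<forall>x \<in> edge_darts N'. white N' (opp N' x) \<noteq> white N' x"
    using edge_darts_cut[OF rs d_edge] is_map by (auto simp: is_map_def)
  ultimately show ?thesis
    using rs' c is_map is_mapD(1)[OF is_map] half_edges_cut[OF rs d_edge] unfolding is_map_def
    by (simp add: rotation_system_def root_face_def del: cut_simps(5))
qed

text \<open>Fusing the new pair restores the edge just cut, so the closure is an invariant of the
  construction.\<close>

lemma fuse': "fuse N' P' = fuse N P"
proof -
  have nF: "d \<notin> Field P" "w \<notin> Field P" using P_face(3-6) by (blast elim: FieldE)+
  have "opp (fuse N' P') x = opp (fuse N P) x" for x
  proof -
    consider "x = d" | "x = w" | "x \<in> Field P" | "x \<noteq> d" "x \<noteq> w" "x \<notin> Field P" by blast
    then show ?thesis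
    proof cases
      case 3
      then show ?thesis
        by (rule FieldE) (simp_all add: opp_fuse(1,2)[OF bracketing] opp_fuse(1,2)[OF bracketing'])
    next
      case 4
      then have "x \<notin> Field P'" by auto
      then show ?thesis using 4 opp_fuse(3)[OF bracketing] opp_fuse(3)[OF bracketing'] by simp
    qed (use nF dd(4) opp_fuse(3)[OF bracketing] opp_fuse(1,2)[OF bracketing', of d w] in simp_all)
  qed
  then have "opp (fuse N' P') = opp (fuse N P)" by blast
  then show ?thesis by (simp add: cut_def fuse_def)
qed

end

text \<open>The walk has stopped at position \<open>pos N c\<close> of turn \<open>p\<close>.\<close>

definition opened_up_to :: "'a pmap \<Rightarrow> ('a \<times> 'a) set \<Rightarrow> nat \<Rightarrow> 'a \<Rightarrow> bool" where
  "opened_up_to N P p c \<longleftrightarrow> c \<in> root_face N \<and>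
     (\<forall>y \<in> root_face N. depth N P y \<le> p \<or> depth N P y = Suc p \<and> pos N y \<le> pos N c) \<and>
     (\<forall>x \<in> root_face N. x \<in> edge_darts N \<longrightarrow> \<not> white N x \<longrightarrow>
        depth N P x < p \<or> depth N P x = p \<and> pos N x \<le> pos N c \<longrightarrow> opp N x \<in> root_face N) \<and>
     (\<forall>x \<in> root_face N. x \<in> edge_darts N \<longrightarrow> \<not> white N x \<longrightarrow> opp N x \<in> root_face N \<longrightarrow>
        depth N P (opp N x) \<le> depth N P x \<or>
        depth N P (opp N x) = Suc (depth N P x) \<and> pos N (opp N x) < pos N x)"

lemma opened_up_toD:
  assumes "opened_up_to N P p c"
  shows "c \<in> root_face N"
    "\<And>y. y \<in> root_face N \<Longrightarrow> depth N P y \<le> p \<or> depth N P y = Suc p \<and> pos N y \<le> pos N c"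
    "\<And>x. x \<in> root_face N \<Longrightarrow> x \<in> edge_darts N \<Longrightarrow> \<not> white N x \<Longrightarrow>
        depth N P x < p \<or> depth N P x = p \<and> pos N x \<le> pos N c \<Longrightarrow> opp N x \<in> root_face N"
    "\<And>x. x \<in> root_face N \<Longrightarrow> x \<in> edge_darts N \<Longrightarrow> \<not> white N x \<Longrightarrow> opp N x \<in> root_face N \<Longrightarrow>
        depth N P (opp N x) \<le> depth N P x \<or>
        depth N P (opp N x) = Suc (depth N P x) \<and> pos N (opp N x) < pos N x"
  using assms unfolding opened_up_to_def by blast+

section \<open>Building the tree cut by cut\<close>

lemma lex_le_encoded:
  fixes a b :: nat
  assumes "a * n + i \<le> b * n + j" "i < n" "j < n"
  shows "a < b \<or> a = b \<and> i \<le> j"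
proof -
  have "\<not> b < a"
  proof
    assume "b < a"
    then have "Suc b * n \<le> a * n" by (intro mult_le_mono1) simp
    then show False using assms by simp
  qed
  then show ?thesis using assms by (cases "a = b") auto
qed

text \<open>In the new root face every dart has at most the depth of \<open>d\<close>, or is one
  deeper and not beyond \<open>w\<close>. A black-to-white traversal up to \<open>w\<close> already
  had both sides in the old root face, so the old condition carries over. For a later traversal,
  this bound on its other side is the required condition.\<close>

lemma (in root_face_cut) opened_up_to_cut:
  assumes op: "opened_up_to N P p c"
    and first: "\<And>x. x \<in> root_face N \<Longrightarrow> x \<in> edge_darts N \<Longrightarrow> \<not> white N x \<Longrightarrow>
      depth N P x < depth N P d \<or> depth N P x = depth N P d \<and> pos N x < pos N d \<Longrightarrow> opp N x \<in> root_face N"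
  shows "opened_up_to N' P' (depth N P d) w"
  unfolding opened_up_to_def
proof (intro conjI ballI impI)
  note O = opened_up_toD[OF op]
  \<comment> \<open>The previous stop \<open>c\<close> of turn \<open>p\<close> lies strictly before
    \<open>d\<close>: up to there, the other sides are already in the root face, while that of
    \<open>d\<close> is not.\<close>
  have late: "\<not> (depth N P d < p \<or> depth N P d = p \<and> pos N d \<le> pos N c)"
    using O(3)[OF d_face d_edge d_black] opp_d by auto
  show wF: "w \<in> root_face N'" using w_new root_face' by simp
  have bound: "depth N' P' y \<le> depth N P d \<or>
      depth N' P' y = Suc (depth N P d) \<and> (y \<in> new_face \<or> pos N y < pos N d)" if y: "y \<in> root_face N'" for y
  proof (cases "y \<in> new_face")
    case True
    then show ?thesis using depth_new by simp
  next
    case False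
    then have "y \<in> root_face N" using y root_face' by auto
    then show ?thesis using O(2)[of y] late depth_old[of y] by auto
  qed
  show "depth N' P' y \<le> depth N P d \<or> depth N' P' y = Suc (depth N P d) \<and> pos N' y \<le> pos N' w"
    if y: "y \<in> root_face N'" for y
  proof (cases "y \<in> new_face")
    case True
    then show ?thesis using depth_new pos_new_le by simp
  next
    case False
    then have yF: "y \<in> root_face N" using y root_face' by auto
    then show ?thesis using bound[OF y] False pos_old_new(1)[OF yF w_new] by auto
  qed
  have edge': "x \<in> edge_darts N" "opp N' x = opp N x" "x \<noteq> d" if "x \<in> edge_darts N'" for x
    using that edge_darts_cut[OF rs d_edge] by auto
  have opp_old: "opp N x \<in> root_face N"
    if x: "x \<in> root_face N" "x \<in> edge_darts N" "\<not> white N x" "x \<noteq> d"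
      and le: "depth N P x < depth N P d \<or> depth N P x = depth N P d \<and> pos N x \<le> pos N d" for x
  proof -
    have "pos N x \<noteq> pos N d" using pos_inj[OF x(1) d_face] x(4) by simp
    then show ?thesis using first[OF x(1-3)] le by auto
  qed
  have early: "x \<in> root_face N \<and> opp N x \<in> root_face N"
    if x: "x \<in> root_face N'" "x \<in> edge_darts N'" "\<not> white N x"
      and le: "depth N' P' x < depth N P d \<or> depth N' P' x = depth N P d \<and> pos N' x \<le> pos N' w" for x
  proof -
    have "x \<notin> new_face" using depth_new[of x] le by auto
    then have xF: "x \<in> root_face N" using x(1) root_face' by auto
    then show ?thesis
      using opp_old[OF xF edge'(1)[OF x(2)] x(3) edge'(3)[OF x(2)]] le depth_old[OF xF]
        pos_old_new(2)[OF xF w_new] by auto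
  qed
  show "opp N' x \<in> root_face N'"
    if x: "x \<in> root_face N'" "x \<in> edge_darts N'" "\<not> white N' x"
      and le: "depth N' P' x < depth N P d \<or> depth N' P' x = depth N P d \<and> pos N' x \<le> pos N' w" for x
    using early[OF x(1,2) _ le] x(3) edge'(2)[OF x(2)] root_face' by auto
  show "depth N' P' (opp N' x) \<le> depth N' P' x \<or>
      depth N' P' (opp N' x) = Suc (depth N' P' x) \<and> pos N' (opp N' x) < pos N' x"
    if x: "x \<in> root_face N'" "x \<in> edge_darts N'" "\<not> white N' x" "opp N' x \<in> root_face N'" for x
  proof (cases "depth N' P' x < depth N P d \<or> depth N' P' x = depth N P d \<and> pos N' x \<le> pos N' w")
    case True
    then have F: "x \<in> root_face N" "opp N x \<in> root_face N" using early[OF x(1,2)] x(3) by auto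
    then show ?thesis
      using O(4)[OF F(1) edge'(1)[OF x(2)] _ F(2)] x(3) edge'(2)[OF x(2)] depth_old[OF F(1)] depth_old[OF F(2)]
        pos_old[OF F(2,1)] by auto
  next
    case late': False
    show ?thesis
    proof (cases "opp N' x \<in> new_face")
      case True
      then show ?thesis using late' depth_new pos_new_le[OF True] by fastforce
    next
      case False
      then have yF: "opp N' x \<in> root_face N" using x(4) root_face' by auto
      then show ?thesis using late' bound[OF x(4)] False pos_old_new(1)[OF yF w_new] by fastforce
    qed
  qed
qed

text \<open>Each cut uses up an edge. When no black-to-white traversal of the root face has its
  other side elsewhere, counting colours shows the same for the remaining traversals. The root face
  is then closed under \<open>opp\<close>, contains all darts, and the map is a tree.\<close>

lemma opening_exists:
  assumes "is_map N" "perfect_bracketing N P" "opened_up_to N P p c"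
  shows "\<exists>T Q. is_tree T \<and> perfect_bracketing T Q \<and> breadth_first T Q \<and> fuse T Q = fuse N P"
  using assms
proof (induction "card (edge_darts N)" arbitrary: N P p c rule: less_induct)
  case less
  note M = \<open>is_map N\<close> and perfect = \<open>perfect_bracketing N P\<close> and O = opened_up_toD[OF less.prems(3)]
  note rs = is_map_rotation_system[OF M]
  let ?X = "{x \<in> root_face N. x \<in> edge_darts N \<and> \<not> white N x \<and> opp N x \<notin> root_face N}"
  show ?case
  proof (cases "?X = {}")
    case True
    have "orbit (next_dart N) (root_dart N) = darts N"
    proof (rule face_eq_darts_if_opp_closed[OF rs is_mapD(4)[OF M] is_mapD(2)[OF M]])
      show "opp N x \<in> orbit (next_dart N) (root_dart N)" if "x \<in> orbit (next_dart N) (root_dart N)" for x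
        using opp_in_root_face[OF M, of x] that True unfolding root_face_def by auto
    qed
    then have all: "root_face N = darts N" and "is_tree N"
      using faces_single[OF rs is_mapD(2)[OF M]] M by (auto simp: is_tree_def root_face_def)
    moreover have "breadth_first N P"
      unfolding breadth_first_def using O(4) all rotation_systemD(6)[OF rs] by (auto simp: edge_darts_def)
    ultimately show ?thesis using perfect by blast
  next
    case False
    \<comment> \<open>Positions stay below \<open>face_length N\<close>, so this number encodes the
      lexicographic order of depth and position.\<close>
    let ?f = "\<lambda>x. depth N P x * face_length N + pos N x"
    have "finite ?X" using finite_edge_darts[OF rs] by (rule rev_finite_subset) auto
    then obtain d where d: "d \<in> ?X" "\<And>x. x \<in> ?X \<Longrightarrow> ?f d \<le> ?f x"
      using finite_has_min[of ?X ?f] False by blast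
    interpret C: root_face_cut N P d
      using M perfect d(1) by unfold_locales auto
    have lex: "depth N P d < depth N P x \<or> depth N P d = depth N P x \<and> pos N d \<le> pos N x" if "x \<in> ?X" for x
      using lex_le_encoded[OF d(2)[OF that]] pos_less[OF rs] d(1) that by auto
    have "opened_up_to (cut N d) (insert (d, opp N d) P) (depth N P d) (opp N d)"
    proof (rule C.opened_up_to_cut[OF less.prems(3)], rule ccontr)
      fix x assume x: "x \<in> root_face N" "x \<in> edge_darts N" "\<not> white N x" "opp N x \<notin> root_face N"
        and lt: "depth N P x < depth N P d \<or> depth N P x = depth N P d \<and> pos N x < pos N d"
      show False using lex[of x] x lt by auto
    qed
    moreover have "card (edge_darts (cut N d)) < card (edge_darts N)"
      unfolding edge_darts_cut[OF rs C.d_edge]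
      by (rule psubset_card_mono[OF finite_edge_darts[OF rs]]) (use C.d_edge in auto)
    ultimately show ?thesis using less.hyps[OF _ C.is_map' C.perfect'] C.fuse' by metis
  qed
qed

lemma leg_map_is_fused:
  assumes M: "is_leg_map 1 M"
  shows "\<exists>T Q. is_tree T \<and> perfect_bracketing T Q \<and> breadth_first T Q \<and> fuse T Q = M"
proof -
  have m: "is_map M" using M by (simp add: is_leg_map_def)
  note rs = is_map_rotation_system[OF m]
  have "leaves M = {root_dart M}" using M by (auto simp: is_leg_map_def card_1_singleton_iff)
  then have p: "perfect_bracketing M {}"
    using M by (simp add: perfect_bracketing_def bracketing_def is_leg_map_def)
  \<comment> \<open>The start value is the root at turn 0. All depths are 0, and the only dart at
    position 0 is the root half-edge, so there is no traversal to account for yet.\<close>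
  have "x \<notin> edge_darts M" if "x \<in> root_face M" "pos M x = 0" for x
    using that pos_0_iff[OF rs] is_mapD(1)[OF m] by (auto simp: edge_darts_def half_edges_def)
  then have "opened_up_to M {} 0 (root_dart M)"
    using root_in_root_face[OF rs] by (auto simp: opened_up_to_def depth_def cover_def)
  from opening_exists[OF m p this] show ?thesis by simp
qed

section \<open>Isomorphisms\<close>

lemma orbit_image_conj:
  assumes d: "d \<in> S" and S: "\<And>x. x \<in> S \<Longrightarrow> p x \<in> S" and f: "\<And>x. x \<in> S \<Longrightarrow> f (p x) = q (f x)"
  shows "orbit q (f d) = f ` orbit p d"
proof
  have sub: "orbit p d \<subseteq> S" using orbit_subset_closed[of d S p] d S by blast
  show "orbit q (f d) \<subseteq> f ` orbit p d"
  proof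
    fix y assume "y \<in> orbit q (f d)"
    then show "y \<in> f ` orbit p d"
    proof induct
      case base
      show ?case using f[OF d] orbit.base[of p d] by (metis imageI)
    next
      case (step y)
      then obtain x where x: "x \<in> orbit p d" "y = f x" by auto
      then have "q y = f (p x)" using f sub by auto
      then show ?case using orbit.step[OF x(1)] by simp
    qed
  qed
  have "f x \<in> orbit q (f d)" if "x \<in> orbit p d" for x
    using that
  proof induct
    case base
    show ?case using f[OF d] orbit.base[of q "f d"] by simp
  next
    case (step x)
    then show ?case using f sub orbit.step[of "f x" q "f d"] by auto
  qed
  then show "f ` orbit p d \<subseteq> orbit q (f d)" by auto
qed

text \<open>Only rotation systems are asked for, so that cut maps fit in whether or not they are
  connected.\<close>

locale map_isomorphism =
  fixes f :: "'a \<Rightarrow> 'a" and M M' :: "'a pmap"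
  assumes iso: "is_iso f M M'" and rs: "rotation_system M" and rs': "rotation_system M'"
    and root: "root_dart M \<in> darts M"
begin

lemma bij: "bij_betw f (darts M) (darts M')"
  using iso by (simp add: is_iso_def)

lemma inj: "inj_on f (darts M)" and img: "f ` darts M = darts M'"
  using bij by (auto simp: bij_betw_def)

lemma darts_imageE:
  assumes "y \<in> darts M'"
  obtains x where "x \<in> darts M" "y = f x"
proof -
  have "y \<in> f ` darts M" using assms img by simp
  then show thesis using that by auto
qed

lemma commute:
  "x \<in> darts M \<Longrightarrow> f (rot M x) = rot M' (f x)"
  "x \<in> darts M \<Longrightarrow> f (opp M x) = opp M' (f x)"
  "x \<in> darts M \<Longrightarrow> white M' (f x) = white M x"
  "f (root_dart M) = root_dart M'"
  using iso by (auto simp: is_iso_def)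

lemma closed: "x \<in> darts M \<Longrightarrow> rot M x \<in> darts M" "x \<in> darts M \<Longrightarrow> opp M x \<in> darts M"
  "x \<in> darts M \<Longrightarrow> next_dart M x \<in> darts M" "x \<in> darts M \<Longrightarrow> f x \<in> darts M'"
  using rotation_systemD(5,6)[OF rs] next_dart_in_darts[OF rs] img by auto

lemma commute_next: "x \<in> darts M \<Longrightarrow> f (next_dart M x) = next_dart M' (f x)"
  by (simp add: next_dart_def commute closed)

lemma f_eq_iff: "x \<in> darts M \<Longrightarrow> y \<in> darts M \<Longrightarrow> f x = f y \<longleftrightarrow> x = y"
  using inj by (auto simp: inj_on_def)

lemma fixed_iff: "x \<in> darts M \<Longrightarrow> opp M' (f x) = f x \<longleftrightarrow> opp M x = x"
  using f_eq_iff[of "opp M x" x] closed commute by simp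

lemma half_edges: "half_edges M' = f ` half_edges M"
  "leaves M' = f ` leaves M" "buds M' = f ` buds M" "edge_darts M' = f ` edge_darts M"
  using fixed_iff commute(3) unfolding half_edges_def leaves_def buds_def edge_darts_def img[symmetric]
  by (auto simp: image_iff)

lemma orbits: "x \<in> darts M \<Longrightarrow> orbit (rot M') (f x) = f ` orbit (rot M) x"
  "x \<in> darts M \<Longrightarrow> orbit (next_dart M') (f x) = f ` orbit (next_dart M) x"
  by (rule orbit_image_conj[of x "darts M"]; use closed commute commute_next in simp)+

lemma orbit_subsets: "x \<in> darts M \<Longrightarrow> orbit (rot M) x \<subseteq> darts M" "x \<in> darts M \<Longrightarrow> orbit (next_dart M) x \<subseteq> darts M"
  using orbit_subset_closed[of x "darts M"] closed by blast+

lemma image_inj_on: "S \<subseteq> Pow (darts M) \<Longrightarrow> inj_on ((`) f) S"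
  using inj_on_image_Pow[OF inj] inj_on_subset by blast

lemma cards: "card (vertices M') = card (vertices M)" "card (faces M') = card (faces M)"
  "card (edges M') = card (edges M)"
proof -
  have "vertices M' = (`) f ` vertices M" "faces M' = (`) f ` faces M"
    unfolding vertices_def faces_def img[symmetric] image_image by (auto simp: orbits)
  moreover have "edges M' = (`) f ` edges M"
    unfolding edges_def half_edges(4) image_image
    by (rule image_cong) (auto simp: commute edge_darts_def)
  moreover have "vertices M \<subseteq> Pow (darts M)" "faces M \<subseteq> Pow (darts M)" "edges M \<subseteq> Pow (darts M)"
    using orbit_subsets closed by (auto simp: vertices_def faces_def edges_def edge_darts_def)
  ultimately show "card (vertices M') = card (vertices M)" "card (faces M') = card (faces M)"
    "card (edges M') = card (edges M)"
    using card_image[OF image_inj_on] by metis+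
qed

lemma connected:
  assumes c: "connected_map M"
  shows "connected_map M'"
proof (rule connected_mapI[OF rs'])
  fix A x assume A: "A \<subseteq> darts M'" "x \<in> A" "\<And>x. x \<in> A \<Longrightarrow> rot M' x \<in> A" "\<And>x. x \<in> A \<Longrightarrow> opp M' x \<in> A"
  obtain y where y: "y \<in> darts M" "x = f y" using A darts_imageE by blast
  have "{z \<in> darts M. f z \<in> A} = darts M"
    by (rule connected_mapD[OF rs c, of _ y]) (use y A closed commute in auto)
  then have "f z \<in> A" if "z \<in> darts M" for z using that by blast
  then show "A = darts M'" using A(1) darts_imageE by blast
qed

lemma degree_distribution: "degree_distribution M' = degree_distribution M"
proof -
  have aux: "image_mset card (mset_set (orbit (rot M') ` {d \<in> darts M'. white M' d = c})) =
    image_mset card (mset_set (orbit (rot M) ` {d \<in> darts M. white M d = c}))" for c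
  proof -
    let ?V = "orbit (rot M) ` {d \<in> darts M. white M d = c}"
    have "{d \<in> darts M'. white M' d = c} = f ` {d \<in> darts M. white M d = c}"
      unfolding img[symmetric] using commute(3) by auto
    then have V: "orbit (rot M') ` {d \<in> darts M'. white M' d = c} = (`) f ` ?V"
      by (auto simp: image_image orbits)
    have sub: "?V \<subseteq> Pow (darts M)" using orbit_subsets by auto
    have fin: "finite ?V" using rotation_systemD(1)[OF rs] by simp
    have "card (f ` C) = card C" if "C \<in> ?V" for C
      using that sub by (intro card_image inj_on_subset[OF inj]) auto
    then have "image_mset (\<lambda>C. card (f ` C)) (mset_set ?V) = image_mset card (mset_set ?V)"
      using fin by (intro image_mset_cong) simp
    moreover have "mset_set ((`) f ` ?V) = image_mset ((`) f) (mset_set ?V)"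
      by (rule image_mset_mset_set[OF image_inj_on[OF sub], symmetric])
    ultimately show ?thesis unfolding V by (simp add: multiset.map_comp comp_def)
  qed
  show ?thesis using aux[of True] aux[of False] by (simp add: degree_distribution_def)
qed

lemma is_map_image:
  assumes M: "is_map M"
  shows "is_map M'"
proof -
  have "white M' (rot M' y) = white M' y" if y: "y \<in> darts M'" for y
  proof -
    obtain x where x: "x \<in> darts M" "y = f x" using darts_imageE[OF y] .
    then show ?thesis using M commute(1)[OF x(1)] commute(3)[OF x(1)] commute(3)[OF closed(1)[OF x(1)]]
      by (simp add: is_map_def)
  qed
  moreover have "white M' (opp M' y) \<noteq> white M' y" if y: "y \<in> edge_darts M'" for y
  proof -
    obtain x where x: "x \<in> edge_darts M" "y = f x" using half_edges(4) y by auto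
    then have xd: "x \<in> darts M" by (simp add: edge_darts_def)
    then show ?thesis using M x commute(2)[OF xd] commute(3)[OF xd] commute(3)[OF closed(2)[OF xd]]
      by (simp add: is_map_def)
  qed
  moreover have "half_edges M' \<subseteq> orbit (next_dart M') (root_dart M')"
    using is_mapD(3)[OF M] orbits(2)[OF root] half_edges(1) commute(4) by (auto simp: root_face_def)
  moreover have "root_dart M' \<in> half_edges M'"
    using is_mapD(1)[OF M] half_edges(1) commute(4) by (metis imageI)
  ultimately show ?thesis
    unfolding is_map_def using rs' connected[OF is_mapD(4)[OF M]] is_mapD(5)[OF M] cards
    by (simp add: rotation_system_def)
qed

lemma is_leg_map_image:
  assumes M: "is_leg_map k M"
  shows "is_leg_map k M'"
proof -
  have "card (leaves M') = card (leaves M)"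
    unfolding half_edges by (rule card_image, rule inj_on_subset[OF inj half_edges_split(4)])
  moreover have "root_dart M' \<in> leaves M'"
    using M commute(4) by (metis half_edges(2) imageI is_leg_map_def)
  ultimately show ?thesis using M is_map_image by (simp add: is_leg_map_def half_edges(3))
qed

lemma inverse: "map_isomorphism (inv_into (darts M) f) M' M"
proof
  let ?g = "inv_into (darts M) f"
  have g: "?g (f x) = x" if "x \<in> darts M" for x using inv_into_f_f[OF inj that] .
  show "is_iso ?g M' M"
    unfolding is_iso_def
  proof (intro conjI ballI)
    show "bij_betw ?g (darts M') (darts M)" using bij by (rule bij_betw_inv_into)
    show "?g (root_dart M') = root_dart M" using g[OF root] commute(4) by simp
  next
    fix y assume "y \<in> darts M'"
    then obtain x where x: "x \<in> darts M" "y = f x" by (rule darts_imageE)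
    show "?g (rot M' y) = rot M (?g y)" "?g (opp M' y) = opp M (?g y)" "white M (?g y) = white M' y"
      using x(2) g[OF x(1)] g[OF closed(1)[OF x(1)]] g[OF closed(2)[OF x(1)]]
        commute(1-3)[OF x(1)] by simp_all
  qed
  show "root_dart M' \<in> darts M'" using closed(4)[OF root] commute(4) by simp
qed (rule rs' rs)+

lemma cut:
  assumes d: "d \<in> darts M"
  shows "map_isomorphism f (cut M d) (cut M' (f d))"
proof
  show "is_iso f (cut M d) (cut M' (f d))"
    unfolding is_iso_def
  proof (intro conjI ballI)
    show "f (opp (cut M d) x) = opp (cut M' (f d)) (f x)" if x: "x \<in> darts (cut M d)" for x
    proof -
      have xd: "x \<in> darts M" using x by simp
      have "f x = f d \<longleftrightarrow> x = d" "f x = opp M' (f d) \<longleftrightarrow> x = opp M d"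
        using f_eq_iff[OF xd d] f_eq_iff[OF xd closed(2)[OF d]] commute(2)[OF d] by simp_all
      then show ?thesis using commute(2)[OF xd] commute(2)[OF d] by simp
    qed
  qed (use bij commute in simp_all)
  show "rotation_system (cut M d)" by (rule rotation_system_cut[OF rs d])
  show "rotation_system (cut M' (f d))" by (rule rotation_system_cut[OF rs' closed(4)[OF d]])
  show "root_dart (cut M d) \<in> darts (cut M d)" using root by simp
qed

lemma separating:
  assumes d: "d \<in> darts M"
  shows "separating M' (f d) \<longleftrightarrow> separating M d"
proof -
  interpret C: map_isomorphism f "Defs.cut M d" "Defs.cut M' (f d)" by (rule cut[OF d])
  interpret I: map_isomorphism "inv_into (darts (Defs.cut M d)) f" "Defs.cut M' (f d)" "Defs.cut M d"
    by (rule C.inverse)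
  show ?thesis using C.connected I.connected by (auto simp: separating_def)
qed

end

section \<open>Isomorphic maps have isomorphic walks\<close>

lemma while_option_simulation:
  assumes w: "while_option b c s = Some t" and R: "R s s'"
    and b: "\<And>s s'. R s s' \<Longrightarrow> b s = b' s'" and c: "\<And>s s'. R s s' \<Longrightarrow> R (c s) (c' s')"
  shows "\<exists>t'. while_option b' c' s' = Some t' \<and> R t t'"
proof -
  \<comment> \<open>The related runs have equal guards after each number of steps, so both stop
    after the same number.\<close>
  have Rk: "R ((c ^^ k) s) ((c' ^^ k) s')" for k by (induct k) (use R c in auto)
  then have bk: "b ((c ^^ k) s) = b' ((c' ^^ k) s')" for k using b by blast
  show ?thesis using w Rk unfolding while_option_def bk by (auto split: if_splits)
qed

lemma opening_step_iso:
  assumes iso: "map_isomorphism f N N'" and d: "d \<in> darts N"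
  shows "opening_guard (N, d) = opening_guard (N', f d)"
    "\<exists>K e K'. opening_step (N, d) = (K, e) \<and> opening_step (N', f d) = (K', f e) \<and> map_isomorphism f K K' \<and> e \<in> darts K"
proof -
  interpret map_isomorphism f N N' by (rule iso)
  have e: "x \<in> darts N" if "x \<in> edge_darts N" for x using that by (simp add: edge_darts_def)
  show "opening_guard (N, d) = opening_guard (N', f d)"
    using separating e by (auto simp: half_edges(4))
  have iff: "f d \<in> edge_darts N' \<longleftrightarrow> d \<in> edge_darts N"
    using d fixed_iff[OF d] closed(4)[OF d] by (simp add: edge_darts_def)
  show "\<exists>K e K'. opening_step (N, d) = (K, e) \<and> opening_step (N', f d) = (K', f e) \<and> map_isomorphism f K K' \<and> e \<in> darts K"
    unfolding opening_step_def using iff separating[OF d] commute(3)[OF d] commute_next[OF d] cut[OF d] map_isomorphism_axioms closed(3)[OF d] d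
    by auto
qed

section \<open>The bijections\<close>

lemma closure_balanced_blossom_tree:
  assumes T: "is_blossom_tree T" "total_charge T = 1" "is_balanced T"
  shows "is_leg_map 1 (map_closure T)" "map_opening (map_closure T) = T"
proof -
  have tree: "is_tree T" "is_map T" using T by (auto simp: is_blossom_tree_def is_tree_def)
  have P: "perfect_bracketing T (matching T)" by (rule perfect_bracketing_matching[OF tree(2) T(2,3)])
  interpret bracketed_tree T "matching T"
    using tree P by unfold_locales (auto simp: perfect_bracketing_def)
  show "is_leg_map 1 (map_closure T)" "map_opening (map_closure T) = T"
    using is_leg_map_fuse[OF P] map_opening_fuse blossom_iff_breadth_first[OF P] T(1)
    by (simp_all add: map_closure_eq_fuse)
qed

text \<open>The leg map is the fusion of some tree satisfying \<open>breadth_first\<close>, and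
  opening this fusion returns the tree. The properties of the opening are read off from that tree,
  not from the loop.\<close>

lemma opening_leg_map:
  assumes M: "is_leg_map 1 M"
  shows "is_blossom_tree (map_opening M)" "total_charge (map_opening M) = 1" "is_balanced (map_opening M)"
    "map_closure (map_opening M) = M"
    "\<exists>e. while_option opening_guard opening_step (M, root_dart M) = Some (map_opening M, e)"
proof -
  obtain T Q where T: "is_tree T" "perfect_bracketing T Q" "breadth_first T Q" "fuse T Q = M"
    using leg_map_is_fused[OF M] by auto
  interpret bracketed_tree T Q
    using T by unfold_locales (auto simp: perfect_bracketing_def)
  have o: "map_opening M = T" using map_opening_fuse[OF T(3)] T(4) by simp
  note m = matching_perfect_bracketing[OF is_map T(2)]
  show "is_blossom_tree (map_opening M)" "total_charge (map_opening M) = 1" "is_balanced (map_opening M)"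
    "map_closure (map_opening M) = M"
    using o m blossom_iff_breadth_first[OF T(2)] T(3,4) by (auto simp: map_closure_eq_fuse)
  show "\<exists>e. while_option opening_guard opening_step (M, root_dart M) = Some (map_opening M, e)"
    using while_option_opening_fuse[OF T(3)] T(4) o by simp
qed

lemma map_closure_simps [simp]:
  "darts (map_closure T) = darts T" "rot (map_closure T) = rot T" "white (map_closure T) = white T"
  "root_dart (map_closure T) = root_dart T"
  by (simp_all add: map_closure_def)

text \<open>A step of the walk depends only on data that isomorphisms preserve, so one and the same
  \<open>f\<close> relates the states of both walks up to their common end.\<close>

lemma opening_iso:
  assumes M: "is_leg_map 1 M" and f: "is_iso f M M'" and M': "is_map M'"
  shows "is_leg_map 1 M'" "is_iso f (map_opening M) (map_opening M')"
proof -
  have m: "is_map M" using M by (simp add: is_leg_map_def)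
  interpret map_isomorphism f M M'
    using f is_map_rotation_system[OF m] is_map_rotation_system[OF M'] is_mapD(2)[OF m] by unfold_locales
  show l: "is_leg_map 1 M'" by (rule is_leg_map_image[OF M])
  let ?R = "\<lambda>(N, d) (N', d'). map_isomorphism f N N' \<and> d \<in> darts N \<and> d' = f d"
  obtain e where e: "while_option opening_guard opening_step (M, root_dart M) = Some (map_opening M, e)"
    using opening_leg_map(5)[OF M] by blast
  obtain e' where e': "while_option opening_guard opening_step (M', root_dart M') = Some (map_opening M', e')"
    using opening_leg_map(5)[OF l] by blast
  have "\<exists>t'. while_option opening_guard opening_step (M', root_dart M') = Some t' \<and> ?R (map_opening M, e) t'"
  proof (rule while_option_simulation[OF e])
    show "?R (M, root_dart M) (M', root_dart M')"
      using map_isomorphism_axioms root commute(4) by simp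
    show "opening_guard s = opening_guard s'" if r: "?R s s'" for s s'
    proof -
      obtain N d N' where s: "s = (N, d)" "s' = (N', f d)" "map_isomorphism f N N'" "d \<in> darts N"
        using r by (cases s; cases s') auto
      show ?thesis unfolding s(1,2) by (rule opening_step_iso(1)[OF s(3,4)])
    qed
    show "?R (opening_step s) (opening_step s')" if r: "?R s s'" for s s'
    proof -
      obtain N d N' where s: "s = (N, d)" "s' = (N', f d)" "map_isomorphism f N N'" "d \<in> darts N"
        using r by (cases s; cases s') auto
      show ?thesis using opening_step_iso(2)[OF s(3,4)] s(1,2) by auto
    qed
  qed
  then have "map_isomorphism f (map_opening M) (map_opening M')" using e' by auto
  then show "is_iso f (map_opening M) (map_opening M')" by (simp add: map_isomorphism_def)
qed

text \<open>The isomorphism is transported to the closures, and the opening of the transported closure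
  is the given tree.\<close>

lemma closure_iso:
  assumes T: "is_blossom_tree T" "total_charge T = 1" "is_balanced T" and f: "is_iso f T T'" and T': "is_map T'"
  shows "is_blossom_tree T' \<and> total_charge T' = 1 \<and> is_balanced T'" "is_iso f (map_closure T) (map_closure T')"
proof -
  let ?M = "map_closure T"
  have t: "is_map T" using T(1) by (simp add: is_blossom_tree_def is_tree_def)
  interpret I: map_isomorphism f T T'
    using f is_map_rotation_system[OF t] is_map_rotation_system[OF T'] is_mapD(2)[OF t] by unfold_locales
  have M: "is_leg_map 1 ?M" by (rule closure_balanced_blossom_tree(1)[OF T])
  then have m: "is_map ?M" by (simp add: is_leg_map_def)
  note rsM = is_map_rotation_system[OF m]
  \<comment> \<open>Closure changes only \<open>opp\<close>, so this is all that has to be carried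
    over along \<open>f\<close>; off the darts it must be the identity.\<close>
  define M' where "M' = T'\<lparr>opp := \<lambda>x. if x \<in> darts T' then f (opp ?M (inv_into (darts T) f x)) else x\<rparr>"
  have M's: "darts M' = darts T'" "rot M' = rot T'" "white M' = white T'" "root_dart M' = root_dart T'"
    by (simp_all add: M'_def)
  have oM: "opp ?M x \<in> darts T" if "x \<in> darts T" for x using rotation_systemD(6)[OF rsM, of x] that by simp
  have o: "opp M' (f x) = f (opp ?M x)" if "x \<in> darts T" for x
    using that I.closed(4)[OF that] inv_into_f_f[OF I.inj that] by (simp add: M'_def)
  have out: "opp M' x = x" if "x \<notin> darts T'" for x using that by (simp add: M'_def)
  have inv: "opp M' (opp M' x) = x" for x
  proof (cases "x \<in> darts T'")
    case True
    then obtain y where y: "y \<in> darts T" "x = f y" by (rule I.darts_imageE)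
    then show ?thesis using o[OF y(1)] o[OF oM[OF y(1)]] rotation_systemD(4)[OF rsM] by simp
  qed (simp add: out)
  have "opp M' permutes darts M'"
    unfolding permutes_def M's(1) using inv out by metis
  then have rsM': "rotation_system M'"
    using rotation_systemD(1,2)[OF I.rs'] inv by (simp add: rotation_system_def M's)
  have isoM: "is_iso f ?M M'"
    using I.iso o by (simp add: is_iso_def M's)
  interpret J: map_isomorphism f ?M M'
    using isoM rsM rsM' is_mapD(2)[OF m] by unfold_locales
  have m': "is_map M'" by (rule J.is_map_image[OF m])
  note op = opening_iso[OF M isoM m']
  note O = opening_leg_map[OF op(1)]
  have fields: "darts (map_opening M') = darts M'" "rot (map_opening M') = rot M'"
    "white (map_opening M') = white M'" "root_dart (map_opening M') = root_dart M'"
    using O(4) map_closure_simps[of "map_opening M'"] by metis+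
  have isoT: "is_iso f T (map_opening M')" using op(2) closure_balanced_blossom_tree(2)[OF T] by simp
  have rsO: "rotation_system (map_opening M')"
    using O(1) by (simp add: is_blossom_tree_def is_tree_def is_map_rotation_system)
  \<comment> \<open>On the darts both sides are the image of \<open>opp T\<close> under
    \<open>f\<close>; off the darts both are the identity. Hence the two records are equal and not
    merely isomorphic.\<close>
  have "opp (map_opening M') x = opp T' x" for x
  proof (cases "x \<in> darts T'")
    case True
    then obtain y where "y \<in> darts T" "x = f y" by (rule I.darts_imageE)
    then show ?thesis using isoT I.iso by (simp add: is_iso_def)
  next
    case False
    then show ?thesis
      using permutes_not_in[OF rotation_systemD(3)[OF rsO]] permutes_not_in[OF rotation_systemD(3)[OF I.rs']]
      by (simp add: fields M's)
  qed
  then have eq: "map_opening M' = T'"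
    by (intro pmap.equality) (auto simp: fields M's)
  show "is_blossom_tree T' \<and> total_charge T' = 1 \<and> is_balanced T'" using O(1-3) eq by simp
  show "is_iso f ?M (map_closure T')" using O(4) eq isoM by simp
qed

section \<open>Passing to isomorphism classes\<close>

lemma on_classes_representative:
  assumes A: "\<And>x x'. x \<in> A \<Longrightarrow> (x, x') \<in> map_iso \<Longrightarrow> (F x, F x') \<in> map_iso" "A \<subseteq> Collect is_map" and x: "x \<in> A"
  shows "on_classes F (map_iso `` {x}) = map_iso `` {F x}"
proof -
  have xx: "(x, x) \<in> map_iso"
    using equiv_class_self[OF equiv_map_iso, of x] A(2) x by auto
  have tr: "trans (map_iso :: ('a pmap \<times> 'a pmap) set)" using equiv_map_iso by (rule equivE)
  show ?thesis unfolding on_classes_def using A(1)[OF x] xx transD[OF tr] by blast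
qed

text \<open>The hypotheses are symmetric in the two sides, so the same result serves for closure
  and, with the roles exchanged, for opening.\<close>

lemma bij_betw_on_classes:
  assumes A: "A \<subseteq> Collect is_map" "\<And>x. x \<in> A \<Longrightarrow> F x \<in> B \<and> G (F x) = x"
      "\<And>x x'. x \<in> A \<Longrightarrow> (x, x') \<in> map_iso \<Longrightarrow> x' \<in> A \<and> (F x, F x') \<in> map_iso"
    and B: "B \<subseteq> Collect is_map" "\<And>y. y \<in> B \<Longrightarrow> G y \<in> A \<and> F (G y) = y"
      "\<And>y y'. y \<in> B \<Longrightarrow> (y, y') \<in> map_iso \<Longrightarrow> y' \<in> B \<and> (G y, G y') \<in> map_iso"
  shows "bij_betw (on_classes F) (A // map_iso) (B // map_iso)"
    "C \<in> A // map_iso \<Longrightarrow> T \<in> C \<Longrightarrow> F T \<in> on_classes F C"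
    "C \<in> A // map_iso \<Longrightarrow> on_classes G (on_classes F C) = C"
proof -
  have F: "on_classes F (map_iso `` {x}) = map_iso `` {F x}" if "x \<in> A" for x
    by (rule on_classes_representative[OF _ A(1) that]) (use A(3) in blast)
  have G: "on_classes G (map_iso `` {y}) = map_iso `` {G y}" if "y \<in> B" for y
    by (rule on_classes_representative[OF _ B(1) that]) (use B(3) in blast)
  have GF: "on_classes G (on_classes F C) = C" if C: "C \<in> A // map_iso" for C
  proof -
    obtain x where "x \<in> A" "C = map_iso `` {x}" using C by (auto elim: quotientE)
    then show ?thesis using F G A(2) by simp
  qed
  have FG: "on_classes F (on_classes G C) = C" if C: "C \<in> B // map_iso" for C
  proof -
    obtain x where "x \<in> B" "C = map_iso `` {x}" using C by (auto elim: quotientE)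
    then show ?thesis using F G B(2) by simp
  qed
  show "bij_betw (on_classes F) (A // map_iso) (B // map_iso)"
  proof (rule bij_betw_byWitness[where f' = "on_classes G"])
    show "on_classes F ` (A // map_iso) \<subseteq> B // map_iso"
    proof
      fix D assume "D \<in> on_classes F ` (A // map_iso)"
      then obtain x where "x \<in> A" "D = on_classes F (map_iso `` {x})" by (auto elim!: quotientE)
      then show "D \<in> B // map_iso" using F A(2) by (auto intro: quotientI)
    qed
    show "on_classes G ` (B // map_iso) \<subseteq> A // map_iso"
    proof
      fix D assume "D \<in> on_classes G ` (B // map_iso)"
      then obtain x where "x \<in> B" "D = on_classes G (map_iso `` {x})" by (auto elim!: quotientE)
      then show "D \<in> A // map_iso" using G B(2) by (auto intro: quotientI)
    qed
  qed (use GF FG in auto)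
  show "C \<in> A // map_iso \<Longrightarrow> on_classes G (on_classes F C) = C" by (rule GF)
  show "F T \<in> on_classes F C" if C: "C \<in> A // map_iso" and T: "T \<in> C"
  proof -
    obtain x where x: "x \<in> A" "C = map_iso `` {x}" using C by (auto elim: quotientE)
    then show ?thesis using F[OF x(1)] A(3)[OF x(1), of T] T by auto
  qed
qed

lemma degree_distribution_iso:
  assumes "(M, N) \<in> map_iso"
  shows "degree_distribution N = degree_distribution M"
proof -
  obtain f where f: "is_iso f M N" "is_map M" "is_map N" using assms by (auto simp: map_iso_def)
  interpret map_isomorphism f M N
    using f is_map_rotation_system is_mapD(2) by unfold_locales auto
  show ?thesis by (rule degree_distribution)
qed

lemma degree_distribution_on_classes:
  assumes C: "C \<in> A // map_iso" and T: "T \<in> C" and N: "N \<in> on_classes F C"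
    and F: "\<And>x. x \<in> C \<Longrightarrow> degree_distribution (F x) = degree_distribution x"
  shows "degree_distribution N = degree_distribution T"
proof -
  obtain x where x: "C = map_iso `` {x}" using C by (auto elim: quotientE)
  obtain y where y: "y \<in> C" "(F y, N) \<in> map_iso" using N by (auto simp: on_classes_def)
  have "degree_distribution z = degree_distribution x" if "z \<in> C" for z
    using that x degree_distribution_iso by auto
  then show ?thesis using degree_distribution_iso[OF y(2)] F[OF y(1)] y(1) T by simp
qed

lemma degree_distribution_map_closure: "degree_distribution (map_closure T) = degree_distribution T"
  by (simp add: degree_distribution_def)

theorem theorem7:
  shows "bij_betw (on_classes map_closure) (balanced_blossom_trees 1) (leg_maps 1) \<and>
    bij_betw (on_classes map_opening) (leg_maps 1) (balanced_blossom_trees 1) \<and>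
    (\<forall>C \<in> balanced_blossom_trees 1. \<forall>T \<in> C. map_closure T \<in> on_classes map_closure C) \<and>
    (\<forall>D \<in> leg_maps 1. \<forall>M \<in> D. map_opening M \<in> on_classes map_opening D) \<and>
    (\<forall>C \<in> balanced_blossom_trees 1. on_classes map_opening (on_classes map_closure C) = C) \<and>
    (\<forall>D \<in> leg_maps 1. on_classes map_closure (on_classes map_opening D) = D) \<and>
    (\<forall>C \<in> balanced_blossom_trees 1. \<forall>T \<in> C. \<forall>M \<in> on_classes map_closure C.
       degree_distribution M = degree_distribution T) \<and>
    (\<forall>D \<in> leg_maps 1. \<forall>M \<in> D. \<forall>T \<in> on_classes map_opening D.
       degree_distribution T = degree_distribution M)"
proof -
  let ?A = "{T :: nat pmap. is_blossom_tree T \<and> total_charge T = 1 \<and> is_balanced T}"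
  let ?B = "{M :: nat pmap. is_leg_map 1 M}"
  have A1: "?A \<subseteq> Collect is_map" by (auto simp: is_blossom_tree_def is_tree_def)
  have A2: "map_closure T \<in> ?B \<and> map_opening (map_closure T) = T" if "T \<in> ?A" for T
    using that closure_balanced_blossom_tree by blast
  have A3: "T' \<in> ?A \<and> (map_closure T, map_closure T') \<in> map_iso" if T: "T \<in> ?A" "(T, T') \<in> map_iso" for T T'
  proof -
    obtain f where "is_iso f T T'" "is_map T'" using T(2) by (auto simp: map_iso_def)
    then have "T' \<in> ?A" "is_iso f (map_closure T) (map_closure T')" using closure_iso T(1) by blast+
    then show ?thesis using A2[OF T(1)] A2[of T'] by (auto simp: map_iso_def is_leg_map_def)
  qed
  have B1: "?B \<subseteq> Collect is_map" by (auto simp: is_leg_map_def)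
  have B2: "map_opening M \<in> ?A \<and> map_closure (map_opening M) = M" if "M \<in> ?B" for M
    using that opening_leg_map by blast
  have B3: "M' \<in> ?B \<and> (map_opening M, map_opening M') \<in> map_iso" if M: "M \<in> ?B" "(M, M') \<in> map_iso" for M M'
  proof -
    obtain f where "is_iso f M M'" "is_map M'" using M(2) by (auto simp: map_iso_def)
    then have "M' \<in> ?B" "is_iso f (map_opening M) (map_opening M')" using opening_iso M(1) by blast+
    moreover from this have "is_map (map_opening M)" "is_map (map_opening M')" using B2 M(1) A1 by blast+
    ultimately show ?thesis by (auto simp: map_iso_def)
  qed
  have sets: "balanced_blossom_trees 1 = ?A // map_iso" "leg_maps 1 = ?B // map_iso"
    by (simp_all add: balanced_blossom_trees_def leg_maps_def)
  note cl = bij_betw_on_classes[OF A1 A2 A3 B1 B2 B3]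
  note op = bij_betw_on_classes[OF B1 B2 B3 A1 A2 A3]
  have dB: "degree_distribution (map_opening M) = degree_distribution M" if D: "D \<in> ?B // map_iso" "M \<in> D" for D M
  proof -
    obtain x where "x \<in> ?B" "D = map_iso `` {x}" using D(1) by (auto elim: quotientE)
    then have "M \<in> ?B" using B3 D(2) by blast
    \<comment> \<open>\<open>M\<close> is the closure of its opening, and closure keeps vertices and
      colours, so the degrees of the opening are those of \<open>M\<close>.\<close>
    then show ?thesis using B2 degree_distribution_map_closure by metis
  qed
  show ?thesis
    unfolding sets
  proof (intro conjI ballI)
    show "degree_distribution M = degree_distribution T"
      if "C \<in> ?A // map_iso" "T \<in> C" "M \<in> on_classes map_closure C" for C T M
      by (rule degree_distribution_on_classes[OF that degree_distribution_map_closure])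
    show "degree_distribution T = degree_distribution M"
      if "D \<in> ?B // map_iso" "M \<in> D" "T \<in> on_classes map_opening D" for D T M
      by (rule degree_distribution_on_classes[OF that dB[OF that(1)]])
  qed (rule cl(1) op(1) cl(2) op(2) cl(3) op(3); assumption)+
qed

end
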